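(* Let $H$ be a coalgebra and $n\ge0$. The Chern–Simons map $$CS:I_n(H)_\natural\longrightarrow W_n(H)_\natural[1],\qquad [x]\mapsto[\mathcal{K}(x)]$$ (where $\mathcal{K}:W(H)\to W(H)$ is the degree $-1$ Chern–Simons contraction) induces an isomorphism $H^*(I_n(H)_\natural)\to H^{*-1}(W_n(H)_\natural)$, compatible with the $S$-operators.
   Context: $H$ is a coalgebra over $\mathbb{C}$ with $\Delta(h)=\sum h_0\otimes h_1$. Its Weil algebra $W(H)$ is the non-commutative, non-unital DG algebra freely generated by symbols $h$ of degree 1 and $\omega_h$ of degree 2, linear in $h\in H$, with differential the (graded) derivation $\partial$ given by $\partial(h)=\omega_h-\sum h_0h_1$, $\partial(\omega_h)=\sum\omega_{h_0}h_1-\sum h_0\omega_{h_1}$. $I(H)$ is the ideal generated by the curvatures $\omega_h$; $I_n(H)=I(H)^{n+1}$ (with $I(H)^0$ meaning $W(H)$ with unit adjoined), $W_n(H)=W(H)/I(H)^{n+1}$. With graded commutators, $W_n(H)_\natural=W_n(H)/[W_n(H),W_n(H)]$ and $I_n(H)_\natural=I_n(H)/[I(H),I_{n-1}(H)]$. Contraction: let $\Omega(1)=\mathbb{C}[t]\oplus\mathbb{C}[t]dt$ be the algebraic de Rham complex of the line. A linear map $\phi:H\to\Omega^1$ into the degree 1 part of a DG algebra $\Omega$ determines a unique DG algebra map $W(H)\to\Omega$ with $h\mapsto\phi(h)$, $\omega_h\mapsto d\phi(h)+\sum\phi(h_0)\phi(h_1)$. Take $\Omega=W(H)\otimes\Omega(1)$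 (graded tensor product), $\phi(h)=h\otimes t$, and compose the resulting map with the degree $-1$ integration map $W(H)\otimes\Omega(1)\to W(H)$, $x\otimes f\mapsto0$, $x\otimes f\,dt\mapsto(-1)^{|x|}(\int_0^1f\,dt)\,x$; this is $\mathcal{K}$. It satisfies $\partial\mathcal{K}+\mathcal{K}\partial=\mathrm{Id}$. $S$-operator: write $\partial=\partial_0+d$ where $\partial_0,d$ are the derivations with $\partial_0(h)=-\sum h_0h_1$, $\partial_0(\omega_h)=\sum\omega_{h_0}h_1-\sum h_0\omega_{h_1}$, $d(h)=\omega_h$, $d(\omega_h)=0$. For a generator $a$ (of the form $h$ or $\omega_h$) let $t(ax)=(-1)^{|a||x|}xa$, $b_t(ax)=t(\partial_0(a)x)$, $b=\partial+b_t$; on monomials that are products of $p$ generators $N=1+t+\cdots+t^{p-1}$. These operators preserve the powers of $I(H)$. For $Y=W_n(H)$ or $I_n(H)$ there is an exact sequence of complexes $0\to Y_\natural\xrightarrow{N}(Y,b)\xrightarrow{t-1}(Y,\partial)\to Y_\natural\to0$, and $S:H^*(Y_\natural)\to H^{*+2}(Y_\natural)$ is the operator it induces: represent a class by $\natural(u)$ with $u\in Y$, solve $\partial u=(t-1)v$, $bv=N(w)$, and put $S[\natural(u)]=[\natural(w)]$ ($\natural$ the projection $Y\to Y_\natural$). Compatible means that the isomorphism commutes with $S$. *)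

theory Defs
  imports Complex_Main "HOL-Library.Poly_Mapping" "HOL-Library.Product_Plus"
begin

section \<open>Complex vector spaces\<close>

class scaleC =
  fixes scaleC :: "complex \<Rightarrow> 'a \<Rightarrow> 'a"  (infixr \<open>*\<^sub>C\<close> 75)

class complex_vector = scaleC + ab_group_add +
  assumes scaleC_add_right: "a *\<^sub>C (x + y) = a *\<^sub>C x + a *\<^sub>C y"
    and scaleC_add_left: "(a + b) *\<^sub>C x = a *\<^sub>C x + b *\<^sub>C x"
    and scaleC_scaleC: "a *\<^sub>C (b *\<^sub>C x) = (a * b) *\<^sub>C x"
    and scaleC_one: "1 *\<^sub>C x = x"

global_interpretation complex_vector: vector_space "scaleC :: complex \<Rightarrow> 'a \<Rightarrow> 'a::complex_vector"
  by unfold_locales (fact scaleC_add_right scaleC_add_left scaleC_scaleC scaleC_one)+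

abbreviation clinear :: "('a::complex_vector \<Rightarrow> 'b::complex_vector) \<Rightarrow> bool"
  where "clinear \<equiv> Vector_Spaces.linear scaleC scaleC"

instantiation complex :: complex_vector
begin
definition scaleC_complex :: "complex \<Rightarrow> complex \<Rightarrow> complex" where "scaleC_complex = (*)"
instance by standard (simp_all add: scaleC_complex_def algebra_simps)
end

instantiation prod :: (complex_vector, complex_vector) complex_vector
begin
definition scaleC_prod :: "complex \<Rightarrow> 'a \<times> 'b \<Rightarrow> 'a \<times> 'b"
  where "scaleC_prod c p = (c *\<^sub>C fst p, c *\<^sub>C snd p)"
instance
  by standard
    (simp_all add: scaleC_prod_def prod_eq_iff scaleC_add_right scaleC_add_left scaleC_scaleC scaleC_one)
end

instantiation poly_mapping :: (type, complex_vector) complex_vector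
begin
lift_definition scaleC_poly_mapping :: "complex \<Rightarrow> ('a \<Rightarrow>\<^sub>0 'b) \<Rightarrow> 'a \<Rightarrow>\<^sub>0 'b"
  is "\<lambda>c f k. c *\<^sub>C f k"
  by (rule finite_subset, blast, auto)
instance
  by standard (transfer; simp add: scaleC_add_right scaleC_add_left scaleC_scaleC scaleC_one)+
end


section \<open>The tensor algebra of a complex vector space\<close>

text \<open>
  Words in the letters \<open>'v\<close> form the free monoid, written additively so that
  \<open>'v tword \<Rightarrow>\<^sub>0 complex\<close> with the library's convolution product is the free unital
  algebra on the set \<open>'v\<close>. The tensor algebra is its quotient by the relations saying that
  letters depend linearly on the vector.
\<close>

datatype 'v tword = TWord (tletters: "'v list")

instantiation tword :: (type) monoid_add
begin
definition zero_tword :: "'a tword" where "zero_tword = TWord []"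
definition plus_tword :: "'a tword \<Rightarrow> 'a tword \<Rightarrow> 'a tword"
  where "plus_tword v w = TWord (tletters v @ tletters w)"
instance by standard (simp_all add: zero_tword_def plus_tword_def)
end

type_synonym 'v free_algebra = "'v tword \<Rightarrow>\<^sub>0 complex"

definition letter :: "'v \<Rightarrow> 'v free_algebra"
  where "letter v = Poly_Mapping.single (TWord [v]) 1"

inductive_set tensor_ideal :: "'v::complex_vector free_algebra set"
where
  zero: "0 \<in> tensor_ideal"
| plus: "x \<in> tensor_ideal \<Longrightarrow> y \<in> tensor_ideal \<Longrightarrow> x + y \<in> tensor_ideal"
| additive: "x * (letter (v + w) - letter v - letter w) * y \<in> tensor_ideal"
| homogeneous: "x * (letter (c *\<^sub>C v) - c *\<^sub>C letter v) * y \<in> tensor_ideal"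

lemma tensor_ideal_mult_left: "z \<in> tensor_ideal \<Longrightarrow> a * z \<in> tensor_ideal"
proof (induction rule: tensor_ideal.induct)
  case (additive x v w y)
  show ?case using tensor_ideal.additive[of "a * x" v w y] by (simp only: mult.assoc)
next
  case (homogeneous x c v y)
  show ?case using tensor_ideal.homogeneous[of "a * x" c v y] by (simp only: mult.assoc)
qed (auto simp: distrib_left intro: tensor_ideal.intros)

lemma tensor_ideal_mult_right: "z \<in> tensor_ideal \<Longrightarrow> z * a \<in> tensor_ideal"
proof (induction rule: tensor_ideal.induct)
  case (additive x v w y)
  show ?case using tensor_ideal.additive[of x v w "y * a"] by (simp only: mult.assoc)
next
  case (homogeneous x c v y)
  show ?case using tensor_ideal.homogeneous[of x c v "y * a"] by (simp only: mult.assoc)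
qed (auto simp: distrib_right intro: tensor_ideal.intros)

lemma tensor_ideal_uminus: "z \<in> tensor_ideal \<Longrightarrow> - z \<in> tensor_ideal"
  using tensor_ideal_mult_left[of z "-1"] by simp

lemma poly_mapping_add_induct [case_names zero single add]:
  fixes x :: "'a \<Rightarrow>\<^sub>0 'b::comm_monoid_add"
  assumes "P 0" "\<And>k v. P (Poly_Mapping.single k v)" "\<And>x y. P x \<Longrightarrow> P y \<Longrightarrow> P (x + y)"
  shows "P x"
proof -
  have "x = (\<Sum>k\<in>Poly_Mapping.keys x. Poly_Mapping.single k (Poly_Mapping.lookup x k))"
    by (rule poly_mapping_eqI)
      (simp add: lookup_sum lookup_single when_def sum.delta not_in_keys_iff_lookup_eq_zero)
  moreover have "P (\<Sum>k\<in>K. Poly_Mapping.single k (Poly_Mapping.lookup x k))" for K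
    by (induction K rule: infinite_finite_induct) (simp_all add: assms)
  ultimately show ?thesis by metis
qed

lemma scaleC_free_algebra: "c *\<^sub>C x = Poly_Mapping.single 0 c * x" for x :: "'v free_algebra"
proof (induction x rule: poly_mapping_add_induct)
  case (single k v)
  show ?case
    by (rule poly_mapping_eqI)
      (simp add: mult_single scaleC_poly_mapping.rep_eq lookup_single when_def scaleC_complex_def)
qed (simp_all add: scaleC_add_right distrib_left)

lemma lookup_mult_empty_word:
  fixes x y :: "'v free_algebra"
  shows "Poly_Mapping.lookup (x * y) 0 = Poly_Mapping.lookup x 0 * Poly_Mapping.lookup y 0"
proof (induction x rule: poly_mapping_add_induct)
  case (single k a)
  show ?case
  proof (induction y rule: poly_mapping_add_induct)
    case (single l b)
    have "k + l = 0 \<longleftrightarrow> k = 0 \<and> l = 0"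
      by (cases k; cases l) (simp add: zero_tword_def plus_tword_def)
    then show ?case by (simp add: mult_single lookup_single when_def)
  qed (simp_all add: lookup_add distrib_left)
qed (simp_all add: lookup_add distrib_right)

lemma lookup_letter_empty_word: "Poly_Mapping.lookup (letter v) 0 = 0"
  by (simp add: letter_def lookup_single when_def zero_tword_def)

lemma tensor_ideal_lookup_empty_word: "x \<in> tensor_ideal \<Longrightarrow> Poly_Mapping.lookup x 0 = 0"
  by (induction rule: tensor_ideal.induct)
    (simp_all add: lookup_add lookup_minus lookup_mult_empty_word lookup_letter_empty_word
      scaleC_poly_mapping.rep_eq)

lemma tensor_ideal_scaleC: "z \<in> tensor_ideal \<Longrightarrow> c *\<^sub>C z \<in> tensor_ideal"
  by (simp only: scaleC_free_algebra tensor_ideal_mult_left)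

quotient_type (overloaded) 'v tensor_algebra = "'v::complex_vector free_algebra" /
  "\<lambda>x y. x - y \<in> tensor_ideal"
proof (rule equivpI)
  show "reflp (\<lambda>x y :: 'v free_algebra. x - y \<in> tensor_ideal)"
    by (simp add: reflp_def tensor_ideal.zero)
  show "symp (\<lambda>x y :: 'v free_algebra. x - y \<in> tensor_ideal)"
    using tensor_ideal_uminus by (fastforce simp: symp_def)
  show "transp (\<lambda>x y :: 'v free_algebra. x - y \<in> tensor_ideal)"
    using tensor_ideal.plus by (fastforce simp: transp_def)
qed

instantiation tensor_algebra :: (complex_vector) "{ring_1, complex_vector}"
begin

lift_definition zero_tensor_algebra :: "'a tensor_algebra" is 0 .
lift_definition one_tensor_algebra :: "'a tensor_algebra" is 1 .
lift_definition plus_tensor_algebra :: "'a tensor_algebra \<Rightarrow> 'a tensor_algebra \<Rightarrow> 'a tensor_algebra"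
  is "(+)"
  using tensor_ideal.plus by (fastforce simp: algebra_simps)
lift_definition uminus_tensor_algebra :: "'a tensor_algebra \<Rightarrow> 'a tensor_algebra" is uminus
  using tensor_ideal_uminus by fastforce
lift_definition minus_tensor_algebra :: "'a tensor_algebra \<Rightarrow> 'a tensor_algebra \<Rightarrow> 'a tensor_algebra"
  is "(-)"
proof -
  fix x x' y y' :: "'a free_algebra"
  assume "x - x' \<in> tensor_ideal" "y - y' \<in> tensor_ideal"
  then have "(x - x') + - (y - y') \<in> tensor_ideal"
    by (intro tensor_ideal.plus tensor_ideal_uminus)
  then show "x - y - (x' - y') \<in> tensor_ideal" by (simp add: algebra_simps)
qed
lift_definition times_tensor_algebra :: "'a tensor_algebra \<Rightarrow> 'a tensor_algebra \<Rightarrow> 'a tensor_algebra"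
  is "(*)"
proof -
  fix x x' y y' :: "'a free_algebra"
  assume "x - x' \<in> tensor_ideal" "y - y' \<in> tensor_ideal"
  then have "(x - x') * y + x' * (y - y') \<in> tensor_ideal"
    by (intro tensor_ideal.plus tensor_ideal_mult_left tensor_ideal_mult_right)
  then show "x * y - x' * y' \<in> tensor_ideal" by (simp add: algebra_simps)
qed
lift_definition scaleC_tensor_algebra :: "complex \<Rightarrow> 'a tensor_algebra \<Rightarrow> 'a tensor_algebra"
  is scaleC
  by (metis complex_vector.scale_right_diff_distrib tensor_ideal_scaleC)

instance
proof
  show "(0 :: 'a tensor_algebra) \<noteq> 1"
    by transfer (auto dest: tensor_ideal_lookup_empty_word simp: lookup_minus lookup_one)
qed (transfer; simp add: algebra_simps tensor_ideal.zero scaleC_add_right scaleC_add_left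
      scaleC_scaleC scaleC_one)+

end

lift_definition tgen :: "'v \<Rightarrow> 'v::complex_vector tensor_algebra" is letter .


section \<open>Coalgebras\<close>

text \<open>
  \<open>H \<otimes> H\<close> and \<open>H \<otimes> H \<otimes> H\<close> are the homogeneous parts of tensor degree 2 and 3 of the tensor
  algebra of \<open>H\<close>. So a comultiplication is a linear map into the tensor algebra with values
  in the part of degree 2, and for a bilinear \<open>F\<close> the term \<open>sweedler \<Delta> F h\<close> is the sum of
  \<open>F h\<^sub>0 h\<^sub>1\<close> over any representation of \<open>\<Delta> h\<close> as a finite sum of \<open>h\<^sub>0 \<otimes> h\<^sub>1\<close>.
\<close>

definition tensor2 :: "'h::complex_vector tensor_algebra set"
  where "tensor2 = complex_vector.span {tgen a * tgen b | a b. True}"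

definition sweedler ::
  "('h::complex_vector \<Rightarrow> 'h tensor_algebra) \<Rightarrow> ('h \<Rightarrow> 'h \<Rightarrow> 'b::complex_vector) \<Rightarrow> 'h \<Rightarrow> 'b"
  where "sweedler \<Delta> F h =
    (THE s. \<forall>ps. \<Delta> h = (\<Sum>(a, b)\<leftarrow>ps. tgen a * tgen b) \<longrightarrow> s = (\<Sum>(a, b)\<leftarrow>ps. F a b))"

locale coalgebra =
  fixes \<Delta> :: "'h::complex_vector \<Rightarrow> 'h tensor_algebra" and \<epsilon> :: "'h \<Rightarrow> complex"
  assumes linear_comult: "clinear \<Delta>"
    and comult_range: "\<Delta> h \<in> tensor2"
    and linear_counit: "clinear \<epsilon>"
    and coassoc: "sweedler \<Delta> (\<lambda>a b. \<Delta> a * tgen b) h = sweedler \<Delta> (\<lambda>a b. tgen a * \<Delta> b) h"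
    and counit_left: "sweedler \<Delta> (\<lambda>a b. \<epsilon> a *\<^sub>C b) h = h"
    and counit_right: "sweedler \<Delta> (\<lambda>a b. \<epsilon> b *\<^sub>C a) h = h"


section \<open>The Weil algebra\<close>

text \<open>
  The algebra freely generated by symbols \<open>h\<close> and \<open>\<omega>\<^sub>h\<close>, both linear in \<open>h\<close>, is the tensor algebra
  of \<open>H \<oplus> H\<close>. The type is the Weil algebra with a unit adjoined; \<open>W(H)\<close> itself is
  the set \<open>weil\<close>, spanned by the nonempty monomials. Linear operators on the type are determined by
  their values on monomials, so those below are given by definite descriptions.
\<close>

type_synonym 'h weil1 = "('h \<times> 'h) tensor_algebra"

datatype 'h wgen = Con 'h | Cur 'h

fun gval :: "'h::complex_vector wgen \<Rightarrow> 'h weil1" where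
  "gval (Con h) = tgen (h, 0)"
| "gval (Cur h) = tgen (0, h)"

fun gdeg :: "'h wgen \<Rightarrow> int" where
  "gdeg (Con h) = 1"
| "gdeg (Cur h) = 2"

abbreviation con :: "'h::complex_vector \<Rightarrow> 'h weil1" where "con h \<equiv> gval (Con h)"
abbreviation cur :: "'h::complex_vector \<Rightarrow> 'h weil1" (\<open>\<omega>\<close>) where "cur h \<equiv> gval (Cur h)"

definition monomial :: "'h::complex_vector wgen list \<Rightarrow> 'h weil1"
  where "monomial as = prod_list (map gval as)"

definition mdeg :: "'h wgen list \<Rightarrow> int"
  where "mdeg as = sum_list (map gdeg as)"

definition weil :: "'h::complex_vector weil1 set"
  where "weil = complex_vector.span {monomial as | as. as \<noteq> []}"

definition weil_comp :: "int \<Rightarrow> 'h::complex_vector weil1 set"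
  where "weil_comp k = complex_vector.span {monomial as | as. mdeg as = k}"

definition ksign :: "int \<Rightarrow> complex"
  where "ksign k = (if even k then 1 else - 1)"

definition graded_derivation :: "('h::complex_vector weil1 \<Rightarrow> 'h weil1) \<Rightarrow> bool"
  where "graded_derivation D \<longleftrightarrow> clinear D \<and>
    (\<forall>k. \<forall>x\<in>weil_comp k. \<forall>y. D (x * y) = D x * y + ksign k *\<^sub>C (x * D y))"

definition weil_derivation ::
  "('h::complex_vector \<Rightarrow> 'h weil1) \<Rightarrow> ('h \<Rightarrow> 'h weil1) \<Rightarrow> 'h weil1 \<Rightarrow> 'h weil1"
  where "weil_derivation f g =
    (THE D. graded_derivation D \<and> (\<forall>h. D (con h) = f h) \<and> (\<forall>h. D (\<omega> h) = g h))"

context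
  fixes \<Delta> :: "'h::complex_vector \<Rightarrow> 'h tensor_algebra"
begin

definition weil_diff :: "'h weil1 \<Rightarrow> 'h weil1"
  where "weil_diff = weil_derivation
    (\<lambda>h. \<omega> h - sweedler \<Delta> (\<lambda>a b. con a * con b) h)
    (\<lambda>h. sweedler \<Delta> (\<lambda>a b. \<omega> a * con b) h - sweedler \<Delta> (\<lambda>a b. con a * \<omega> b) h)"

definition weil_diff0 :: "'h weil1 \<Rightarrow> 'h weil1"
  where "weil_diff0 = weil_derivation
    (\<lambda>h. - sweedler \<Delta> (\<lambda>a b. con a * con b) h)
    (\<lambda>h. sweedler \<Delta> (\<lambda>a b. \<omega> a * con b) h - sweedler \<Delta> (\<lambda>a b. con a * \<omega> b) h)"

end

definition curv_ideal :: "'h::complex_vector weil1 set"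
  where "curv_ideal = complex_vector.span {x * \<omega> h * y | x h y. True}"

primrec curv_power :: "nat \<Rightarrow> 'h::complex_vector weil1 set" where
  "curv_power 0 = UNIV"
| "curv_power (Suc m) = complex_vector.span {x * y | x y. x \<in> curv_ideal \<and> y \<in> curv_power m}"


subsection \<open>The cyclic operators\<close>

text \<open>
  The cyclic operators only concern nonempty monomials. To determine them on
  the whole type they are made to vanish on the adjoined unit.
\<close>

definition cyc_t :: "'h::complex_vector weil1 \<Rightarrow> 'h weil1"
  where "cyc_t = (THE T. clinear T \<and> T 1 = 0 \<and>
    (\<forall>a k. \<forall>x\<in>weil_comp k. T (gval a * x) = ksign (gdeg a * k) *\<^sub>C (x * gval a)))"

definition cyc_bt :: "('h::complex_vector \<Rightarrow> 'h tensor_algebra) \<Rightarrow> 'h weil1 \<Rightarrow> 'h weil1"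
  where "cyc_bt \<Delta> = (THE B. clinear B \<and> B 1 = 0 \<and>
    (\<forall>a x. B (gval a * x) = cyc_t (weil_diff0 \<Delta> (gval a) * x)))"

definition cyc_b :: "('h::complex_vector \<Rightarrow> 'h tensor_algebra) \<Rightarrow> 'h weil1 \<Rightarrow> 'h weil1"
  where "cyc_b \<Delta> x = weil_diff \<Delta> x + cyc_bt \<Delta> x"

definition cyc_N :: "'h::complex_vector weil1 \<Rightarrow> 'h weil1"
  where "cyc_N = (THE N. clinear N \<and>
    (\<forall>as. N (monomial as) = (\<Sum>i<length as. (cyc_t ^^ i) (monomial as))))"


subsection \<open>The Chern--Simons contraction\<close>

text \<open>
  Elements of \<open>W(H) \<otimes> \<Omega>(1)\<close> (with a unit adjoined to \<open>W(H)\<close>) are written as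
  \<open>\<Sum> p\<^sub>k \<otimes> t\<^sup>k + \<Sum> q\<^sub>k \<otimes> t\<^sup>k dt\<close> and represented by the pair \<open>(p, q)\<close> of polynomials in the central
  variable \<open>t\<close>. Moving \<open>dt\<close>, or the differential of \<open>\<Omega>(1)\<close>, past \<open>x \<in> W(H)\<close> costs the sign \<open>(-1)\<^bsup>|x|\<^esup>\<close>.
\<close>

type_synonym 'h weil_forms = "(nat \<Rightarrow>\<^sub>0 'h weil1) \<times> (nat \<Rightarrow>\<^sub>0 'h weil1)"

definition weil_sign :: "'h::complex_vector weil1 \<Rightarrow> 'h weil1"
  where "weil_sign = (THE \<sigma>. clinear \<sigma> \<and> (\<forall>k. \<forall>x\<in>weil_comp k. \<sigma> x = ksign k *\<^sub>C x))"

definition forms_mult :: "'h::complex_vector weil_forms \<Rightarrow> 'h weil_forms \<Rightarrow> 'h weil_forms"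
  where "forms_mult a b = (case (a, b) of ((p, q), (p', q')) \<Rightarrow>
    (p * p', p * q' + q * Poly_Mapping.map weil_sign p'))"

definition t_deriv :: "(nat \<Rightarrow>\<^sub>0 'h::complex_vector weil1) \<Rightarrow> nat \<Rightarrow>\<^sub>0 'h weil1"
  where "t_deriv p = (\<Sum>k\<in>Poly_Mapping.keys p.
    Poly_Mapping.single (k - 1) (of_nat k *\<^sub>C Poly_Mapping.lookup p k))"

definition forms_diff ::
  "('h::complex_vector \<Rightarrow> 'h tensor_algebra) \<Rightarrow> 'h weil_forms \<Rightarrow> 'h weil_forms"
  where "forms_diff \<Delta> a = (case a of (p, q) \<Rightarrow>
    (Poly_Mapping.map (weil_diff \<Delta>) p,
     Poly_Mapping.map (weil_diff \<Delta>) q + t_deriv (Poly_Mapping.map weil_sign p)))"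

definition con_t :: "'h::complex_vector \<Rightarrow> 'h weil_forms"
  where "con_t h = (Poly_Mapping.single 1 (con h), 0)"

definition char_map :: "('h::complex_vector \<Rightarrow> 'h tensor_algebra) \<Rightarrow> 'h weil1 \<Rightarrow> 'h weil_forms"
  where "char_map \<Delta> = (THE \<Phi>. clinear \<Phi> \<and> \<Phi> 1 = (1, 0) \<and>
    (\<forall>x y. \<Phi> (x * y) = forms_mult (\<Phi> x) (\<Phi> y)) \<and>
    (\<forall>x. \<Phi> (weil_diff \<Delta> x) = forms_diff \<Delta> (\<Phi> x)) \<and>
    (\<forall>h. \<Phi> (con h) = con_t h) \<and>
    (\<forall>h. \<Phi> (\<omega> h) = forms_diff \<Delta> (con_t h) + sweedler \<Delta> (\<lambda>a b. forms_mult (con_t a) (con_t b)) h))"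

definition integrate :: "'h::complex_vector weil_forms \<Rightarrow> 'h weil1"
  where "integrate a = (\<Sum>k\<in>Poly_Mapping.keys (snd a).
    (1 / of_nat (k + 1)) *\<^sub>C weil_sign (Poly_Mapping.lookup (snd a) k))"

definition cs_contraction :: "('h::complex_vector \<Rightarrow> 'h tensor_algebra) \<Rightarrow> 'h weil1 \<Rightarrow> 'h weil1"
  where "cs_contraction \<Delta> x = integrate (char_map \<Delta> x)"


section \<open>Cochain complexes, quotients and cohomology\<close>

text \<open>
  Quotients of quotients are needed, so vector spaces with extra structure are records here and
  quotient spaces consist of cosets. \<open>vcomp\<close> gives the homogeneous components.
\<close>

record 'a cspace =
  vcarrier :: "'a set"
  vadd :: "'a \<Rightarrow> 'a \<Rightarrow> 'a"
  vzero :: 'a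
  vscale :: "complex \<Rightarrow> 'a \<Rightarrow> 'a"

record 'a cochain = "'a cspace" +
  vcomp :: "int \<Rightarrow> 'a set"
  vdiff :: "'a \<Rightarrow> 'a"

record 'a cyclic_algebra = "'a cochain" +
  vmult :: "'a \<Rightarrow> 'a \<Rightarrow> 'a"
  op_t :: "'a \<Rightarrow> 'a"
  op_b :: "'a \<Rightarrow> 'a"
  op_N :: "'a \<Rightarrow> 'a"

definition coset :: "('a, 'm) cspace_scheme \<Rightarrow> 'a set \<Rightarrow> 'a \<Rightarrow> 'a set"
  where "coset M U x = vadd M x ` U"

definition quot_op1 :: "('a, 'm) cspace_scheme \<Rightarrow> 'a set \<Rightarrow> ('a \<Rightarrow> 'a) \<Rightarrow> 'a set \<Rightarrow> 'a set"
  where "quot_op1 M U f X = (\<Union>x\<in>X. coset M U (f x))"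

definition quot_op2 ::
  "('a, 'm) cspace_scheme \<Rightarrow> 'a set \<Rightarrow> ('a \<Rightarrow> 'a \<Rightarrow> 'a) \<Rightarrow> 'a set \<Rightarrow> 'a set \<Rightarrow> 'a set"
  where "quot_op2 M U f X Y = (\<Union>x\<in>X. \<Union>y\<in>Y. coset M U (f x y))"

definition quot_space :: "('a, 'm) cspace_scheme \<Rightarrow> 'a set \<Rightarrow> 'a set cspace"
  where "quot_space M U = \<lparr>
    vcarrier = coset M U ` vcarrier M,
    vadd = quot_op2 M U (vadd M),
    vzero = U,
    vscale = (\<lambda>c. quot_op1 M U (vscale M c))\<rparr>"

definition quot_cochain :: "('a, 'm) cochain_scheme \<Rightarrow> 'a set \<Rightarrow> 'a set cochain"
  where "quot_cochain M U = cspace.extend (quot_space M U) (cochain.fields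
    (\<lambda>k. coset M U ` vcomp M k)
    (quot_op1 M U (vdiff M)))"

definition quot_algebra :: "('a, 'm) cyclic_algebra_scheme \<Rightarrow> 'a set \<Rightarrow> 'a set cyclic_algebra"
  where "quot_algebra M U = cochain.extend (quot_cochain M U) (cyclic_algebra.fields
    (quot_op2 M U (vmult M))
    (quot_op1 M U (op_t M))
    (quot_op1 M U (op_b M))
    (quot_op1 M U (op_N M)))"

definition sub_algebra :: "('a, 'm) cochain_scheme \<Rightarrow> 'a set \<Rightarrow> ('a, 'm) cochain_scheme"
  where "sub_algebra M A = M\<lparr>vcarrier := A, vcomp := (\<lambda>k. A \<inter> vcomp M k)\<rparr>"

definition vspan :: "('a, 'm) cspace_scheme \<Rightarrow> 'a set \<Rightarrow> 'a set"
  where "vspan M X = (\<lambda>S. vzero M \<in> S \<and> (\<forall>x\<in>S. \<forall>y\<in>S. vadd M x y \<in> S) \<and>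
    (\<forall>c. \<forall>x\<in>S. vscale M c x \<in> S)) hull X"

definition gr_commutators :: "('a, 'm) cyclic_algebra_scheme \<Rightarrow> 'a set \<Rightarrow> 'a set \<Rightarrow> 'a set"
  where "gr_commutators M A B = vspan M
    {vadd M (vmult M x y) (vscale M (- ksign (j * k)) (vmult M y x)) | x y j k.
      x \<in> A \<inter> vcomp M j \<and> y \<in> B \<inter> vcomp M k}"

definition cocycles :: "('a, 'm) cochain_scheme \<Rightarrow> int \<Rightarrow> 'a set"
  where "cocycles M k = {x \<in> vcomp M k. vdiff M x = vzero M}"

definition coboundaries :: "('a, 'm) cochain_scheme \<Rightarrow> int \<Rightarrow> 'a set"
  where "coboundaries M k = vdiff M ` vcomp M (k - 1)"

definition cohomology :: "('a, 'm) cochain_scheme \<Rightarrow> int \<Rightarrow> 'a set cspace"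
  where "cohomology M k = quot_space (M\<lparr>vcarrier := cocycles M k\<rparr>) (coboundaries M k)"

definition cohom_class :: "('a, 'm) cochain_scheme \<Rightarrow> int \<Rightarrow> 'a \<Rightarrow> 'a set"
  where "cohom_class M k x = coset M (coboundaries M k) x"

text \<open>
  The shift that makes a map of degree \<open>-1\<close> that anticommutes with the differentials a cochain map;
  \<open>H\<^sup>k\<close> of the shifted complex is \<open>H\<^bsup>k-1\<^esup>\<close> of the original one.
\<close>

definition shift :: "('a, 'm) cochain_scheme \<Rightarrow> ('a, 'm) cochain_scheme"
  where "shift M = M\<lparr>vcomp := (\<lambda>k. vcomp M (k - 1)), vdiff := (\<lambda>x. vscale M (- 1) (vdiff M x))\<rparr>"

definition linear_map ::
  "('a, 'm) cspace_scheme \<Rightarrow> ('b, 'l) cspace_scheme \<Rightarrow> ('a \<Rightarrow> 'b) \<Rightarrow> bool"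
  where "linear_map V W f \<longleftrightarrow> f ` vcarrier V \<subseteq> vcarrier W \<and>
    (\<forall>x\<in>vcarrier V. \<forall>y\<in>vcarrier V. f (vadd V x y) = vadd W (f x) (f y)) \<and>
    (\<forall>c. \<forall>x\<in>vcarrier V. f (vscale V c x) = vscale W c (f x))"

definition linear_iso ::
  "('a, 'm) cspace_scheme \<Rightarrow> ('b, 'l) cspace_scheme \<Rightarrow> ('a \<Rightarrow> 'b) \<Rightarrow> bool"
  where "linear_iso V W f \<longleftrightarrow> linear_map V W f \<and> bij_betw f (vcarrier V) (vcarrier W)"

definition cochain_map ::
  "('a, 'm) cochain_scheme \<Rightarrow> ('b, 'l) cochain_scheme \<Rightarrow> ('a \<Rightarrow> 'b) \<Rightarrow> bool"
  where "cochain_map M N f \<longleftrightarrow> linear_map M N f \<and> (\<forall>k. f ` vcomp M k \<subseteq> vcomp N k) \<and>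
    (\<forall>x\<in>vcarrier M. f (vdiff M x) = vdiff N (f x))"

text \<open>
  For a map \<open>f\<close> on representatives that is constant on the coset \<open>X\<close>, the value at \<open>X\<close> of
  the map it induces.
\<close>

definition induced :: "('a \<Rightarrow> 'b) \<Rightarrow> 'a set \<Rightarrow> 'b"
  where "induced f X = the_elem (f ` X)"

text \<open>
  The \<open>S\<close>-operator on \<open>H\<^sup>k(Y/C)\<close>, where \<open>C\<close> is the space of commutators killed by \<open>Y \<rightarrow> Y\<^sub>\<natural>\<close>.
\<close>

definition S_op :: "('a, 'm) cyclic_algebra_scheme \<Rightarrow> 'a set \<Rightarrow> int \<Rightarrow> 'a set set \<Rightarrow> 'a set set"
  where "S_op Y C k \<xi> = (THE \<eta>. \<exists>u\<in>vcomp Y k. \<exists>v\<in>vcomp Y (k + 1). \<exists>w\<in>vcomp Y (k + 2).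
    \<xi> = cohom_class (quot_cochain Y C) k (coset Y C u) \<and>
    vdiff Y u = vadd Y (op_t Y v) (vscale Y (- 1) v) \<and>
    op_b Y v = op_N Y w \<and>
    \<eta> = cohom_class (quot_cochain Y C) (k + 2) (coset Y C w))"


section \<open>The complexes of the theorem\<close>

context
  fixes \<Delta> :: "'h::complex_vector \<Rightarrow> 'h tensor_algebra"
begin

definition weil1_alg :: "'h weil1 cyclic_algebra"
  where "weil1_alg = \<lparr>vcarrier = UNIV, vadd = (+), vzero = 0, vscale = scaleC,
    vcomp = weil_comp, vdiff = weil_diff \<Delta>, vmult = (*),
    op_t = cyc_t, op_b = cyc_b \<Delta>, op_N = cyc_N\<rparr>"

definition weil_alg :: "'h weil1 cyclic_algebra"
  where "weil_alg = sub_algebra weil1_alg weil"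

definition I_alg :: "nat \<Rightarrow> 'h weil1 cyclic_algebra"
  where "I_alg n = sub_algebra weil1_alg (curv_power (n + 1))"

definition W_alg :: "nat \<Rightarrow> 'h weil1 set cyclic_algebra"
  where "W_alg n = quot_algebra weil_alg (curv_power (n + 1))"

text \<open>
  \<open>I\<^sub>n(H)\<^sub>\<natural>\<close> divides out \<open>[I(H), I\<^sub>n\<^sub>-\<^sub>1(H)]\<close>, where \<open>I\<^sub>n\<^sub>-\<^sub>1(H)\<close> is \<open>I(H)\<^sup>n\<close>; for \<open>n = 0\<close> that
  is the Weil algebra with unit.
\<close>

definition I_comm :: "nat \<Rightarrow> 'h weil1 set"
  where "I_comm n = gr_commutators weil1_alg curv_ideal (curv_power n)"

definition W_comm :: "nat \<Rightarrow> 'h weil1 set set"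
  where "W_comm n = gr_commutators (W_alg n) (vcarrier (W_alg n)) (vcarrier (W_alg n))"

definition I_nat :: "nat \<Rightarrow> 'h weil1 set cochain"
  where "I_nat n = quot_cochain (I_alg n) (I_comm n)"

definition W_nat :: "nat \<Rightarrow> 'h weil1 set set cochain"
  where "W_nat n = quot_cochain (W_alg n) (W_comm n)"

definition I_proj :: "nat \<Rightarrow> 'h weil1 \<Rightarrow> 'h weil1 set"
  where "I_proj n x = coset (I_alg n) (I_comm n) x"

definition W_proj :: "nat \<Rightarrow> 'h weil1 \<Rightarrow> 'h weil1 set set"
  where "W_proj n x = coset (W_alg n) (W_comm n) (coset weil_alg (curv_power (n + 1)) x)"

definition CS :: "nat \<Rightarrow> 'h weil1 set \<Rightarrow> 'h weil1 set set"
  where "CS n = induced (\<lambda>x. W_proj n (cs_contraction \<Delta> x))"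

definition CS_cohom :: "nat \<Rightarrow> int \<Rightarrow> 'h weil1 set set \<Rightarrow> 'h weil1 set set set"
  where "CS_cohom n k = induced (\<lambda>X. cohom_class (W_nat n) (k - 1) (CS n X))"

definition S_I :: "nat \<Rightarrow> int \<Rightarrow> 'h weil1 set set \<Rightarrow> 'h weil1 set set"
  where "S_I n = S_op (I_alg n) (I_comm n)"

definition S_W :: "nat \<Rightarrow> int \<Rightarrow> 'h weil1 set set set \<Rightarrow> 'h weil1 set set set"
  where "S_W n = S_op (W_alg n) (W_comm n)"

end

end

theory Submission
  imports Defs
begin

text \<open>
  The contraction \<open>\<K>\<close> maps commutators to commutators, since it is the composite of an algebra map
  and an integral. Rotating words shows \<open>[I, I\<^sup>n] = I\<^sup>n\<^sup>+\<^sup>1 \<inter> [W, W]\<close>; this is where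
  \<open>N\<close> enters, as both sides are cut out by \<open>N x = 0\<close>. Hence \<open>0 \<rightarrow> I\<^sub>n\<^sub>\<natural> \<rightarrow> W\<^sub>\<natural> \<rightarrow> W\<^sub>n\<^sub>\<natural> \<rightarrow> 0\<close> is
  exact, its middle term is contractible by \<open>\<K>\<close>, and \<open>CS\<close> inverts the connecting homomorphism,
  which commutes with \<open>S\<close>. Division by the length of words, in the form
  \<open>1 = N P + (t - 1) Q\<close> with operators preserving \<open>I\<^sup>n\<close>, gives all exactness statements at once.
\<close>

section \<open>Multilinear extension to the tensor algebra\<close>

text \<open>The operators on the Weil algebra are given by definite descriptions, so existence and
  uniqueness have to come before any calculation: existence by recursion along words, uniqueness
  because monomials span. The contraction does not preserve the powers of I, since it sends
  \<open>\<omega> h\<close> to \<open>con h\<close>. This is why its target is W_n: the homotopy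
  formula says that it anticommutes with \<partial> up to x itself, and x dies in W_n when x lies in
  the (n+1)-st power of I. The sign is absorbed by the shift. \<partial> mixes word lengths, so P
  and Q cannot be moved past it. Instead an element or its boundary is split as i + (t - 1) q with i
  in the ideal, and the pieces are carried across the differential by \<partial> (t - 1) = (t - 1) b
  and b N = N \<partial>. Being a commutator becomes the linear condition N x = 0 in I_n, and N x in
  the (n+1)-st power of I in W_n. Cosets of cosets are avoided by keeping all representatives in the
  Weil algebra.\<close>

lemma clinear_iff:
  "clinear f \<longleftrightarrow> (\<forall>x y. f (x + y) = f x + f y) \<and> (\<forall>c x. f (c *\<^sub>C x) = c *\<^sub>C f x)"
  by (simp add: Vector_Spaces.linear_iff complex_vector.vector_space_axioms)

lemma clinearI:
  assumes "\<And>x y. f (x + y) = f x + f y" "\<And>c x. f (c *\<^sub>C x) = c *\<^sub>C f x"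
  shows "clinear f"
  using assms by (simp add: clinear_iff)

lemma clinear_add: "clinear f \<Longrightarrow> f (x + y) = f x + f y"
  by (simp add: clinear_iff)

lemma clinear_scaleC: "clinear f \<Longrightarrow> f (c *\<^sub>C x) = c *\<^sub>C f x"
  by (simp add: clinear_iff)

lemma clinear_0: "clinear f \<Longrightarrow> f 0 = 0"
  using clinear_scaleC[of f 0 0] by simp

lemma clinear_uminus: "clinear f \<Longrightarrow> f (- x) = - f x"
  using clinear_scaleC[of f "-1" x] by simp

lemma clinear_diff: "clinear f \<Longrightarrow> f (x - y) = f x - f y"
  using clinear_add[of f x "- y"] by (simp add: clinear_uminus)

lemma clinear_sum: "clinear f \<Longrightarrow> f (\<Sum>i\<in>A. g i) = (\<Sum>i\<in>A. f (g i))"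
  by (induction A rule: infinite_finite_induct) (simp_all add: clinear_0 clinear_add)

lemma clinear_sum_list: "clinear f \<Longrightarrow> f (\<Sum>(a, b)\<leftarrow>ps. g a b) = (\<Sum>(a, b)\<leftarrow>ps. f (g a b))"
  by (induction ps) (auto simp: clinear_0 clinear_add)

lemmas clinear_simps = clinear_add clinear_scaleC clinear_0 clinear_uminus clinear_diff

lemma clinear_ident: "clinear (\<lambda>x. x)"
  by (simp add: clinear_iff)

lemma clinear_zero: "clinear (\<lambda>x. 0)"
  by (simp add: clinear_iff)

lemma clinear_comp: "clinear f \<Longrightarrow> clinear g \<Longrightarrow> clinear (\<lambda>x. f (g x))"
  by (simp add: clinear_iff)

lemma clinear_plus: "clinear f \<Longrightarrow> clinear g \<Longrightarrow> clinear (\<lambda>x. f x + g x)"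
  by (simp add: clinear_iff complex_vector.scale_right_distrib)

lemma clinear_minus: "clinear f \<Longrightarrow> clinear g \<Longrightarrow> clinear (\<lambda>x. f x - g x)"
  by (simp add: clinear_iff complex_vector.scale_right_diff_distrib)

lemma clinear_scale: "clinear f \<Longrightarrow> clinear (\<lambda>x. c *\<^sub>C f x)"
  by (simp add: clinear_iff complex_vector.scale_right_distrib mult.commute)

lemma clinear_neg: "clinear f \<Longrightarrow> clinear (\<lambda>x. - f x)"
  by (simp add: clinear_iff)

lemma clinear_setsum: "(\<And>i. i \<in> A \<Longrightarrow> clinear (f i)) \<Longrightarrow> clinear (\<lambda>x. \<Sum>i\<in>A. f i x)"
  by (simp add: clinear_iff sum.distrib complex_vector.scale_sum_right)

lemma clinear_funpow: "clinear f \<Longrightarrow> clinear (f ^^ i)" for f :: "'a::complex_vector \<Rightarrow> 'a"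
  by (induction i) (simp_all add: clinear_iff)

lemma clinear_Pair: "clinear f \<Longrightarrow> clinear g \<Longrightarrow> clinear (\<lambda>x. (f x, g x))"
  by (simp add: clinear_iff scaleC_prod_def)

lemma clinear_fst: "clinear fst"
  by (simp add: clinear_iff scaleC_prod_def)

lemma clinear_snd: "clinear snd"
  by (simp add: clinear_iff scaleC_prod_def)

lemma span_linear_image:
  assumes "clinear f" "x \<in> complex_vector.span S" "\<And>s. s \<in> S \<Longrightarrow> f s \<in> complex_vector.span U"
  shows "f x \<in> complex_vector.span U"
  using assms(2)
  by (induction rule: complex_vector.span_induct_alt)
    (simp_all add: clinear_simps[OF assms(1)] assms(3) complex_vector.span_zero
      complex_vector.span_add complex_vector.span_scale)

lemma clinear_eq_on_span:
  assumes "clinear f" "clinear g" "x \<in> complex_vector.span S" "\<And>s. s \<in> S \<Longrightarrow> f s = g s"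
  shows "f x = g x"
  using assms(3)
  by (induction rule: complex_vector.span_induct_alt)
    (simp_all add: clinear_simps[OF assms(1)] clinear_simps[OF assms(2)] assms(4))

lemma free_algebra_scaleC_right: "x * (c *\<^sub>C y) = c *\<^sub>C (x * y)" for x y :: "'v free_algebra"
proof -
  have "x * Poly_Mapping.single 0 c = Poly_Mapping.single 0 c * x"
  proof (induction x rule: poly_mapping_add_induct)
    case (single k v)
    then show ?case by (simp add: mult_single mult.commute)
  qed (simp_all add: distrib_left distrib_right)
  then show ?thesis by (metis mult.assoc scaleC_free_algebra)
qed

lemma tensor_scaleC_left [simp]: "(c *\<^sub>C x) * y = c *\<^sub>C (x * y)" for x y :: "'v::complex_vector
  tensor_algebra"
  by transfer (simp add: scaleC_free_algebra mult.assoc tensor_ideal.zero)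

lemma tensor_scaleC_right [simp]: "x * (c *\<^sub>C y) = c *\<^sub>C (x * y)" for x y :: "'v::complex_vector
  tensor_algebra"
  by transfer (simp add: free_algebra_scaleC_right tensor_ideal.zero)

lemma clinear_mult_left: "clinear f \<Longrightarrow> clinear (\<lambda>x. f x * y)" for y :: "'v::complex_vector tensor_algebra"
  by (simp add: clinear_iff distrib_right)

lemma clinear_mult_right: "clinear f \<Longrightarrow> clinear (\<lambda>x. y * f x)" for y :: "'v::complex_vector tensor_algebra"
  by (simp add: clinear_iff distrib_left)

lemma tgen_add: "tgen (v + w) = tgen v + tgen w"
proof transfer
  fix v w :: 'a
  show "letter (v + w) - (letter v + letter w) \<in> tensor_ideal"
    using tensor_ideal.additive[of 1 v w 1] by (simp add: algebra_simps)
qed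

lemma tgen_scaleC: "tgen (c *\<^sub>C v) = c *\<^sub>C tgen v"
proof transfer
  fix c and v :: 'a
  show "letter (c *\<^sub>C v) - c *\<^sub>C letter v \<in> tensor_ideal"
    using tensor_ideal.homogeneous[of 1 c v 1] by simp
qed

lemma clinear_tgen: "clinear tgen"
  by (simp add: clinear_iff tgen_add tgen_scaleC)

definition tword_prod :: "'v::complex_vector list \<Rightarrow> 'v tensor_algebra"
  where "tword_prod vs = prod_list (map tgen vs)"

lemma tword_prod_simps [simp]:
  "tword_prod [] = 1" "tword_prod (v # vs) = tgen v * tword_prod vs"
  "tword_prod (vs @ ws) = tword_prod vs * tword_prod ws"
  by (simp_all add: tword_prod_def)

lemma clinear_tword_prod: "clinear (\<lambda>v. tword_prod (xs @ v # ys))"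
  by (simp add: clinear_mult_right clinear_mult_left clinear_tgen)

lemma tword_prod_abs: "tword_prod vs = abs_tensor_algebra (Poly_Mapping.single (TWord vs) 1)"
proof (induction vs)
  case Nil
  then show ?case
    by (simp add: one_tensor_algebra_def zero_tword_def[symmetric])
next
  case (Cons v vs)
  then show ?case
    by (simp add: tgen.abs_eq times_tensor_algebra.abs_eq letter_def mult_single plus_tword_def)
qed

lemma abs_tensor_algebra_surj: "\<exists>y. x = abs_tensor_algebra y"
  by (rule exI[of _ "rep_tensor_algebra x"]) (simp add: Quotient3_abs_rep[OF Quotient3_tensor_algebra])

lemma tensor_algebra_induct [case_names word add]:
  fixes x :: "'v::complex_vector tensor_algebra"
  assumes "\<And>c vs. P (c *\<^sub>C tword_prod vs)" "\<And>x y. P x \<Longrightarrow> P y \<Longrightarrow> P (x + y)"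
  shows "P x"
proof -
  have single: "P (abs_tensor_algebra (Poly_Mapping.single k c))" for k c
  proof -
    have "Poly_Mapping.single k c = c *\<^sub>C Poly_Mapping.single k 1"
      by (rule poly_mapping_eqI)
        (simp add: scaleC_poly_mapping.rep_eq lookup_single when_def scaleC_complex_def)
    then have "abs_tensor_algebra (Poly_Mapping.single k c) = c *\<^sub>C tword_prod (tletters k)"
      by (simp add: tword_prod_abs scaleC_tensor_algebra.abs_eq)
    then show ?thesis using assms(1) by simp
  qed
  have "P (abs_tensor_algebra y)" for y
  proof (induction y rule: poly_mapping_add_induct)
    case zero
    then show ?case using single[of 0 0] by simp
  next
    case (add x y)
    then have "P (abs_tensor_algebra x + abs_tensor_algebra y)" by (rule assms(2))
    then show ?case by (simp only: plus_tensor_algebra.abs_eq)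
  qed (rule single)
  then show ?thesis
    using abs_tensor_algebra_surj[of x] by auto
qed

text \<open>A function on lists bundles one function of p vectors for each p, so a single predicate
  covers a family of multilinear maps, one for every tensor degree.\<close>

definition multilinear :: "('v::complex_vector list \<Rightarrow> 'b::complex_vector) \<Rightarrow> bool"
  where "multilinear F \<longleftrightarrow> (\<forall>xs ys. clinear (\<lambda>v. F (xs @ v # ys)))"

definition free_ext :: "('v::complex_vector list \<Rightarrow> 'b::complex_vector) \<Rightarrow> 'v free_algebra \<Rightarrow> 'b"
  where "free_ext F x = (\<Sum>w\<in>Poly_Mapping.keys x. Poly_Mapping.lookup x w *\<^sub>C F (tletters w))"

text \<open>Evaluates at an arbitrarily chosen representative. For multilinear \<open>F\<close> the
  choice is immaterial, which is what \<open>tensor_ext_abs\<close> records.\<close>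

definition tensor_ext :: "('v::complex_vector list \<Rightarrow> 'b::complex_vector) \<Rightarrow> 'v tensor_algebra \<Rightarrow> 'b"
  where "tensor_ext F x = free_ext F (rep_tensor_algebra x)"

lemma free_ext_superset:
  assumes "finite A" "Poly_Mapping.keys x \<subseteq> A"
  shows "free_ext F x = (\<Sum>w\<in>A. Poly_Mapping.lookup x w *\<^sub>C F (tletters w))"
  unfolding free_ext_def
  by (rule sum.mono_neutral_left) (use assms in \<open>auto simp: not_in_keys_iff_lookup_eq_zero\<close>)

lemma clinear_free_ext: "clinear (free_ext F)"
proof (rule clinearI)
  show "free_ext F (x + y) = free_ext F x + free_ext F y" for x y
  proof -
    let ?A = "Poly_Mapping.keys x \<union> Poly_Mapping.keys y"
    have "Poly_Mapping.keys (x + y) \<subseteq> ?A" by (rule keys_add)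
    then show ?thesis
      by (subst (1 2 3) free_ext_superset[of ?A])
        (simp_all add: lookup_add scaleC_add_left sum.distrib)
  qed
  show "free_ext F (c *\<^sub>C x) = c *\<^sub>C free_ext F x" for c x
  proof -
    have "Poly_Mapping.keys (c *\<^sub>C x) \<subseteq> Poly_Mapping.keys x"
      by (auto simp: scaleC_poly_mapping.rep_eq in_keys_iff)
    then show ?thesis
      by (subst (1 2) free_ext_superset[of "Poly_Mapping.keys x"])
        (simp_all add: scaleC_poly_mapping.rep_eq complex_vector.scale_sum_right scaleC_complex_def)
  qed
qed

lemma free_ext_single: "free_ext F (Poly_Mapping.single w c) = c *\<^sub>C F (tletters w)"
  by (subst free_ext_superset[of "{w}"]) (auto simp: lookup_single)

text \<open>By bilinearity the outer factors of a relation may be taken to be single words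
  \<open>k\<close> and \<open>l\<close>; the relation then says that \<open>F\<close> is additive or
  homogeneous in the slot between them.\<close>

lemma free_ext_tensor_ideal:
  assumes F: "multilinear F" and "z \<in> tensor_ideal"
  shows "free_ext F z = 0"
proof -
  note lin = clinear_simps[OF clinear_free_ext]
  have word: "free_ext F (Poly_Mapping.single k a * letter v * Poly_Mapping.single l b) =
    (a * b) *\<^sub>C F (tletters k @ v # tletters l)" for k a v l b
    by (simp add: letter_def mult_single free_ext_single plus_tword_def)
  have Flin: "clinear (\<lambda>v. F (xs @ v # ys))" for xs ys
    using F by (simp add: multilinear_def)
  have add: "free_ext F (x * (letter (v + w) - letter v - letter w) * y) = 0" for x v w y
  proof (induction x rule: poly_mapping_add_induct)
    case (single k a)
    show ?case
    proof (induction y rule: poly_mapping_add_induct)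
      case (single l b)
      show ?case
        by (simp add: right_diff_distrib left_diff_distrib word lin clinear_add[OF Flin]
            complex_vector.scale_right_distrib)
    qed (simp_all add: distrib_left lin)
  qed (simp_all add: distrib_right lin)
  have scale: "free_ext F (x * (letter (c *\<^sub>C v) - c *\<^sub>C letter v) * y) = 0" for x c v y
  proof (induction x rule: poly_mapping_add_induct)
    case (single k a)
    show ?case
    proof (induction y rule: poly_mapping_add_induct)
      case (single l b)
      have "Poly_Mapping.single k a * (c *\<^sub>C letter v) * Poly_Mapping.single l b =
          c *\<^sub>C (Poly_Mapping.single k a * letter v * Poly_Mapping.single l b)"
        by (simp add: free_algebra_scaleC_right) (simp add: scaleC_free_algebra mult.assoc)
      then show ?case
        by (simp add: right_diff_distrib left_diff_distrib word lin clinear_scaleC[OF Flin] mult.commute)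
    qed (simp_all add: distrib_left lin)
  qed (simp_all add: distrib_right lin)
  from assms(2) show ?thesis
    by induction (simp_all add: lin add scale)
qed

lemma tensor_ext_abs:
  assumes "multilinear F"
  shows "tensor_ext F (abs_tensor_algebra x) = free_ext F x"
proof -
  have "rep_tensor_algebra (abs_tensor_algebra x) - x \<in> tensor_ideal"
    by (rule Quotient3_rep_abs[OF Quotient3_tensor_algebra]) (simp add: tensor_ideal.zero)
  from free_ext_tensor_ideal[OF assms this] show ?thesis
    by (simp add: tensor_ext_def clinear_diff[OF clinear_free_ext])
qed

lemma clinear_tensor_ext:
  assumes "multilinear F"
  shows "clinear (tensor_ext F)"
proof (rule clinearI)
  note surj = abs_tensor_algebra_surj
  show "tensor_ext F (x + y) = tensor_ext F x + tensor_ext F y" for x y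
    using surj[of x] surj[of y]
    by (auto simp: plus_tensor_algebra.abs_eq tensor_ext_abs[OF assms] clinear_add[OF clinear_free_ext])
  show "tensor_ext F (c *\<^sub>C x) = c *\<^sub>C tensor_ext F x" for c x
    using surj[of x]
    by (auto simp: scaleC_tensor_algebra.abs_eq tensor_ext_abs[OF assms] clinear_scaleC[OF clinear_free_ext])
qed

lemma tensor_ext_word:
  assumes "multilinear F"
  shows "tensor_ext F (tword_prod vs) = F vs"
  by (simp add: tword_prod_abs tensor_ext_abs[OF assms] free_ext_single)

lemma tensor_ext_Cons:
  assumes "multilinear F" "clinear L" "clinear R" "\<And>vs. F (v # vs) = L (tword_prod vs) + R (F vs)"
  shows "tensor_ext F (tgen v * x) = L x + R (tensor_ext F x)"
proof (induction x rule: tensor_algebra_induct)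
  case (word c vs)
  have "tensor_ext F (tgen v * tword_prod vs) = F (v # vs)"
    using tensor_ext_word[OF assms(1), of "v # vs"] by simp
  then show ?case
    by (simp add: clinear_simps[OF clinear_tensor_ext[OF assms(1)]] clinear_simps[OF assms(2)]
      clinear_simps[OF assms(3)] tensor_ext_word[OF assms(1)] assms(4) scaleC_add_right)
next
  case (add x y)
  then show ?case
    by (simp add: distrib_left clinear_simps[OF clinear_tensor_ext[OF assms(1)]]
       clinear_simps[OF assms(2)] clinear_simps[OF assms(3)])
qed

text \<open>In a slot behind the head, the value is a function of the remaining word and of the
  recursive value. Both vary linearly with the entry of that slot, hence the demand that
  \<open>G\<close> be linear in the pair and not in each argument separately.\<close>

lemma multilinear_recI:
  assumes "\<And>vs. clinear (\<lambda>v. F (v # vs))"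
    and "\<And>v. \<exists>G. (\<forall>vs. F (v # vs) = G (tword_prod vs) (F vs)) \<and> clinear (\<lambda>p. G (fst p) (snd p))"
  shows "multilinear F"
proof -
  have "clinear (\<lambda>v. F (xs @ v # ys))" for xs ys
  proof (induction xs)
    case (Cons u xs)
    obtain G where G: "\<And>vs. F (u # vs) = G (tword_prod vs) (F vs)" "clinear (\<lambda>p. G (fst p) (snd p))"
      using assms(2) by blast
    have "clinear (\<lambda>v. G (tword_prod (xs @ v # ys)) (F (xs @ v # ys)))"
      using clinear_comp[OF G(2) clinear_Pair[OF clinear_tword_prod Cons]] by simp
    then show ?case by (simp add: G(1))
  qed (simp add: assms(1))
  then show ?thesis by (simp add: multilinear_def)
qed

text \<open>Supplies existence for the sign, the derivations, \<open>cyc_t\<close>,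
  \<open>cyc_bt\<close> and the characteristic map. \<open>L\<close> sees the tail itself and
  \<open>R\<close> the value already computed on it; the Leibniz rule needs both.\<close>

lemma tensor_rec:
  fixes L :: "'v::complex_vector \<Rightarrow> 'v tensor_algebra \<Rightarrow> 'b::complex_vector"
  assumes "\<And>x. clinear (\<lambda>v. L v x)" "\<And>v. clinear (L v)" "\<And>y. clinear (\<lambda>v. R v y)" "\<And>v. clinear (R v)"
  obtains G where "clinear G" "G 1 = e" "\<And>v x. G (tgen v * x) = L v x + R v (G x)"
proof -
  define F where "F = rec_list e (\<lambda>v vs r. L v (tword_prod vs) + R v r)"
  have F: "F [] = e" "F (v # vs) = L v (tword_prod vs) + R v (F vs)" for v vs
    by (simp_all add: F_def)
  have "multilinear F"
  proof (rule multilinear_recI)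
    show "clinear (\<lambda>v. F (v # vs))" for vs
      unfolding F by (intro clinear_plus assms)
    show "\<exists>G. (\<forall>vs. F (v # vs) = G (tword_prod vs) (F vs)) \<and> clinear (\<lambda>p. G (fst p) (snd p))" for v
      by (rule exI[of _ "\<lambda>x y. L v x + R v y"])
        (intro conjI allI F clinear_plus clinear_comp[OF assms(2) clinear_fst]
          clinear_comp[OF assms(4) clinear_snd])
  qed
  note ext = this
  show ?thesis
  proof (rule that)
    show "clinear (tensor_ext F)" by (rule clinear_tensor_ext[OF ext])
    show "tensor_ext F 1 = e" using tensor_ext_word[OF ext, of "[]"] by (simp add: F)
    show "tensor_ext F (tgen v * x) = L v x + R v (tensor_ext F x)" for v x
      by (rule tensor_ext_Cons[OF ext assms(2) assms(4)]) (rule F)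
  qed
qed

section \<open>Sweedler sums\<close>

definition bilin :: "('a::complex_vector \<Rightarrow> 'b::complex_vector \<Rightarrow> 'c::complex_vector) \<Rightarrow> bool"
  where "bilin F \<longleftrightarrow> (\<forall>b. clinear (\<lambda>a. F a b)) \<and> (\<forall>a. clinear (F a))"

lemma bilinI: "(\<And>b. clinear (\<lambda>a. F a b)) \<Longrightarrow> (\<And>a. clinear (\<lambda>b. F a b)) \<Longrightarrow> bilin F"
  by (simp add: bilin_def)

lemma bilin_left: "bilin F \<Longrightarrow> clinear (\<lambda>a. F a b)"
  by (simp add: bilin_def)

lemma bilin_right: "bilin F \<Longrightarrow> clinear (\<lambda>b. F a b)"
  by (simp add: bilin_def)

lemma bilin_tensor_mult:
  fixes f g :: "_ \<Rightarrow> 'v::complex_vector tensor_algebra"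
  assumes "clinear f" "clinear g"
  shows "bilin (\<lambda>a b. f a * g b)"
  by (intro bilinI clinear_mult_left clinear_mult_right assms)

lemma bilin_comp: "clinear L \<Longrightarrow> bilin F \<Longrightarrow> bilin (\<lambda>a b. L (F a b))"
  by (simp add: bilin_def clinear_iff)

text \<open>Setting \<open>F\<close> to zero in every arity other than 2 makes it a multilinear
  family, so the universal property of the tensor square follows from that of the tensor
  algebra.\<close>

lemma bilin_ext:
  assumes "bilin F"
  obtains G where "clinear G" "\<And>a b. G (tgen a * tgen b) = F a b"
proof -
  define F' where "F' vs = (if length vs = 2 then F (vs ! 0) (vs ! 1) else 0)" for vs
  have "clinear (\<lambda>v. F' (xs @ v # ys))" for xs ys
  proof (cases "length xs + length ys = 1")
    case True
    then consider b where "xs = []" "ys = [b]" | a where "xs = [a]" "ys = []"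
      by (cases xs; cases ys) auto
    then show ?thesis
      by cases (simp_all add: F'_def bilin_left[OF assms] bilin_right[OF assms])
  next
    case False
    then have "F' (xs @ v # ys) = 0" for v by (simp add: F'_def)
    then show ?thesis by (simp add: clinear_zero)
  qed
  then have F': "multilinear F'" by (simp add: multilinear_def)
  show ?thesis
  proof (rule that)
    show "clinear (tensor_ext F')" by (rule clinear_tensor_ext[OF F'])
    show "tensor_ext F' (tgen a * tgen b) = F a b" for a b
      using tensor_ext_word[OF F', of "[a, b]"] by (simp add: F'_def)
  qed
qed

lemma trilin_ext:
  assumes "\<And>b c. clinear (\<lambda>a. F a b c)" "\<And>a c. clinear (\<lambda>b. F a b c)" "\<And>a b. clinear (\<lambda>c. F a b c)"
  obtains G where "clinear G" "\<And>a b c. G (tgen a * tgen b * tgen c) = F a b c"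
proof -
  define F' where "F' vs = (if length vs = 3 then F (vs ! 0) (vs ! 1) (vs ! 2) else 0)" for vs
  have "clinear (\<lambda>v. F' (xs @ v # ys))" for xs ys
  proof (cases "length xs + length ys = 2")
    case True
    then consider a b where "xs = []" "ys = [a, b]" | a b where "xs = [a]" "ys = [b]"
      | a b where "xs = [a, b]" "ys = []"
      by (cases xs; cases ys; cases "tl xs"; cases "tl ys") auto
    then show ?thesis
      by cases (simp_all add: F'_def assms)
  next
    case False
    then have "F' (xs @ v # ys) = 0" for v by (simp add: F'_def)
    then show ?thesis by (simp add: clinear_zero)
  qed
  then have F': "multilinear F'" by (simp add: multilinear_def)
  show ?thesis
  proof (rule that)
    show "clinear (tensor_ext F')" by (rule clinear_tensor_ext[OF F'])
    show "tensor_ext F' (tgen a * tgen b * tgen c) = F a b c" for a b c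
      using tensor_ext_word[OF F', of "[a, b, c]"] by (simp add: F'_def mult.assoc)
  qed
qed

lemma tensor2_eq_sum_list:
  assumes "x \<in> tensor2"
  obtains ps where "x = (\<Sum>(a, b)\<leftarrow>ps. tgen a * tgen b)"
proof -
  from assms have "\<exists>ps. x = (\<Sum>(a, b)\<leftarrow>ps. tgen a * tgen b)"
    unfolding tensor2_def
  proof (induction rule: complex_vector.span_induct_alt)
    case base
    show ?case by (rule exI[of _ "[]"]) simp
  next
    case (step c x y)
    then obtain a b ps where "x = tgen a * tgen b" "y = (\<Sum>(a, b)\<leftarrow>ps. tgen a * tgen b)" by auto
    then show ?case by (intro exI[of _ "(c *\<^sub>C a, b) # ps"]) (simp add: tgen_scaleC)
  qed
  then show ?thesis using that by blast
qed

text \<open>Every representation of \<open>\<Delta> h\<close> gives the same sum because that sum is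
  the linear extension of \<open>F\<close> evaluated at \<open>\<Delta> h\<close>. This makes the
  definite description meaningful.\<close>

lemma sweedler_eq:
  assumes "bilin F" "\<Delta> h = (\<Sum>(a, b)\<leftarrow>ps. tgen a * tgen b)"
  shows "sweedler \<Delta> F h = (\<Sum>(a, b)\<leftarrow>ps. F a b)"
proof -
  obtain G where G: "clinear G" "\<And>a b. G (tgen a * tgen b) = F a b"
    using bilin_ext[OF assms(1)] by blast
  have eq: "(\<Sum>(a, b)\<leftarrow>qs. F a b) = G (\<Delta> h)" if "\<Delta> h = (\<Sum>(a, b)\<leftarrow>qs. tgen a * tgen b)" for qs
    by (simp add: that clinear_sum_list[OF G(1)] G(2))
  show ?thesis
    unfolding sweedler_def
  proof (rule the_equality)
    show "\<forall>qs. \<Delta> h = (\<Sum>(a, b)\<leftarrow>qs. tgen a * tgen b) \<longrightarrow> (\<Sum>(a, b)\<leftarrow>ps. F a b) = (\<Sum>(a, b)\<leftarrow>qs. F a b)"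
      using eq assms(2) by metis
  next
    fix s
    assume "\<forall>qs. \<Delta> h = (\<Sum>(a, b)\<leftarrow>qs. tgen a * tgen b) \<longrightarrow> s = (\<Sum>(a, b)\<leftarrow>qs. F a b)"
    then show "s = (\<Sum>(a, b)\<leftarrow>ps. F a b)" using assms(2) by blast
  qed
qed

context coalgebra
begin

lemma comult_eq_sum_list:
  obtains ps where "\<Delta> h = (\<Sum>(a, b)\<leftarrow>ps. tgen a * tgen b)"
  using tensor2_eq_sum_list[OF comult_range] by blast

lemma sweedler_apply:
  assumes "bilin F" "clinear L"
  shows "sweedler \<Delta> (\<lambda>a b. L (F a b)) h = L (sweedler \<Delta> F h)"
proof -
  obtain ps where ps: "\<Delta> h = (\<Sum>(a, b)\<leftarrow>ps. tgen a * tgen b)" by (rule comult_eq_sum_list)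
  show ?thesis
    by (simp add: sweedler_eq[where \<Delta>=\<Delta> and h=h, OF _ ps] assms bilin_comp clinear_sum_list)
qed

lemma sweedler_plus:
  assumes "bilin F" "bilin G"
  shows "sweedler \<Delta> (\<lambda>a b. F a b + G a b) h = sweedler \<Delta> F h + sweedler \<Delta> G h"
proof -
  obtain ps where ps: "\<Delta> h = (\<Sum>(a, b)\<leftarrow>ps. tgen a * tgen b)" by (rule comult_eq_sum_list)
  have "bilin (\<lambda>a b. F a b + G a b)" using assms by (simp add: bilin_def clinear_plus)
  then show ?thesis
    by (simp add: sweedler_eq[where \<Delta>=\<Delta> and h=h, OF _ ps] assms case_prod_unfold sum_list_addf)
qed

lemma sweedler_uminus: "bilin F \<Longrightarrow> sweedler \<Delta> (\<lambda>a b. - F a b) h = - sweedler \<Delta> F h"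
  using sweedler_apply[of F uminus] by (simp add: clinear_neg clinear_ident)

lemma sweedler_minus:
  assumes "bilin F" "bilin G"
  shows "sweedler \<Delta> (\<lambda>a b. F a b - G a b) h = sweedler \<Delta> F h - sweedler \<Delta> G h"
  using sweedler_plus[of F "\<lambda>a b. - G a b"] assms
  by (simp add: sweedler_uminus bilin_def clinear_neg)

lemma clinear_sweedler:
  assumes "bilin F"
  shows "clinear (sweedler \<Delta> F)"
proof -
  obtain G where G: "clinear G" "\<And>a b. G (tgen a * tgen b) = F a b"
    using bilin_ext[OF assms] by blast
  have "sweedler \<Delta> F h = G (\<Delta> h)" for h
  proof -
    obtain ps where ps: "\<Delta> h = (\<Sum>(a, b)\<leftarrow>ps. tgen a * tgen b)" by (rule comult_eq_sum_list)
    show ?thesis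
      by (simp add: sweedler_eq[where \<Delta>=\<Delta> and h=h, OF assms ps]) (simp add: ps clinear_sum_list[OF G(1)] G(2))
  qed
  then show ?thesis using clinear_comp[OF G(1) linear_comult] by (metis (no_types, lifting) ext)
qed

text \<open>The axiom compares two elements of the tensor algebra. Applying the linear map that
  extends a trilinear \<open>F\<close> to both of them transports the identity to arbitrary
  trilinear expressions.\<close>

lemma sweedler_coassoc:
  fixes F :: "'h \<Rightarrow> 'h \<Rightarrow> 'h \<Rightarrow> 'b::complex_vector"
  assumes F: "\<And>b c. clinear (\<lambda>a. F a b c)" "\<And>a c. clinear (\<lambda>b. F a b c)" "\<And>a b. clinear (\<lambda>c. F a b c)"
  shows "sweedler \<Delta> (\<lambda>a b. sweedler \<Delta> (\<lambda>c d. F c d b) a) h =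
    sweedler \<Delta> (\<lambda>a b. sweedler \<Delta> (\<lambda>c d. F a c d) b) h"
proof -
  obtain G where G: "clinear G" "\<And>a b c. G (tgen a * tgen b * tgen c) = F a b c"
    using trilin_ext[of F] F by blast
  have "G (\<Delta> a * tgen b) = sweedler \<Delta> (\<lambda>c d. F c d b) a" for a b
  proof -
    obtain ps where ps: "\<Delta> a = (\<Sum>(a, b)\<leftarrow>ps. tgen a * tgen b)" by (rule comult_eq_sum_list)
    have "bilin (\<lambda>c d. F c d b)" by (simp add: bilin_def F)
    from sweedler_eq[where \<Delta>=\<Delta> and h=a, OF this ps] show ?thesis
      by (simp add: ps clinear_sum_list[OF clinear_comp[OF G(1) clinear_mult_left[OF clinear_ident]]] G)
  qed
  moreover have "G (tgen a * \<Delta> b) = sweedler \<Delta> (\<lambda>c d. F a c d) b" for a b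
  proof -
    obtain ps where ps: "\<Delta> b = (\<Sum>(a, b)\<leftarrow>ps. tgen a * tgen b)" by (rule comult_eq_sum_list)
    have "bilin (\<lambda>c d. F a c d)" by (simp add: bilin_def F)
    from sweedler_eq[where \<Delta>=\<Delta> and h=b, OF this ps] show ?thesis
      by (simp add: ps clinear_sum_list[OF clinear_comp[OF G(1) clinear_mult_right[OF clinear_ident]]] G
          flip: mult.assoc)
  qed
  ultimately show ?thesis
    using arg_cong[OF coassoc[of h], of G]
    by (simp add: bilin_tensor_mult linear_comult clinear_tgen G(1) flip: sweedler_apply)
qed

end

section \<open>Words in the generators\<close>

lemma ksign_simps [simp]: "ksign 0 = 1" "ksign 1 = -1" "ksign 2 = 1" "ksign (- k) = ksign k"
  "ksign k * ksign k = 1" "ksign k * (ksign k * c) = c"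
  by (simp_all add: ksign_def)

lemma ksign_add: "ksign (j + k) = ksign j * ksign k"
  by (simp add: ksign_def)

lemma tgen_Pair: "tgen (a, b) = con a + \<omega> b"
  using tgen_add[of "(a, 0)" "(0, b)"] by simp

lemma clinear_con: "clinear con"
proof (rule clinearI)
  show "con (x + y) = con x + con y" for x y :: 'a
    using tgen_add[of "(x, 0)" "(y, 0)"] by simp
  show "con (c *\<^sub>C x) = c *\<^sub>C con x" for c and x :: 'a
    using tgen_scaleC[of c "(x, 0)"] by (simp add: scaleC_prod_def)
qed

lemma clinear_cur: "clinear \<omega>"
proof (rule clinearI)
  show "\<omega> (x + y) = \<omega> x + \<omega> y" for x y :: 'a
    using tgen_add[of "(0, x)" "(0, y)"] by simp
  show "\<omega> (c *\<^sub>C x) = c *\<^sub>C \<omega> x" for c and x :: 'a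
    using tgen_scaleC[of c "(0, x)"] by (simp add: scaleC_prod_def)
qed

lemma monomial_simps [simp]: "monomial [] = 1" "monomial (a # as) = gval a * monomial as"
  "monomial (as @ bs) = monomial as * monomial bs"
  by (simp_all add: monomial_def)

lemma mdeg_simps [simp]: "mdeg [] = 0" "mdeg (a # as) = gdeg a + mdeg as"
  "mdeg (as @ bs) = mdeg as + mdeg bs"
  by (simp_all add: mdeg_def)

text \<open>The degree components, the nonunital algebra, the parts of fixed length and, by
  \<open>curv_power_eq\<close>, the powers of I all have this form, so stability under an operator
  reduces to combinatorics of the predicate on words.\<close>

definition word_span :: "('h::complex_vector wgen list \<Rightarrow> bool) \<Rightarrow> 'h weil1 set"
  where "word_span R = complex_vector.span {monomial as | as. R as}"

lemma weil_comp_eq: "weil_comp k = word_span (\<lambda>as. mdeg as = k)"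
  by (simp add: weil_comp_def word_span_def)

lemma weil_eq: "weil = word_span (\<lambda>as. as \<noteq> [])"
  by (simp add: weil_def word_span_def)

lemma word_span_base: "R as \<Longrightarrow> monomial as \<in> word_span R"
  unfolding word_span_def by (rule complex_vector.span_base) auto

lemma word_span_subspace:
  "0 \<in> word_span R"
  "x \<in> word_span R \<Longrightarrow> y \<in> word_span R \<Longrightarrow> x + y \<in> word_span R"
  "x \<in> word_span R \<Longrightarrow> y \<in> word_span R \<Longrightarrow> x - y \<in> word_span R"
  "x \<in> word_span R \<Longrightarrow> - x \<in> word_span R"
  "x \<in> word_span R \<Longrightarrow> c *\<^sub>C x \<in> word_span R"
  unfolding word_span_def
  by (simp_all add: complex_vector.span_zero complex_vector.span_add complex_vector.span_diff
      complex_vector.span_neg complex_vector.span_scale)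

lemma word_span_sum: "(\<And>i. i \<in> A \<Longrightarrow> f i \<in> word_span R) \<Longrightarrow> (\<Sum>i\<in>A. f i) \<in> word_span R"
  unfolding word_span_def by (rule complex_vector.span_sum)

lemma word_span_image:
  assumes "clinear f" "x \<in> word_span R" "\<And>as. R as \<Longrightarrow> f (monomial as) \<in> word_span S"
  shows "f x \<in> word_span S"
  using span_linear_image[OF assms(1) assms(2)[unfolded word_span_def]] assms(3)
  unfolding word_span_def by blast

lemma word_span_mono:
  assumes "x \<in> word_span R" "\<And>as. R as \<Longrightarrow> S as"
  shows "x \<in> word_span S"
  using word_span_image[OF clinear_ident assms(1)] assms(2) word_span_base by blast

lemma word_span_mult:
  assumes "x \<in> word_span R" "y \<in> word_span S" "\<And>as bs. R as \<Longrightarrow> S bs \<Longrightarrow> U (as @ bs)"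
  shows "x * y \<in> word_span U"
proof (rule word_span_image[OF _ assms(1), of "\<lambda>x. x * y"])
  show "clinear (\<lambda>x. x * y)" by (intro clinear_mult_left clinear_ident)
next
  fix as
  assume R: "R as"
  show "monomial as * y \<in> word_span U"
  proof (rule word_span_image[OF _ assms(2), of "\<lambda>y. monomial as * y"])
    show "clinear (\<lambda>y. monomial as * y)" by (intro clinear_mult_right clinear_ident)
    show "monomial as * monomial bs \<in> word_span U" if "S bs" for bs
      using word_span_base[of U "as @ bs"] assms(3)[OF R that] by simp
  qed
qed

lemma word_span_eq:
  assumes "clinear f" "clinear g" "x \<in> word_span R" "\<And>as. R as \<Longrightarrow> f (monomial as) = g (monomial as)"
  shows "f x = g x"
  using clinear_eq_on_span[OF assms(1,2) assms(3)[unfolded word_span_def]] assms(4) by blast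

lemma word_span_True: "x \<in> word_span (\<lambda>_. True)"
proof (induction x rule: tensor_algebra_induct)
  case (word c vs)
  have "tword_prod vs \<in> word_span (\<lambda>_. True)"
  proof (induction vs)
    case Nil
    then show ?case using word_span_base[of "\<lambda>_. True" "[]"] by simp
  next
    case (Cons v vs)
    have "tgen v \<in> word_span (\<lambda>_. True)"
      using word_span_base[of "\<lambda>_. True" "[Con (fst v)]"] word_span_base[of "\<lambda>_. True" "[Cur (snd v)]"]
      by (cases v) (auto simp: tgen_Pair simp del: gval.simps intro: word_span_subspace)
    then show ?case using word_span_mult[OF _ Cons] by auto
  qed
  then show ?case by (rule word_span_subspace)
qed (rule word_span_subspace)

lemma weil1_eqI:
  assumes "clinear f" "clinear g" "\<And>as. f (monomial as) = g (monomial as)"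
  shows "f x = g x"
  by (rule word_span_eq[OF assms(1,2) word_span_True assms(3)])

text \<open>Gives uniqueness for derivations, \<open>cyc_t\<close>, \<open>cyc_bt\<close> and the
  characteristic map, all of which are prescribed one leading generator at a time.\<close>

lemma weil1_eq_induct:
  assumes "clinear f" "clinear g" "f 1 = g 1"
    "\<And>a as. f (monomial as) = g (monomial as) \<Longrightarrow> f (gval a * monomial as) = g (gval a * monomial as)"
  shows "f x = g x"
proof (rule weil1_eqI[OF assms(1,2)])
  show "f (monomial as) = g (monomial as)" for as
    by (induction as) (simp_all add: assms(3,4))
qed

lemma monomial_in_weil_comp: "monomial as \<in> weil_comp (mdeg as)"
  unfolding weil_comp_eq by (rule word_span_base) simp

lemma gval_in_weil_comp: "gval a \<in> weil_comp (gdeg a)"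
  using monomial_in_weil_comp[of "[a]"] by simp

lemma one_in_weil_comp: "1 \<in> weil_comp 0"
  using monomial_in_weil_comp[of "[]"] by simp

lemma weil_comp_subspace:
  "0 \<in> weil_comp k"
  "x \<in> weil_comp k \<Longrightarrow> y \<in> weil_comp k \<Longrightarrow> x + y \<in> weil_comp k"
  "x \<in> weil_comp k \<Longrightarrow> y \<in> weil_comp k \<Longrightarrow> x - y \<in> weil_comp k"
  "x \<in> weil_comp k \<Longrightarrow> - x \<in> weil_comp k"
  "x \<in> weil_comp k \<Longrightarrow> c *\<^sub>C x \<in> weil_comp k"
  unfolding weil_comp_eq by (fact word_span_subspace)+

lemma weil_comp_mult: "x \<in> weil_comp j \<Longrightarrow> y \<in> weil_comp k \<Longrightarrow> x * y \<in> weil_comp (j + k)"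
  unfolding weil_comp_eq by (erule word_span_mult) auto

lemma weil_comp_eqI:
  assumes "clinear f" "clinear g" "x \<in> weil_comp k"
    and "\<And>as. mdeg as = k \<Longrightarrow> f (monomial as) = g (monomial as)"
  shows "f x = g x"
  using word_span_eq[OF assms(1,2) assms(3)[unfolded weil_comp_eq]] assms(4) by blast

section \<open>Operators on the Weil algebra\<close>

lemma gval_cases: obtains h where "a = Con h" "gval a = tgen (h, 0)" "gdeg a = 1"
  | h where "a = Cur h" "gval a = tgen (0, h)" "gdeg a = 2"
  by (cases a) simp_all

text \<open>The parity sign of a single letter (a, b): the first summand has degree 1 and the second
  degree 2. Written this way the Koszul sign stays linear in the letter and can enter a
  recursion.\<close>

lemma clinear_sign_tgen: "clinear (\<lambda>v. tgen (- fst v, snd v))"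
  by (intro clinear_comp[OF clinear_tgen] clinear_Pair clinear_neg clinear_fst clinear_snd)

lemma weil_sign_spec:
  "clinear (weil_sign :: 'h::complex_vector weil1 \<Rightarrow> 'h weil1) \<and>
    (\<forall>k. \<forall>x\<in>weil_comp k. (weil_sign x :: 'h weil1) = ksign k *\<^sub>C x)" (is "?P weil_sign")
proof -
  obtain G :: "'h weil1 \<Rightarrow> 'h weil1" where G: "clinear G" "G 1 = 1"
    "\<And>v x. G (tgen v * x) = 0 + tgen (- fst v, snd v) * G x"
    by (rule tensor_rec[where L="\<lambda>v x. 0" and R="\<lambda>v y. tgen (- fst v, snd v) * y" and e=1,
      OF clinear_zero clinear_zero clinear_mult_left[OF clinear_sign_tgen]
        clinear_mult_right[OF clinear_ident]]) blast
  have uminus: "tgen (- h, 0) = - tgen (h, 0 :: 'h)" for h :: 'h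
    using clinear_uminus[OF clinear_con, of h] by simp
  have word: "G (monomial as) = ksign (mdeg as) *\<^sub>C monomial as" for as
  proof (induction as)
    case (Cons a as)
    show ?case
      by (cases a rule: gval_cases) (simp_all add: G(3) Cons uminus ksign_add)
  qed (simp add: G(2))
  have "clinear G \<and> (\<forall>k. \<forall>x\<in>weil_comp k. G x = ksign k *\<^sub>C x)"
    by (intro conjI G(1) allI ballI,
      rule weil_comp_eqI[OF G(1) clinear_scale[OF clinear_ident]], auto simp: word)
  moreover have "F = G" if "clinear F \<and> (\<forall>k. \<forall>x\<in>weil_comp k. F x = ksign k *\<^sub>C x)" for F
  proof
    show "F x = G x" for x
      by (rule weil1_eqI) (use that monomial_in_weil_comp in \<open>auto simp: G(1) word\<close>)
  qed
  ultimately show ?thesis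
    unfolding weil_sign_def
    by (rule theI[where P = ?P])
qed

lemma clinear_weil_sign: "clinear weil_sign"
  and weil_sign_comp: "x \<in> weil_comp k \<Longrightarrow> weil_sign x = ksign k *\<^sub>C x"
  using weil_sign_spec by auto

lemma weil_sign_monomial: "weil_sign (monomial as) = ksign (mdeg as) *\<^sub>C monomial as"
  by (rule weil_sign_comp[OF monomial_in_weil_comp])

lemma weil_sign_one [simp]: "weil_sign 1 = 1"
  using weil_sign_monomial[of "[]"] by simp

lemma weil_sign_weil_sign [simp]: "weil_sign (weil_sign x) = x"
  by (rule weil1_eqI[OF clinear_comp[OF clinear_weil_sign clinear_weil_sign] clinear_ident])
    (simp add: weil_sign_monomial clinear_scaleC[OF clinear_weil_sign])

lemma weil_sign_mult: "weil_sign (x * y) = weil_sign x * weil_sign y"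
proof (rule weil1_eqI[where x = x])
  show "clinear (\<lambda>x. weil_sign (x * y))" "clinear (\<lambda>x. weil_sign x * weil_sign y)"
    by (intro clinear_comp[OF clinear_weil_sign] clinear_mult_left clinear_ident clinear_weil_sign)+
  fix as
  show "weil_sign (monomial as * y) = weil_sign (monomial as) * weil_sign y"
  proof (rule weil1_eqI[where x = y])
    show "clinear (\<lambda>y. weil_sign (monomial as * y))" "clinear (\<lambda>y. weil_sign (monomial as) * weil_sign y)"
      by (intro clinear_comp[OF clinear_weil_sign] clinear_mult_right clinear_ident clinear_weil_sign)+
    show "weil_sign (monomial as * monomial bs) = weil_sign (monomial as) * weil_sign (monomial bs)" for bs
      using weil_sign_monomial[of "as @ bs"] by (simp add: weil_sign_monomial ksign_add mult.commute)
  qed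
qed

lemma derivation_clinear: "graded_derivation D \<Longrightarrow> clinear D"
  and derivation_mult: "graded_derivation D \<Longrightarrow> x \<in> weil_comp k \<Longrightarrow> D (x * y) = D x * y + ksign k *\<^sub>C (x * D y)"
  and derivation_gval: "graded_derivation D \<Longrightarrow> D (gval a * y) = D (gval a) * y + ksign (gdeg a) *\<^sub>C (gval
    a * D y)"
  using gval_in_weil_comp[of a] by (auto simp: graded_derivation_def)

lemma graded_derivation_one: "graded_derivation D \<Longrightarrow> D 1 = 0"
  using derivation_mult[OF _ one_in_weil_comp, of D 1] by simp

lemma graded_derivation_eqI:
  assumes "graded_derivation D" "graded_derivation E" "\<And>a. D (gval a) = E (gval a)"
  shows "D = E"
proof
  fix x
  show "D x = E x"
  proof (rule weil1_eq_induct[where f = D and g = E])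
    show "clinear D" "clinear E" using assms by (auto simp: graded_derivation_def)
    show "D 1 = E 1" using assms by (simp add: graded_derivation_one)
    show "D (gval a * monomial as) = E (gval a * monomial as)" if "D (monomial as) = E (monomial as)" for a as
      using assms gval_in_weil_comp[of a] that by (auto simp: graded_derivation_def)
  qed
qed

text \<open>The Leibniz rule for one leading letter, with its sign moved into the letter, is a
  linear recursion and defines \<open>D\<close>. The rule for an arbitrary left factor follows by
  induction on the length of that factor.\<close>

lemma weil_derivation_spec:
  fixes f g :: "'h::complex_vector \<Rightarrow> 'h weil1"
  assumes f: "clinear f" and g: "clinear g"
  shows "graded_derivation (weil_derivation f g) \<and> (\<forall>h. weil_derivation f g (con h) = f h) \<and>
    (\<forall>h. weil_derivation f g (\<omega> h) = g h)" (is "?P (weil_derivation f g)")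
proof -
  have L: "clinear (\<lambda>v. (f (fst v) + g (snd v)) * x)" for x
    by (intro clinear_mult_left clinear_plus clinear_comp[OF f clinear_fst] clinear_comp[OF g clinear_snd])
  obtain D :: "'h weil1 \<Rightarrow> 'h weil1" where D: "clinear D" "D 1 = 0"
    "\<And>v x. D (tgen v * x) = (f (fst v) + g (snd v)) * x + tgen (- fst v, snd v) * D x"
    by (rule tensor_rec[where L="\<lambda>v x. (f (fst v) + g (snd v)) * x"
        and R="\<lambda>v y. tgen (- fst v, snd v) * y" and e=0,
      OF L clinear_mult_right[OF clinear_ident] clinear_mult_left[OF clinear_sign_tgen]
        clinear_mult_right[OF clinear_ident]]) blast
  have uminus: "tgen (- h, 0) = - tgen (h, 0 :: 'h)" for h :: 'h
    using clinear_uminus[OF clinear_con, of h] by simp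
  have gen: "D (gval a) = (case a of Con h \<Rightarrow> f h | Cur h \<Rightarrow> g h)" for a
    by (cases a) (use D(3)[of "(_, _)" 1] in \<open>simp_all add: D(2) clinear_0[OF f] clinear_0[OF g]\<close>)
  have Cons: "D (gval a * x) = D (gval a) * x + ksign (gdeg a) *\<^sub>C (gval a * D x)" for a x
    unfolding gen
    by (cases a) (simp_all add: D(3) uminus clinear_0[OF f] clinear_0[OF g])
  have word: "D (monomial as * y) = D (monomial as) * y + ksign (mdeg as) *\<^sub>C (monomial as * D y)" for as y
    by (induction as) (simp_all add: Cons D(2) mult.assoc ksign_add algebra_simps scaleC_add_right)
  have "D (x * y) = D x * y + ksign k *\<^sub>C (x * D y)" if "x \<in> weil_comp k" for k x y
    by (rule weil_comp_eqI[OF clinear_comp[OF D(1) clinear_mult_left[OF clinear_ident]]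
          clinear_plus[OF clinear_mult_left[OF D(1)] clinear_scale[OF clinear_mult_left[OF clinear_ident]]]
          that])
      (auto simp: word)
  then have "graded_derivation D"
    by (simp add: graded_derivation_def D(1))
  then have spec: "graded_derivation D \<and> (\<forall>h. D (con h) = f h) \<and> (\<forall>h. D (\<omega> h) = g h)"
    using gen[of "Con _"] gen[of "Cur _"] by simp
  moreover have "E = D" if "graded_derivation E \<and> (\<forall>h. E (con h) = f h) \<and> (\<forall>h. E (\<omega> h) = g h)" for E
  proof (rule graded_derivation_eqI)
    show "E (gval a) = D (gval a)" for a
      using that spec by (cases a) (auto simp del: gval.simps)
  qed (use that spec in auto)
  ultimately show ?thesis
    unfolding weil_derivation_def
    by (rule theI[where P = ?P])
qed

text \<open>The sign for moving a generator past x is the parity of x if the generator has degree 1,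
  and trivial if it has degree 2. So rotation is linear in the letter once the parity is expressed
  by \<open>weil_sign\<close>.\<close>

lemma cyc_t_spec:
  "clinear (cyc_t :: 'h::complex_vector weil1 \<Rightarrow> 'h weil1) \<and> cyc_t (1 :: 'h weil1) = 0 \<and>
    (\<forall>a k. \<forall>x\<in>weil_comp k. cyc_t (gval a * x :: 'h weil1) = ksign (gdeg a * k) *\<^sub>C (x * gval a))"
    (is "?P cyc_t")
proof -
  have L1: "clinear (\<lambda>v. weil_sign x * con (fst v) + x * \<omega> (snd v))" for x :: "'h weil1"
    by (intro clinear_plus clinear_mult_right clinear_comp[OF clinear_con clinear_fst]
      clinear_comp[OF clinear_cur clinear_snd])
  have L2: "clinear (\<lambda>x. weil_sign x * con (fst v) + x * \<omega> (snd v))" for v :: "'h \<times> 'h"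
    by (intro clinear_plus clinear_mult_left clinear_weil_sign clinear_ident)
  obtain T :: "'h weil1 \<Rightarrow> 'h weil1" where T: "clinear T" "T 1 = 0"
    "\<And>v x. T (tgen v * x) = (weil_sign x * con (fst v) + x * \<omega> (snd v)) + 0"
    by (rule tensor_rec[where L="\<lambda>v x. weil_sign x * con (fst v) + x * \<omega> (snd v)"
      and R="\<lambda>v y. 0" and e=0, OF L1 L2 clinear_zero clinear_zero]) blast
  have zero: "tgen (0 :: 'h, 0 :: 'h) = 0"
    using clinear_0[OF clinear_con] by simp
  have "T (gval a * x) = ksign (gdeg a * k) *\<^sub>C (x * gval a)" if "x \<in> weil_comp k" for a k x
    by (cases a) (simp_all add: T(3) weil_sign_comp[OF that] ksign_def zero)
  then have spec: "clinear T \<and> T 1 = 0 \<and> (\<forall>a k. \<forall>x\<in>weil_comp k. T (gval a * x) = ksign (gdeg a * k) *\<^sub>C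
    (x * gval a))"
    by (simp add: T)
  moreover have "F = T" if "clinear F \<and> F 1 = 0 \<and>
    (\<forall>a k. \<forall>x\<in>weil_comp k. F (gval a * x) = ksign (gdeg a * k) *\<^sub>C (x * gval a))" for F
  proof
    show "F x = T x" for x
      proof (rule weil1_eq_induct[where f = F and g = T])
      show "F (gval a * monomial as) = T (gval a * monomial as)" for a as
        using that spec monomial_in_weil_comp[of as] by metis
    qed (use that spec in auto)
  qed
  ultimately show ?thesis
    unfolding cyc_t_def
    by (rule theI[where P = ?P])
qed

lemma clinear_cyc_t: "clinear cyc_t"
  and cyc_t_one [simp]: "cyc_t 1 = 0"
  and cyc_t_gval: "x \<in> weil_comp k \<Longrightarrow> cyc_t (gval a * x) = ksign (gdeg a * k) *\<^sub>C (x * gval a)"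
  using cyc_t_spec by auto

section \<open>Cyclic permutations\<close>

lemma cyc_t_Cons: "cyc_t (gval a * monomial as) = ksign (gdeg a * mdeg as) *\<^sub>C (monomial as * gval a)"
  by (rule cyc_t_gval[OF monomial_in_weil_comp])

text \<open>Each rotation moves one generator of \<open>us\<close> past everything behind it. A pair
  of generators of \<open>us\<close> passes each other twice, so these signs cancel and only those
  from passing \<open>y\<close> survive.\<close>

lemma cyc_t_funpow_monomial:
  "y \<in> weil_comp k \<Longrightarrow>
    (cyc_t ^^ length us) (monomial us * y) = ksign (mdeg us * k) *\<^sub>C (y * monomial us)"
proof (induction us arbitrary: y k)
  case (Cons a us)
  have "monomial us * y \<in> weil_comp (mdeg us + k)"
    by (rule weil_comp_mult[OF monomial_in_weil_comp Cons.prems])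
  then have "(cyc_t ^^ length (a # us)) (monomial (a # us) * y) =
      ksign (gdeg a * (mdeg us + k)) *\<^sub>C (cyc_t ^^ length us) (monomial us * (y * gval a))"
    by (simp add: funpow_Suc_right mult.assoc cyc_t_gval clinear_scaleC[OF clinear_funpow[OF clinear_cyc_t]]
        del: funpow.simps)
  also have "\<dots> = ksign (gdeg a * (mdeg us + k)) *\<^sub>C ksign (mdeg us * (k + gdeg a)) *\<^sub>C (y * gval a *
    monomial us)"
    using Cons.IH[OF weil_comp_mult[OF Cons.prems gval_in_weil_comp]] by simp
  also have "\<dots> = ksign (mdeg (a # us) * k) *\<^sub>C (y * monomial (a # us))"
    by (simp add: mult.assoc ksign_def)
  finally show ?case .
qed simp

lemma cyc_t_funpow:
  assumes "x \<in> word_span (\<lambda>as. length as = p \<and> mdeg as = j)" "y \<in> weil_comp k"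
  shows "(cyc_t ^^ p) (x * y) = ksign (j * k) *\<^sub>C (y * x)"
  by (rule word_span_eq[OF clinear_comp[OF clinear_funpow[OF clinear_cyc_t] clinear_mult_left[OF
    clinear_ident]]
        clinear_scale[OF clinear_mult_right[OF clinear_ident]] assms(1)])
    (use cyc_t_funpow_monomial[OF assms(2)] in auto)

lemma cyc_t_funpow_length: "(cyc_t ^^ length as) (monomial as) = monomial as"
  using cyc_t_funpow_monomial[OF one_in_weil_comp, of as] by simp

lemma word_span_cyc_t:
  assumes "x \<in> word_span R" "\<And>a as. R (a # as) \<Longrightarrow> R (as @ [a])"
  shows "cyc_t x \<in> word_span R"
proof (rule word_span_image[OF clinear_cyc_t assms(1)])
  fix as assume "R as"
  then show "cyc_t (monomial as) \<in> word_span R"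
  proof (cases as)
    case (Cons a bs)
    then have "monomial (bs @ [a]) \<in> word_span R"
      using assms(2) \<open>R as\<close> by (intro word_span_base) simp
    then show ?thesis using Cons by (simp add: cyc_t_Cons word_span_subspace)
  qed (simp add: word_span_subspace)
qed

lemma word_span_cyc_t_funpow:
  assumes "x \<in> word_span R" "\<And>a as. R (a # as) \<Longrightarrow> R (as @ [a])"
  shows "(cyc_t ^^ i) x \<in> word_span R"
  by (induction i) (simp_all add: assms word_span_cyc_t)

subsection \<open>Operators depending on the length of a word\<close>

text \<open>Prescribes a linear operator separately in each tensor degree without constructing the
  projections. It is well defined because the relations of the tensor algebra replace one letter at
  a time and keep the length.\<close>

definition length_op :: "(nat \<Rightarrow> 'h::complex_vector weil1 \<Rightarrow> 'h weil1) \<Rightarrow> 'h weil1 \<Rightarrow> 'h weil1"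
  where "length_op L = tensor_ext (\<lambda>vs. L (length vs) (tword_prod vs))"

lemma multilinear_length_op:
  "(\<And>p. clinear (L p)) \<Longrightarrow> multilinear (\<lambda>vs. L (length vs) (tword_prod vs))"
  using clinear_comp[OF _ clinear_tword_prod]
  by (fastforce simp: multilinear_def)

lemma clinear_length_op: "(\<And>p. clinear (L p)) \<Longrightarrow> clinear (length_op L)"
  unfolding length_op_def by (rule clinear_tensor_ext[OF multilinear_length_op])

lemma monomial_eq_tword_prod:
  "monomial as = tword_prod (map (case_wgen (\<lambda>h. (h, 0)) (\<lambda>h. (0, h))) as)"
proof (induction as)
  case (Cons a as)
  then show ?case by (cases a) simp_all
qed simp

lemma length_op_monomial:
  "(\<And>p. clinear (L p)) \<Longrightarrow> length_op L (monomial as) = L (length as) (monomial as)"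
  by (simp add: length_op_def monomial_eq_tword_prod tensor_ext_word[OF multilinear_length_op])

lemma length_op_word_span:
  assumes "\<And>p. clinear (L p)" "x \<in> word_span (\<lambda>as. length as = p \<and> R as)"
  shows "length_op L x = L p x"
  by (rule word_span_eq[OF clinear_length_op[OF assms(1)] assms(1,2)])
    (simp add: length_op_monomial[OF assms(1)])

lemma cyc_N_spec:
  "clinear (cyc_N :: 'h::complex_vector weil1 \<Rightarrow> 'h weil1) \<and>
    (\<forall>as. cyc_N (monomial as :: 'h weil1) = (\<Sum>i<length as. (cyc_t ^^ i) (monomial as)))" (is "?P cyc_N")
proof -
  have L: "clinear (\<lambda>x :: 'h weil1. \<Sum>i<p. (cyc_t ^^ i) x)" for p
    by (intro clinear_setsum clinear_funpow clinear_cyc_t)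
  define G :: "'h weil1 \<Rightarrow> 'h weil1" where "G = length_op (\<lambda>p x. \<Sum>i<p. (cyc_t ^^ i) x)"
  have "?P G"
    unfolding G_def
    using clinear_length_op[where L = "\<lambda>p x. \<Sum>i<p. (cyc_t ^^ i) x", OF L]
      length_op_monomial[where L = "\<lambda>p x. \<Sum>i<p. (cyc_t ^^ i) x", OF L] by blast
  moreover have "F = G" if "?P F" for F
  proof
    show "F x = G x" for x
      by (rule weil1_eqI[where f = F and g = G]) (use that \<open>?P G\<close> in auto)
  qed
  ultimately show ?thesis
    unfolding cyc_N_def by (rule theI[where P = ?P])
qed

lemma clinear_cyc_N: "clinear cyc_N"
  and cyc_N_monomial: "cyc_N (monomial as) = (\<Sum>i<length as. (cyc_t ^^ i) (monomial as))"
  using cyc_N_spec by auto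

lemma cyc_N_word_span:
  assumes "x \<in> word_span (\<lambda>as. length as = p \<and> R as)"
  shows "cyc_N x = (\<Sum>i<p. (cyc_t ^^ i) x)"
  by (rule word_span_eq[OF clinear_cyc_N _ assms])
    (auto simp: cyc_N_monomial intro!: clinear_setsum clinear_funpow clinear_cyc_t)

text \<open>
  On words of length \<open>p\<close> the operator \<open>cyc_P\<close> is division by \<open>p\<close>, and \<open>cyc_Q\<close> is the polynomial
  in \<open>t\<close> with \<open>1 = N / p + (t - 1) Q\<close> modulo \<open>t\<^sup>p - 1\<close>.
\<close>

definition cyc_P :: "'h::complex_vector weil1 \<Rightarrow> 'h weil1"
  where "cyc_P = length_op (\<lambda>p x. (1 / of_nat p) *\<^sub>C x)"

definition cyc_Q :: "'h::complex_vector weil1 \<Rightarrow> 'h weil1"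
  where "cyc_Q = length_op (\<lambda>p x. - (1 / of_nat p) *\<^sub>C (\<Sum>i<p. \<Sum>j<i. (cyc_t ^^ j) x))"

lemma clinear_cyc_P: "clinear cyc_P"
  unfolding cyc_P_def by (intro clinear_length_op clinear_scale clinear_ident)

lemma cyc_P_word_span:
  "x \<in> word_span (\<lambda>as. length as = p \<and> R as) \<Longrightarrow> cyc_P x = (1 / of_nat p) *\<^sub>C x"
  unfolding cyc_P_def by (rule length_op_word_span) (intro clinear_scale clinear_ident)

lemma clinear_cyc_Q_aux:
  "clinear (\<lambda>x. - (1 / of_nat p) *\<^sub>C (\<Sum>i<p. \<Sum>j<i. (cyc_t ^^ j) x))"
  by (intro clinear_scale clinear_setsum clinear_funpow clinear_cyc_t)

lemma clinear_cyc_Q: "clinear cyc_Q"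
  unfolding cyc_Q_def by (intro clinear_length_op clinear_cyc_Q_aux)

lemma cyc_Q_word_span:
  "x \<in> word_span (\<lambda>as. length as = p \<and> R as) \<Longrightarrow>
    cyc_Q x = - (1 / of_nat p) *\<^sub>C (\<Sum>i<p. \<Sum>j<i. (cyc_t ^^ j) x)"
  unfolding cyc_Q_def by (rule length_op_word_span[OF clinear_cyc_Q_aux])

lemma monomial_length: "monomial as \<in> word_span (\<lambda>bs. length bs = length as \<and> True)"
  by (rule word_span_base) simp

lemma word_span_cyc_ops:
  assumes "x \<in> word_span R" "\<And>a as. R (a # as) \<Longrightarrow> R (as @ [a])"
  shows "cyc_N x \<in> word_span R" "cyc_P x \<in> word_span R" "cyc_Q x \<in> word_span R"
proof -
  have *: "(cyc_t ^^ i) (monomial as) \<in> word_span R" if "R as" for i as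
    using word_span_cyc_t_funpow[of _ R] word_span_base[of R] assms(2) that by blast
  show "cyc_N x \<in> word_span R"
    by (rule word_span_image[OF clinear_cyc_N assms(1)])
      (auto simp: cyc_N_monomial intro!: word_span_sum *)
  show "cyc_P x \<in> word_span R"
    by (rule word_span_image[OF clinear_cyc_P assms(1)])
      (auto simp: cyc_P_word_span[OF monomial_length] intro!: word_span_subspace(5) word_span_base)
  show "cyc_Q x \<in> word_span R"
    by (rule word_span_image[OF clinear_cyc_Q assms(1)])
      (auto simp: cyc_Q_word_span[OF monomial_length] simp del: complex_vector.scale_minus_left
        intro!: word_span_subspace(5) word_span_sum *)
qed

lemma cyc_t_monomial_length: "cyc_t (monomial as) \<in> word_span (\<lambda>bs. length bs = length as \<and> True)"
  by (rule word_span_cyc_t[OF monomial_length]) simp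

lemma cyc_N_monomial_length: "cyc_N (monomial as) \<in> word_span (\<lambda>bs. length bs = length as \<and> True)"
  by (rule word_span_cyc_ops(1)[OF monomial_length]) simp

text \<open>Shifting the index trades the term at 0 for the term at the length of the word, and
  these agree because a full turn is the identity. Hence t N = N = N t.\<close>

lemma sum_cyc_t_funpow_Suc:
  "(\<Sum>i<length as. (cyc_t ^^ Suc i) (monomial as)) = (\<Sum>i<length as. (cyc_t ^^ i) (monomial as))"
proof -
  have "(\<Sum>i<length as. (cyc_t ^^ Suc i) (monomial as)) + (cyc_t ^^ 0) (monomial as) =
      (\<Sum>i<length as. (cyc_t ^^ i) (monomial as)) + (cyc_t ^^ length as) (monomial as)"
    using sum.lessThan_Suc_shift[of "\<lambda>i. (cyc_t ^^ i) (monomial as)" "length as"]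
      sum.lessThan_Suc[of "\<lambda>i. (cyc_t ^^ i) (monomial as)" "length as"]
    by (simp only: add.commute)
  then show ?thesis by (simp add: cyc_t_funpow_length)
qed

lemma cyc_t_cyc_N [simp]: "cyc_t (cyc_N x) = cyc_N x"
  by (rule weil1_eqI[where x = x, OF clinear_comp[OF clinear_cyc_t clinear_cyc_N] clinear_cyc_N])
    (use sum_cyc_t_funpow_Suc in \<open>simp add: cyc_N_monomial clinear_sum[OF clinear_cyc_t]\<close>)

lemma cyc_N_cyc_t [simp]: "cyc_N (cyc_t x) = cyc_N x"
  by (rule weil1_eqI[where x = x, OF clinear_comp[OF clinear_cyc_N clinear_cyc_t] clinear_cyc_N])
    (use sum_cyc_t_funpow_Suc in \<open>simp add: cyc_N_word_span[OF cyc_t_monomial_length] cyc_N_monomial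
      funpow_swap1\<close>)

lemma cyc_N_cyc_t_funpow [simp]: "cyc_N ((cyc_t ^^ i) x) = cyc_N x"
  by (induction i) simp_all

lemma cyc_N_cyc_P: "cyc_N (cyc_P x) = cyc_P (cyc_N x)"
  by (rule weil1_eqI[where x = x, OF clinear_comp[OF clinear_cyc_N clinear_cyc_P]
        clinear_comp[OF clinear_cyc_P clinear_cyc_N]])
    (simp add: cyc_P_word_span[OF monomial_length] clinear_scaleC[OF clinear_cyc_N]
      cyc_P_word_span[OF cyc_N_monomial_length])

lemma cyc_t_cyc_Q: "cyc_t (cyc_Q x) = cyc_Q (cyc_t x)"
  by (rule weil1_eqI[where x = x, OF clinear_comp[OF clinear_cyc_t clinear_cyc_Q]
        clinear_comp[OF clinear_cyc_Q clinear_cyc_t]])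
    (simp add: cyc_Q_word_span[OF monomial_length] clinear_simps[OF clinear_cyc_t]
      cyc_Q_word_span[OF cyc_t_monomial_length] clinear_sum[OF clinear_cyc_t] funpow_swap1)

text \<open>Telescoping gives (t - 1)(1 + ... + t^(i-1)) = t^i - 1; averaging over i < p turns the
  right side into N / p - 1. Words must be nonempty for p to be invertible, which is why x lies in
  \<open>weil\<close>.\<close>

lemma cyc_decomposition:
  assumes "x \<in> weil"
  shows "x = cyc_N (cyc_P x) + (cyc_t (cyc_Q x) - cyc_Q x)"
proof (rule word_span_eq[OF clinear_ident _ assms[unfolded weil_eq]])
  show "clinear (\<lambda>x. cyc_N (cyc_P x) + (cyc_t (cyc_Q x) - cyc_Q x))"
    by (intro clinear_plus clinear_minus clinear_comp[OF clinear_cyc_N clinear_cyc_P]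
      clinear_comp[OF clinear_cyc_t clinear_cyc_Q] clinear_cyc_Q)
  fix as :: "'a wgen list"
  assume "as \<noteq> []"
  let ?m = "monomial as" and ?p = "length as" and ?c = "1 / of_nat (length as) :: complex"
  have "cyc_t (cyc_Q ?m) - cyc_Q ?m =
      - ?c *\<^sub>C (\<Sum>i<?p. \<Sum>j<i. (cyc_t ^^ Suc j) ?m - (cyc_t ^^ j) ?m)"
    by (simp add: cyc_Q_word_span[OF monomial_length] clinear_simps[OF clinear_cyc_t]
      clinear_sum[OF clinear_cyc_t] sum_subtractf complex_vector.scale_right_diff_distrib)
  also have "\<dots> = - ?c *\<^sub>C (\<Sum>i<?p. (cyc_t ^^ i) ?m - ?m)"
    using sum_lessThan_telescope[of "\<lambda>j. (cyc_t ^^ j) ?m"] by simp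
  also have "\<dots> = - ?c *\<^sub>C cyc_N ?m + ?m"
    using \<open>as \<noteq> []\<close>
    by (simp add: sum_subtractf cyc_N_monomial complex_vector.scale_right_diff_distrib
      complex_vector.sum_constant_scale del: sum_constant)
  finally show "?m = cyc_N (cyc_P ?m) + (cyc_t (cyc_Q ?m) - cyc_Q ?m)"
    by (simp add: cyc_P_word_span[OF monomial_length] clinear_scaleC[OF clinear_cyc_N])
qed

text \<open>N is a graded trace: N t = N, and \<open>length as\<close> rotations carry the left
  factor behind the right one with exactly the Koszul sign.\<close>

lemma cyc_N_mult_commute:
  assumes "x \<in> weil_comp j" "y \<in> weil_comp k"
  shows "cyc_N (x * y) = ksign (j * k) *\<^sub>C cyc_N (y * x)"
proof (rule weil_comp_eqI[OF _ _ assms(1)])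
  show "clinear (\<lambda>x. cyc_N (x * y))" "clinear (\<lambda>x. ksign (j * k) *\<^sub>C cyc_N (y * x))"
    by (intro clinear_scale clinear_comp[OF clinear_cyc_N] clinear_mult_left clinear_mult_right
      clinear_ident)+
  fix as :: "'a wgen list"
  assume j: "mdeg as = j"
  have "cyc_N (monomial as * y) = cyc_N ((cyc_t ^^ length as) (monomial as * y))" by simp
  also have "\<dots> = ksign (j * k) *\<^sub>C cyc_N (y * monomial as)"
    by (simp add: cyc_t_funpow_monomial[OF assms(2)] j clinear_scaleC[OF clinear_cyc_N])
  finally show "cyc_N (monomial as * y) = ksign (j * k) *\<^sub>C cyc_N (y * monomial as)" .
qed

section \<open>The differentials\<close>

primrec is_cur :: "'h wgen \<Rightarrow> bool" where
  "is_cur (Con h) = False"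
| "is_cur (Cur h) = True"

definition ncur :: "'h wgen list \<Rightarrow> nat"
  where "ncur as = length (filter is_cur as)"

lemma ncur_simps [simp]: "ncur [] = 0" "ncur (a # as) = of_bool (is_cur a) + ncur as"
  "ncur (as @ bs) = ncur as + ncur bs"
  by (simp_all add: ncur_def)

text \<open>The summand d of \<partial> that replaces a connection letter by its curvature. It keeps
  the length of words, whereas \<open>weil_diff0\<close> raises it by one, and this difference
  governs how each commutes with t.\<close>

definition lin_d :: "'h::complex_vector weil1 \<Rightarrow> 'h weil1"
  where "lin_d = weil_derivation \<omega> (\<lambda>h. 0)"

lemma lin_d_spec: "graded_derivation lin_d" "lin_d (con h) = \<omega> h" "lin_d (\<omega> h) = 0"
  using weil_derivation_spec[OF clinear_cur clinear_zero] unfolding lin_d_def by auto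

text \<open>One estimate tracks length, degree and number of curvatures together; \<open>l\<close>
  is 0 for \<open>lin_d\<close> and 1 for \<open>weil_diff0\<close>. The curvature count is only
  bounded below, since \<open>lin_d\<close> can create curvatures, and that bound keeps the powers
  of I stable.\<close>

lemma derivation_word_span:
  assumes D: "graded_derivation D"
    and gen: "\<And>a. D (gval a) \<in> word_span (\<lambda>bs. length bs = Suc l \<and> mdeg bs = gdeg a + 1 \<and> ncur [a] \<le> ncur bs)"
  shows "D (monomial as) \<in> word_span (\<lambda>bs. length bs = length as + l \<and> mdeg bs = mdeg as + 1 \<and> ncur as \<le>
    ncur bs)"
proof (induction as)
  case Nil
  show ?case by (simp add: graded_derivation_one[OF D] word_span_subspace)
next
  case (Cons a as)
  have "D (gval a) * monomial as \<in> word_span (\<lambda>bs. length bs = length (a # as) + l \<and>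
      mdeg bs = mdeg (a # as) + 1 \<and> ncur (a # as) \<le> ncur bs)"
    by (rule word_span_mult[OF gen word_span_base[of "\<lambda>bs. bs = as"]]) auto
  moreover have "gval a * D (monomial as) \<in> word_span (\<lambda>bs. length bs = length (a # as) + l \<and>
      mdeg bs = mdeg (a # as) + 1 \<and> ncur (a # as) \<le> ncur bs)"
    using word_span_mult[OF word_span_base[of "\<lambda>bs. bs = [a]" "[a]"] Cons,
        of "\<lambda>bs. length bs = length (a # as) + l \<and>
      mdeg bs = mdeg (a # as) + 1 \<and> ncur (a # as) \<le> ncur bs"] by auto
  ultimately show ?case
    by (simp add: derivation_gval[OF D] word_span_subspace)
qed

lemma lin_d_word_span:
  "lin_d (monomial as) \<in> word_span (\<lambda>bs. length bs = length as + 0 \<and> mdeg bs = mdeg as + 1 \<and> ncur as \<le>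
    ncur bs)"
proof (rule derivation_word_span[OF lin_d_spec(1)])
  show "lin_d (gval a) \<in> word_span (\<lambda>bs. length bs = Suc 0 \<and> mdeg bs = gdeg a + 1 \<and> ncur [a] \<le> ncur bs)"
    for a :: "'a wgen"
  proof (cases a)
    case (Con h)
    then show ?thesis
      using word_span_base[of "\<lambda>bs. length bs = Suc 0 \<and> mdeg bs = gdeg a + 1 \<and> ncur [a] \<le> ncur bs" "[Cur h]"]
      by (simp add: lin_d_spec del: gval.simps)
  qed (simp add: lin_d_spec word_span_subspace del: gval.simps)
qed

context coalgebra
begin

abbreviation wd where "wd \<equiv> weil_diff \<Delta>"
abbreviation wd0 where "wd0 \<equiv> weil_diff0 \<Delta>"

lemma bilin_minus: "bilin F \<Longrightarrow> bilin G \<Longrightarrow> bilin (\<lambda>a b. F a b - G a b)"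
  and bilin_neg: "bilin F \<Longrightarrow> bilin (\<lambda>a b. - F a b)"
  by (simp_all add: bilin_def clinear_minus clinear_neg)

lemma bilin_words: "bilin (\<lambda>a b. con a * con b)" "bilin (\<lambda>a b. \<omega> a * con b)"
  "bilin (\<lambda>a b. con a * \<omega> b)" "bilin (\<lambda>a b. \<omega> a * \<omega> b)"
  by (rule bilin_tensor_mult; fact clinear_con clinear_cur)+

lemma weil_diff_spec: "graded_derivation wd"
  "wd (con h) = \<omega> h - sweedler \<Delta> (\<lambda>a b. con a * con b) h"
  "wd (\<omega> h) = sweedler \<Delta> (\<lambda>a b. \<omega> a * con b) h - sweedler \<Delta> (\<lambda>a b. con a * \<omega> b) h"
  using weil_derivation_spec[OF
      clinear_minus[OF clinear_cur clinear_sweedler[OF bilin_words(1)]]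
      clinear_minus[OF clinear_sweedler[OF bilin_words(2)] clinear_sweedler[OF bilin_words(3)]]]
  unfolding weil_diff_def by auto

lemma weil_diff0_spec: "graded_derivation wd0"
  "wd0 (con h) = - sweedler \<Delta> (\<lambda>a b. con a * con b) h"
  "wd0 (\<omega> h) = sweedler \<Delta> (\<lambda>a b. \<omega> a * con b) h - sweedler \<Delta> (\<lambda>a b. con a * \<omega> b) h"
  using weil_derivation_spec[OF
      clinear_neg[OF clinear_sweedler[OF bilin_words(1)]]
      clinear_minus[OF clinear_sweedler[OF bilin_words(2)] clinear_sweedler[OF bilin_words(3)]]]
  unfolding weil_diff0_def by auto

lemmas clinear_wd = derivation_clinear[OF weil_diff_spec(1)]
lemmas clinear_wd0 = derivation_clinear[OF weil_diff0_spec(1)]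
lemmas clinear_lin_d = derivation_clinear[OF lin_d_spec(1)]

lemma weil_diff_eq: "wd x = wd0 x + lin_d x"
proof -
  have "graded_derivation (\<lambda>x. wd0 x + lin_d x)"
    using weil_diff0_spec(1) lin_d_spec(1) unfolding graded_derivation_def
    by (auto intro: clinear_plus simp: algebra_simps scaleC_add_right)
  then have "wd = (\<lambda>x. wd0 x + lin_d x)"
  proof (rule graded_derivation_eqI[OF weil_diff_spec(1)])
    show "wd (gval a) = wd0 (gval a) + lin_d (gval a)" for a
      by (cases a) (simp_all add: weil_diff_spec weil_diff0_spec lin_d_spec del: gval.simps)
  qed
  then show ?thesis by metis
qed

lemma sweedler_word_span:
  assumes "bilin F" "\<And>a b. F a b \<in> word_span R"
  shows "sweedler \<Delta> F h \<in> word_span R"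
proof -
  obtain ps where ps: "\<Delta> h = (\<Sum>(a, b)\<leftarrow>ps. tgen a * tgen b)" by (rule comult_eq_sum_list)
  have "(\<Sum>(a, b)\<leftarrow>ps. F a b) \<in> word_span R"
    by (induction ps) (auto intro: word_span_subspace assms(2))
  then show ?thesis by (simp add: sweedler_eq[where \<Delta>=\<Delta> and h=h, OF assms(1) ps])
qed

lemma wd0_gval:
  "wd0 (gval a) \<in> word_span (\<lambda>bs. length bs = Suc 1 \<and> mdeg bs = gdeg a + 1 \<and> ncur [a] \<le> ncur bs)"
proof -
  have word: "gval b * gval c \<in> word_span R" if "R [b, c]" for b c and R :: "'h wgen list \<Rightarrow> bool"
    using word_span_base[of R "[b, c]"] that by simp
  show ?thesis
    by (cases a)
      (auto simp: weil_diff0_spec simp del: gval.simps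
        intro!: word_span_subspace(3,4) sweedler_word_span bilin_words word)
qed

lemma wd0_word_span:
  "wd0 (monomial as) \<in> word_span (\<lambda>bs. length bs = length as + 1 \<and> mdeg bs = mdeg as + 1 \<and> ncur as \<le> ncur bs)"
  by (rule derivation_word_span[OF weil_diff0_spec(1) wd0_gval])

lemma wd_word_span:
  "wd (monomial as) \<in> word_span (\<lambda>bs. length as \<le> length bs \<and> mdeg bs = mdeg as + 1 \<and> ncur as \<le> ncur bs)"
  unfolding weil_diff_eq
  by (intro word_span_subspace(2) word_span_mono[OF wd0_word_span] word_span_mono[OF lin_d_word_span]) auto

lemma wd0_weil_comp: "x \<in> weil_comp k \<Longrightarrow> wd0 x \<in> weil_comp (k + 1)"
  unfolding weil_comp_eq
  by (erule word_span_image[OF clinear_wd0], rule word_span_mono[OF wd0_word_span]) auto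

lemma lin_d_weil_comp: "x \<in> weil_comp k \<Longrightarrow> lin_d x \<in> weil_comp (k + 1)"
  unfolding weil_comp_eq
  by (erule word_span_image[OF clinear_lin_d], rule word_span_mono[OF lin_d_word_span]) auto

lemma wd_weil_comp: "x \<in> weil_comp k \<Longrightarrow> wd x \<in> weil_comp (k + 1)"
  by (simp add: weil_diff_eq wd0_weil_comp lin_d_weil_comp weil_comp_subspace)

lemma sweedler_mult_left:
  "bilin F \<Longrightarrow> sweedler \<Delta> F a * y = sweedler \<Delta> (\<lambda>c d. F c d * y) a" for y :: "'h weil1"
  by (rule sweedler_apply[symmetric, OF _ clinear_mult_left[OF clinear_ident]])

lemma sweedler_mult_right:
  "bilin F \<Longrightarrow> y * sweedler \<Delta> F a = sweedler \<Delta> (\<lambda>c d. y * F c d) a" for y :: "'h weil1"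
  by (rule sweedler_apply[symmetric, OF _ clinear_mult_right[OF clinear_ident]])

lemma sweedler_coassoc_words:
  fixes f g k :: "'h \<Rightarrow> 'h weil1"
  assumes "clinear f" "clinear g" "clinear k"
  shows "sweedler \<Delta> (\<lambda>a b. sweedler \<Delta> (\<lambda>c d. f c * g d) a * k b) h =
    sweedler \<Delta> (\<lambda>a b. f a * sweedler \<Delta> (\<lambda>c d. g c * k d) b) h"
  using sweedler_coassoc[of "\<lambda>a b c. f a * g b * k c" h]
  by (simp add: sweedler_mult_left sweedler_mult_right bilin_tensor_mult assms
      clinear_mult_left clinear_mult_right mult.assoc)

lemma bilin_sweedler_left:
  "bilin F \<Longrightarrow> clinear k \<Longrightarrow> bilin (\<lambda>a b. sweedler \<Delta> F a * k b)" for k :: "'h \<Rightarrow> 'h weil1"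
  by (intro bilin_tensor_mult clinear_sweedler)

lemma bilin_sweedler_right:
  "bilin F \<Longrightarrow> clinear k \<Longrightarrow> bilin (\<lambda>a b. k a * sweedler \<Delta> F b)" for k :: "'h \<Rightarrow> 'h weil1"
  by (intro bilin_tensor_mult clinear_sweedler)

lemma derivation_con: "graded_derivation D \<Longrightarrow> D (con a * y) = D (con a) * y - con a * D y"
  and derivation_cur: "graded_derivation D \<Longrightarrow> D (\<omega> a * y) = D (\<omega> a) * y + \<omega> a * D y"
  using derivation_gval[of D "Con a" y] derivation_gval[of D "Cur a" y] by simp_all

lemma derivation_sweedler:
  "graded_derivation D \<Longrightarrow> bilin F \<Longrightarrow> D (sweedler \<Delta> F h) = sweedler \<Delta> (\<lambda>a b. D (F a b)) h"
  by (rule sweedler_apply[symmetric]) (simp_all add: derivation_clinear)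

text \<open>Coassociativity matches the two ways of splitting h into three. For a connection letter
  the two cubic sums cancel; for a curvature letter there are six, cancelling in pairs according to
  the position of \<omega>.\<close>

lemma wd0_wd0_gval: "wd0 (wd0 (gval a)) = 0"
proof (cases a)
  case (Con h)
  have "wd0 (wd0 (con h)) = - sweedler \<Delta> (\<lambda>a b. con a * sweedler \<Delta> (\<lambda>a b. con a * con b) b
      - sweedler \<Delta> (\<lambda>a b. con a * con b) a * con b) h"
    by (simp add: weil_diff0_spec derivation_sweedler bilin_words derivation_con
        clinear_uminus[OF clinear_wd0] del: gval.simps)
  also have "\<dots> = 0"
    by (subst sweedler_minus)
      (simp_all add: sweedler_coassoc_words bilin_words clinear_con bilin_sweedler_left
        bilin_sweedler_right del: gval.simps)
  finally show ?thesis using Con by simp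
next
  case (Cur h)
  let ?A = "\<lambda>f g k a b. sweedler \<Delta> (\<lambda>c d. f c * g d) a * k b"
    and ?B = "\<lambda>f g k a b. f a * sweedler \<Delta> (\<lambda>c d. g c * k d) b"
  have "wd0 (wd0 (\<omega> h)) = sweedler \<Delta> (\<lambda>a b. ((?A \<omega> con con a b - ?A con \<omega> con a b) - ?B \<omega> con con a b)) h
    - sweedler \<Delta> (\<lambda>a b. - ?A con con \<omega> a b - (?B con \<omega> con a b - ?B con con \<omega> a b)) h"
    by (simp add: weil_diff0_spec derivation_sweedler bilin_words derivation_con derivation_cur
        clinear_diff[OF clinear_wd0] left_diff_distrib right_diff_distrib del: gval.simps)
  also have "\<dots> = 0"
    by (simp add: sweedler_minus sweedler_uminus bilin_words clinear_con clinear_cur bilin_sweedler_left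
        bilin_sweedler_right bilin_minus bilin_neg sweedler_coassoc_words del: gval.simps)
  finally show ?thesis using Cur by simp
qed

lemma lin_d_wd0_gval: "wd0 (lin_d (gval a)) + lin_d (wd0 (gval a)) = 0"
  by (cases a) (simp_all add: weil_diff0_spec lin_d_spec derivation_sweedler bilin_words derivation_con
    derivation_cur
        clinear_simps[OF clinear_lin_d] clinear_0[OF clinear_wd0] sweedler_minus del: gval.simps)

lemma lin_d_lin_d_gval: "lin_d (lin_d (gval a)) = 0"
  by (cases a) (simp_all add: lin_d_spec clinear_0[OF clinear_lin_d] del: gval.simps)

lemma wd_wd_gval: "wd (wd (gval a)) = 0"
  using wd0_wd0_gval[of a] lin_d_wd0_gval[of a] lin_d_lin_d_gval[of a]
  by (simp add: weil_diff_eq clinear_add[OF clinear_wd0] clinear_add[OF clinear_lin_d] add.assoc)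

text \<open>Generators carry all the content. On a product the two mixed terms, in which each factor
  is differentiated once, have opposite signs because \<partial> raises the degree by one.\<close>

lemma wd_wd [simp]: "wd (wd x) = 0"
proof (rule weil1_eq_induct[where f = "\<lambda>x. wd (wd x)" and g = "\<lambda>_. 0"])
  show "clinear (\<lambda>x. wd (wd x))" by (rule clinear_comp[OF clinear_wd clinear_wd])
  show "wd (wd 1) = 0"
    by (simp add: graded_derivation_one[OF weil_diff_spec(1)] clinear_0[OF clinear_wd])
  show "wd (wd (gval a * monomial as)) = 0" if "wd (wd (monomial as)) = 0" for a as
    using that derivation_mult[OF weil_diff_spec(1) wd_weil_comp[OF gval_in_weil_comp]]
    by (simp add: derivation_gval[OF weil_diff_spec(1)] clinear_simps[OF clinear_wd] wd_wd_gval ksign_add)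
qed (rule clinear_zero)

subsection \<open>The operator \<open>b\<close>\<close>

lemma cyc_bt_spec: "clinear (cyc_bt \<Delta>) \<and> cyc_bt \<Delta> 1 = 0 \<and>
    (\<forall>a x. cyc_bt \<Delta> (gval a * x) = cyc_t (wd0 (gval a) * x))" (is "?P (cyc_bt \<Delta>)")
proof -
  obtain G :: "'h weil1 \<Rightarrow> 'h weil1" where G: "clinear G" "G 1 = 0"
    "\<And>v x. G (tgen v * x) = cyc_t (wd0 (tgen v) * x) + 0"
    by (rule tensor_rec[where L="\<lambda>v x. cyc_t (wd0 (tgen v) * x)" and R="\<lambda>v y. 0" and e=0,
      OF clinear_comp[OF clinear_cyc_t clinear_mult_left[OF clinear_comp[OF clinear_wd0 clinear_tgen]]]
        clinear_comp[OF clinear_cyc_t clinear_mult_right[OF clinear_ident]] clinear_zero clinear_zero]) blast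
  have spec: "?P G"
  proof (intro conjI G(1,2) allI)
    show "G (gval a * x) = cyc_t (wd0 (gval a) * x)" for a x
      by (cases a) (simp_all add: G(3))
  qed
  moreover have "F = G" if "?P F" for F
  proof
    show "F x = G x" for x
      by (rule weil1_eq_induct[where f = F and g = G]) (use that spec in auto)
  qed
  ultimately show ?thesis
    unfolding cyc_bt_def by (rule theI[where P = ?P])
qed

lemma clinear_cyc_bt: "clinear (cyc_bt \<Delta>)"
  and cyc_bt_one [simp]: "cyc_bt \<Delta> 1 = 0"
  and cyc_bt_gval: "cyc_bt \<Delta> (gval a * x) = cyc_t (wd0 (gval a) * x)"
  using cyc_bt_spec by auto

lemma clinear_cyc_b: "clinear (cyc_b \<Delta>)"
proof -
  have "clinear (\<lambda>x. wd x + cyc_bt \<Delta> x)" by (rule clinear_plus[OF clinear_wd clinear_cyc_bt])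
  then show ?thesis unfolding cyc_b_def[abs_def] .
qed

text \<open>The terms that differentiate x agree on both sides. The defect comes from
  differentiating \<open>gval a\<close>: on the left the whole of \<open>D (gval a)\<close> ends up
  behind x, on the right t moves only its first generator.\<close>

lemma cyc_t_derivation:
  assumes D: "graded_derivation D" and deg: "D x \<in> weil_comp (k + 1)" and x: "x \<in> weil_comp k"
  shows "D (cyc_t (gval a * x)) = cyc_t (D (gval a * x)) +
    ksign ((gdeg a + 1) * k) *\<^sub>C (x * D (gval a)) - cyc_t (D (gval a) * x)"
proof -
  have "ksign (gdeg a) * ksign (gdeg a * (k + 1)) = ksign (gdeg a * k)"
    "ksign (gdeg a * k) * ksign k = ksign ((gdeg a + 1) * k)"
    by (auto simp: ksign_def)
  then show ?thesis
    by (simp add: cyc_t_gval[OF x] cyc_t_gval[OF deg] clinear_simps[OF derivation_clinear[OF D]]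
        derivation_mult[OF D x] derivation_gval[OF D] clinear_simps[OF clinear_cyc_t] scaleC_add_right)
qed

text \<open>\<open>lin_d (gval a)\<close> has length one, so moving it as a whole is a single
  rotation and the defect in \<open>cyc_t_derivation\<close> vanishes.\<close>

lemma lin_d_cyc_t: "lin_d (cyc_t x) = cyc_t (lin_d x)" for x :: "'h weil1"
proof (rule weil1_eq_induct[where f = "\<lambda>x. lin_d (cyc_t x)" and g = "\<lambda>x. cyc_t (lin_d x)"])
  show "lin_d (cyc_t (gval a * monomial as)) = cyc_t (lin_d (gval a * monomial as))" for a :: "'h wgen" and as
  proof -
    have "lin_d (gval a) \<in> word_span (\<lambda>bs. length bs = 1 \<and> mdeg bs = gdeg a + 1)"
      using word_span_mono[OF lin_d_word_span[of "[a]"]] by simp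
    from cyc_t_funpow[OF this monomial_in_weil_comp[of as]] show ?thesis
      using cyc_t_derivation[OF lin_d_spec(1) lin_d_weil_comp[OF monomial_in_weil_comp]
          monomial_in_weil_comp[of as], of a]
      by simp
  qed
qed (auto simp: graded_derivation_one[OF lin_d_spec(1)] clinear_0[OF clinear_cyc_t] clinear_0[OF
  clinear_lin_d]
    intro: clinear_comp[OF clinear_lin_d clinear_cyc_t] clinear_comp[OF clinear_cyc_t clinear_lin_d])

text \<open>\<open>wd0 (gval a)\<close> has length two, so moving it as a whole takes two rotations.
  The first of them produces \<open>cyc_bt\<close>, and the second accounts for the extra t on the
  right.\<close>

lemma wd0_cyc_t: "wd0 (cyc_t x) + cyc_bt \<Delta> x = cyc_t (wd0 x) + cyc_t (cyc_bt \<Delta> x)"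
proof (rule weil1_eq_induct[where f = "\<lambda>x. wd0 (cyc_t x) + cyc_bt \<Delta> x" and g = "\<lambda>x. cyc_t (wd0 x) +
  cyc_t (cyc_bt \<Delta> x)"])
  show "wd0 (cyc_t (gval a * monomial as)) + cyc_bt \<Delta> (gval a * monomial as) =
      cyc_t (wd0 (gval a * monomial as)) + cyc_t (cyc_bt \<Delta> (gval a * monomial as))" for a as
  proof -
    have "wd0 (gval a) \<in> word_span (\<lambda>bs. length bs = Suc 1 \<and> mdeg bs = gdeg a + 1)"
      by (rule word_span_mono[OF wd0_gval]) auto
    from cyc_t_funpow[OF this monomial_in_weil_comp[of as]] show ?thesis
      using cyc_t_derivation[OF weil_diff0_spec(1) wd0_weil_comp[OF monomial_in_weil_comp]
          monomial_in_weil_comp[of as], of a]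
      by (simp add: cyc_bt_gval)
  qed
qed (simp_all add: graded_derivation_one[OF weil_diff0_spec(1)] clinear_0[OF clinear_cyc_t] clinear_0[OF
  clinear_wd0]
     clinear_plus clinear_cyc_bt clinear_comp[OF clinear_wd0 clinear_cyc_t] clinear_comp[OF
       clinear_cyc_t clinear_wd0]
      clinear_comp[OF clinear_cyc_t clinear_cyc_bt])

text \<open>The square (t - 1) b = \<partial> (t - 1) of the cyclic sequence. It is used below to
  show that the boundary of a commutator (t - 1) q is again of this form.\<close>

lemma cyc_t_cyc_b: "cyc_t (cyc_b \<Delta> x) - cyc_b \<Delta> x = wd (cyc_t x) - wd x"
proof -
  have "cyc_t (wd0 x) + cyc_t (cyc_bt \<Delta> x) - cyc_bt \<Delta> x = wd0 (cyc_t x)"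
    using wd0_cyc_t[of x] by (simp add: algebra_simps)
  then show ?thesis
    by (simp add: cyc_b_def weil_diff_eq clinear_add[OF clinear_cyc_t] lin_d_cyc_t algebra_simps)
qed

text \<open>Under the trace N, the term of \<open>wd0\<close> that differentiates a given letter
  equals \<open>cyc_bt\<close> of the word rotated until that letter comes first. The prefix
  \<open>us\<close> of letters already passed is carried along for the induction, with the sign of
  moving the derivation past it.\<close>

lemma cyc_N_wd0_monomial:
  "ksign (mdeg us) *\<^sub>C cyc_N (monomial us * wd0 (monomial vs)) =
    (\<Sum>i<length vs. cyc_N (cyc_bt \<Delta> ((cyc_t ^^ (length us + i)) (monomial us * monomial vs))))"
proof (induction vs arbitrary: us)
  case Nil
  show ?case by (simp add: graded_derivation_one[OF weil_diff0_spec(1)] clinear_0[OF clinear_cyc_N])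
next
  case (Cons a vs)
  have deg: "wd0 (gval a) * monomial vs \<in> weil_comp (gdeg a + 1 + mdeg vs)"
    by (intro weil_comp_mult wd0_weil_comp gval_in_weil_comp monomial_in_weil_comp)
  have "cyc_N (cyc_bt \<Delta> ((cyc_t ^^ length us) (monomial us * monomial (a # vs)))) =
    ksign (mdeg us * (gdeg a + mdeg vs)) *\<^sub>C cyc_N (cyc_bt \<Delta> (gval a * (monomial vs * monomial us)))"
    using cyc_t_funpow_monomial[OF monomial_in_weil_comp[of "a # vs"]]
    by (simp add: mult.assoc clinear_scaleC[OF clinear_cyc_bt] clinear_scaleC[OF clinear_cyc_N])
  also have "\<dots> = ksign (mdeg us * (gdeg a + mdeg vs)) *\<^sub>C cyc_N ((wd0 (gval a) * monomial vs) * monomial us)"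
    by (simp add: cyc_bt_gval mult.assoc)
  also have "\<dots> = (ksign (mdeg us * (gdeg a + mdeg vs)) * ksign ((gdeg a + 1 + mdeg vs) * mdeg us)) *\<^sub>C
      cyc_N (monomial us * (wd0 (gval a) * monomial vs))"
    by (simp add: cyc_N_mult_commute[OF deg monomial_in_weil_comp])
  also have "ksign (mdeg us * (gdeg a + mdeg vs)) * ksign ((gdeg a + 1 + mdeg vs) * mdeg us) = ksign
    (mdeg us)"
    by (auto simp: ksign_def)
  finally have first: "cyc_N (cyc_bt \<Delta> ((cyc_t ^^ length us) (monomial us * monomial (a # vs)))) =
      ksign (mdeg us) *\<^sub>C cyc_N (monomial us * (wd0 (gval a) * monomial vs))" .
  have "ksign (mdeg us) *\<^sub>C cyc_N (monomial us * wd0 (monomial (a # vs))) =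
    ksign (mdeg us) *\<^sub>C cyc_N (monomial us * (wd0 (gval a) * monomial vs)) +
    ksign (mdeg (us @ [a])) *\<^sub>C cyc_N (monomial (us @ [a]) * wd0 (monomial vs))"
    by (simp add: derivation_gval[OF weil_diff0_spec(1)] distrib_left clinear_simps[OF clinear_cyc_N]
        scaleC_add_right ksign_add mult.assoc)
  also have "\<dots> = (\<Sum>i<Suc (length vs). cyc_N (cyc_bt \<Delta> ((cyc_t ^^ (length us + i)) (monomial us *
    monomial (a # vs)))))"
    unfolding Cons.IH first[symmetric] sum.lessThan_Suc_shift
    by (simp add: mult.assoc del: funpow.simps)
  finally show ?case by simp
qed

lemma cyc_N_wd0: "cyc_N (wd0 x) = cyc_N (cyc_bt \<Delta> (cyc_N x))"
proof (rule weil1_eqI[where f = "\<lambda>x. cyc_N (wd0 x)" and g = "\<lambda>x. cyc_N (cyc_bt \<Delta> (cyc_N x))"])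
  show "clinear (\<lambda>x. cyc_N (wd0 x))" "clinear (\<lambda>x. cyc_N (cyc_bt \<Delta> (cyc_N x)))"
    by (intro clinear_comp[OF clinear_cyc_N] clinear_wd0 clinear_comp[OF clinear_cyc_bt clinear_cyc_N])+
  show "cyc_N (wd0 (monomial as)) = cyc_N (cyc_bt \<Delta> (cyc_N (monomial as)))" for as
    using cyc_N_wd0_monomial[of "[]" as]
    by (simp add: cyc_N_monomial clinear_sum[OF clinear_cyc_bt] clinear_sum[OF clinear_cyc_N])
qed

lemma lin_d_cyc_N: "lin_d (cyc_N x) = cyc_N (lin_d x)" for x :: "'h weil1"
proof (rule weil1_eqI[where f = "\<lambda>x. lin_d (cyc_N x)" and g = "\<lambda>x. cyc_N (lin_d x)"])
  fix as :: "'h wgen list"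
  have comm: "lin_d ((cyc_t ^^ i) x) = (cyc_t ^^ i) (lin_d x)" for i and x :: "'h weil1"
    by (induction i) (simp_all add: lin_d_cyc_t)
  have len: "lin_d (monomial as) \<in> word_span (\<lambda>bs. length bs = length as \<and> True)"
    by (rule word_span_mono[OF lin_d_word_span]) simp
  show "lin_d (cyc_N (monomial as)) = cyc_N (lin_d (monomial as))"
    by (simp add: cyc_N_word_span[OF len] cyc_N_monomial clinear_sum[OF clinear_lin_d] comm)
qed (rule clinear_comp[OF clinear_lin_d clinear_cyc_N] clinear_comp[OF clinear_cyc_N clinear_lin_d])+

lemma cyc_t_fixed_funpow: "cyc_t x = x \<Longrightarrow> (cyc_t ^^ i) x = x"
  by (induction i) simp_all

lemma word_span_cyc_bt:
  "cyc_bt \<Delta> (monomial as) \<in> word_span (\<lambda>bs. length bs = length as + 1 \<and> mdeg bs = mdeg as + 1 \<and> ncur as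
    \<le> ncur bs)"
proof (cases as)
  case (Cons a vs)
  have "wd0 (gval a) * monomial vs \<in> word_span (\<lambda>bs. length bs = length as + 1 \<and> mdeg bs = mdeg as + 1 \<and>
    ncur as \<le> ncur bs)"
    by (rule word_span_mult[OF wd0_gval word_span_base[of "\<lambda>bs. bs = vs"]]) (auto simp: Cons)
  then show ?thesis
    by (auto simp: Cons cyc_bt_gval intro: word_span_cyc_t)
qed (simp add: word_span_subspace)

text \<open>Averaging replaces a bookkeeping of rotations. On words of length p the left side z is
  fixed by t and has length p + 1, so N z = (p + 1) z. Computing N z from \<open>cyc_N_wd0\<close>
  and N N = p N gives (p + 1) times the right side, and p + 1 can be cancelled over the complex
  numbers.\<close>

lemma wd0_cyc_N: "wd0 (cyc_N x) + cyc_bt \<Delta> (cyc_N x) = cyc_N (wd0 x)"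
proof (rule weil1_eqI[where f = "\<lambda>x. wd0 (cyc_N x) + cyc_bt \<Delta> (cyc_N x)" and g = "\<lambda>x. cyc_N (wd0 x)"])
  show "clinear (\<lambda>x. wd0 (cyc_N x) + cyc_bt \<Delta> (cyc_N x))" "clinear (\<lambda>x. cyc_N (wd0 x))"
    by (intro clinear_plus clinear_comp[OF clinear_cyc_N] clinear_comp[OF _ clinear_cyc_N] clinear_wd0
      clinear_cyc_bt)+
  fix as :: "'h wgen list"
  let ?m = "monomial as" and ?p = "length as"
  define z where "z = wd0 (cyc_N ?m) + cyc_bt \<Delta> (cyc_N ?m)"
  have len: "z \<in> word_span (\<lambda>bs. length bs = ?p + 1 \<and> True)"
    unfolding z_def
    by (intro word_span_subspace(2) word_span_image[OF clinear_wd0 cyc_N_monomial_length]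
        word_span_image[OF clinear_cyc_bt cyc_N_monomial_length];
      rule word_span_mono[OF wd0_word_span] word_span_mono[OF word_span_cyc_bt]; simp)
  \<comment> \<open>\<open>wd0_cyc_t\<close> applied to an element that t already fixes.\<close>
  have "cyc_t z = z"
    unfolding z_def clinear_add[OF clinear_cyc_t] wd0_cyc_t[symmetric] by simp
  then have "cyc_N z = of_nat (?p + 1) *\<^sub>C z"
    by (simp add: cyc_N_word_span[OF len] cyc_t_fixed_funpow complex_vector.sum_constant_scale
       del: sum_constant sum.lessThan_Suc)
  moreover have "cyc_N (cyc_N ?m) = of_nat ?p *\<^sub>C cyc_N ?m"
    by (simp add: cyc_N_word_span[OF cyc_N_monomial_length] cyc_t_fixed_funpow
      complex_vector.sum_constant_scale
       del: sum_constant)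
  then have "cyc_N z = of_nat (?p + 1) *\<^sub>C cyc_N (wd0 ?m)"
    by (simp add: z_def cyc_N_wd0 clinear_simps[OF clinear_cyc_N] clinear_simps[OF clinear_cyc_bt]
      scaleC_add_left)
  ultimately have "of_nat (?p + 1) *\<^sub>C z = of_nat (?p + 1) *\<^sub>C cyc_N (wd0 ?m)" by metis
  moreover have "of_nat (?p + 1) \<noteq> (0 :: complex)" by (simp only: of_nat_eq_0_iff)
  ultimately show "wd0 (cyc_N ?m) + cyc_bt \<Delta> (cyc_N ?m) = cyc_N (wd0 ?m)"
    unfolding z_def[symmetric] by (metis complex_vector.scale_left_imp_eq)
qed

lemma cyc_b_cyc_N: "cyc_b \<Delta> (cyc_N x) = cyc_N (wd x)"
  by (simp add: cyc_b_def weil_diff_eq clinear_add[OF clinear_cyc_N] lin_d_cyc_N flip: wd0_cyc_N)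

lemma cyc_bt_length_one:
  assumes "y \<in> word_span (\<lambda>bs. length bs = 1 \<and> R bs)"
  shows "cyc_bt \<Delta> (y * x) = cyc_t (wd0 y * x)"
proof (rule word_span_eq[OF _ _ assms])
  show "clinear (\<lambda>y. cyc_bt \<Delta> (y * x))" "clinear (\<lambda>y. cyc_t (wd0 y * x))"
    by (intro clinear_comp[OF clinear_cyc_bt] clinear_comp[OF clinear_cyc_t] clinear_mult_left
      clinear_ident clinear_wd0)+
  show "cyc_bt \<Delta> (monomial as * x) = cyc_t (wd0 (monomial as) * x)" if "length as = 1 \<and> R as" for as
    using that by (cases as) (auto simp: cyc_bt_gval)
qed

text \<open>For y = a b, one rotation brings b to the front, so the first summand differentiates b
  and the second differentiates a. Together they form the Leibniz rule for \<open>wd0\<close> on a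
  b, seen after two rotations.\<close>

lemma cyc_bt_length_two:
  assumes "y \<in> word_span (\<lambda>bs. length bs = 2 \<and> R bs)" and x: "x \<in> weil_comp k"
  shows "cyc_bt \<Delta> (cyc_t (y * x)) + cyc_t (cyc_bt \<Delta> (y * x)) = cyc_t (cyc_t (wd0 y * x))"
proof (rule word_span_eq[OF _ _ assms(1)])
  show "clinear (\<lambda>y. cyc_bt \<Delta> (cyc_t (y * x)) + cyc_t (cyc_bt \<Delta> (y * x)))" "clinear (\<lambda>y. cyc_t (cyc_t
    (wd0 y * x)))"
    by (intro clinear_plus clinear_comp[OF clinear_cyc_bt] clinear_comp[OF clinear_cyc_t] clinear_mult_left
      clinear_ident clinear_wd0)+
  fix as
  assume "length as = 2 \<and> R as"
  then obtain a b where as: "as = [a, b]"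
    by (auto simp: numeral_2_eq_2 length_Suc_conv)
  have "gval b * x \<in> weil_comp (gdeg b + k)" "wd0 (gval b) * x \<in> weil_comp (gdeg b + 1 + k)"
    by (intro weil_comp_mult wd0_weil_comp gval_in_weil_comp x)+
  note t = this[THEN cyc_t_gval[where a = a]]
  have "ksign (gdeg a) * ksign (gdeg a * (gdeg b + 1 + k)) = ksign (gdeg a * (gdeg b + k))"
    by (auto simp: ksign_def)
  then show "cyc_bt \<Delta> (cyc_t (monomial as * x)) + cyc_t (cyc_bt \<Delta> (monomial as * x)) =
      cyc_t (cyc_t (wd0 (monomial as) * x))"
    by (simp add: as mult.assoc t cyc_bt_gval clinear_simps[OF clinear_cyc_bt] clinear_simps[OF clinear_cyc_t]
        derivation_gval[OF weil_diff0_spec(1)] graded_derivation_one[OF weil_diff0_spec(1)] distrib_right)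
qed

text \<open>Put z = \<open>wd0 (gval a)\<close> times x, so that b (a x) = \<partial> (a x) + t z.
  Since \<partial> squares to zero, there remain \<partial> t z, b_t \<partial> (a x) and b_t t z.
  Moving \<partial> past t by \<open>cyc_t_cyc_b\<close>, the rest cancels through two facts on
  generators: \<open>wd0\<close> squares to zero, and it anticommutes with
  \<open>lin_d\<close>.\<close>

lemma cyc_b_cyc_b: "cyc_b \<Delta> (cyc_b \<Delta> x) = 0"
proof (rule weil1_eq_induct[where f = "\<lambda>x. cyc_b \<Delta> (cyc_b \<Delta> x)" and g = "\<lambda>_. 0"])
  show "clinear (\<lambda>x. cyc_b \<Delta> (cyc_b \<Delta> x))" by (rule clinear_comp[OF clinear_cyc_b clinear_cyc_b])
next
  fix a :: "'h wgen" and as :: "'h wgen list"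
  let ?a = "gval a" and ?x = "monomial as"
  define z where "z = wd0 ?a * ?x"
  note lin = clinear_simps[OF clinear_wd] clinear_simps[OF clinear_cyc_t] clinear_simps[OF clinear_cyc_bt]
  have bt: "cyc_bt \<Delta> (?a * y) = cyc_t (wd0 ?a * y)" for y by (rule cyc_bt_gval)
  have "lin_d ?a \<in> word_span (\<lambda>bs. length bs = 1 \<and> True)"
    using word_span_mono[OF lin_d_word_span[of "[a]"]] by simp
  from cyc_bt_length_one[OF this] have bt_lin: "cyc_bt \<Delta> (lin_d ?a * ?x) = cyc_t (wd0 (lin_d ?a) * ?x)" .
  have two: "cyc_bt \<Delta> (cyc_t z) + cyc_t (cyc_bt \<Delta> z) = 0"
  proof -
    have "wd0 ?a \<in> word_span (\<lambda>bs. length bs = 2 \<and> True)"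
      by (rule word_span_mono[OF wd0_gval]) simp
    from cyc_bt_length_two[OF this monomial_in_weil_comp] show ?thesis
      by (simp add: z_def wd0_wd0_gval lin)
  qed
  have "wd (cyc_t z) = cyc_t (wd z) + cyc_t (cyc_bt \<Delta> z) - cyc_bt \<Delta> z"
    using cyc_t_cyc_b[of z] by (simp add: cyc_b_def lin algebra_simps)
  moreover have "wd z = wd (wd0 ?a) * ?x - ksign (gdeg a) *\<^sub>C (wd0 ?a * wd ?x)"
    unfolding z_def derivation_mult[OF weil_diff_spec(1) wd0_weil_comp[OF gval_in_weil_comp]]
    by (simp add: ksign_add)
  ultimately have dt: "wd (cyc_t z) = cyc_t (wd (wd0 ?a) * ?x) - ksign (gdeg a) *\<^sub>C cyc_t (wd0 ?a * wd ?x)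
      + cyc_t (cyc_bt \<Delta> z) - cyc_bt \<Delta> z"
    by (simp add: lin)
  have btd: "cyc_bt \<Delta> (wd (?a * ?x)) = cyc_bt \<Delta> z + cyc_t (wd0 (lin_d ?a) * ?x) + ksign (gdeg a) *\<^sub>C
    cyc_t (wd0 ?a * wd ?x)"
    by (simp add: derivation_gval[OF weil_diff_spec(1)] lin bt weil_diff_eq[of ?a] distrib_right bt_lin z_def)
  have "wd (wd0 ?a) + wd0 (lin_d ?a) = 0"
    using wd0_wd0_gval[of a] lin_d_wd0_gval[of a] by (simp add: weil_diff_eq add.commute)
  then have "cyc_t (wd (wd0 ?a) * ?x) + cyc_t (wd0 (lin_d ?a) * ?x) = 0"
    by (metis clinear_add[OF clinear_cyc_t] clinear_0[OF clinear_cyc_t] distrib_right mult_zero_left)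
  moreover have "cyc_b \<Delta> (cyc_b \<Delta> (?a * ?x)) = wd (cyc_t z) + cyc_bt \<Delta> (wd (?a * ?x)) + cyc_bt \<Delta> (cyc_t z)"
    by (simp add: cyc_b_def lin bt z_def algebra_simps)
  ultimately show "cyc_b \<Delta> (cyc_b \<Delta> (gval a * monomial as)) = 0"
    using two unfolding dt btd by (simp add: algebra_simps)
qed (simp_all add: clinear_zero cyc_b_def
    graded_derivation_one[OF weil_diff_spec(1)] clinear_0[OF clinear_wd] clinear_0[OF clinear_cyc_bt])

lemma cyc_b_word_span:
  "cyc_b \<Delta> (monomial as) \<in> word_span (\<lambda>bs. length as \<le> length bs \<and> mdeg bs = mdeg as + 1 \<and> ncur as \<le> ncur bs)"
  unfolding cyc_b_def
  by (intro word_span_subspace(2) word_span_mono[OF wd_word_span] word_span_mono[OF word_span_cyc_bt]) auto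

end

section \<open>Powers of the curvature ideal\<close>

lemma subspace_word_span: "complex_vector.subspace (word_span R)"
  by (simp add: word_span_def)

lemma first_cur:
  assumes "1 \<le> ncur as"
  obtains us h vs where "as = us @ Cur h # vs" "ncur us = 0"
proof -
  from assms have "\<exists>us h vs. as = us @ Cur h # vs \<and> ncur us = 0"
  proof (induction as)
    case (Cons a as)
    show ?case
    proof (cases a)
      case (Con g)
      then obtain us h vs where "as = us @ Cur h # vs" "ncur us = 0" using Cons by auto
      then show ?thesis using Con by (intro exI[of _ "a # us"]) auto
    next
      case (Cur h)
      then show ?thesis by (intro exI[of _ "[]"]) auto
    qed
  qed simp
  then show ?thesis using that by blast
qed

lemma cur_in_word_span: "\<omega> h \<in> word_span (\<lambda>as. 1 \<le> ncur as)"
  using word_span_base[of "\<lambda>as. 1 \<le> ncur as" "[Cur h]"] by simp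

lemma curv_ideal_eq: "curv_ideal = word_span (\<lambda>as. 1 \<le> ncur as)"
proof
  show "curv_ideal \<subseteq> word_span (\<lambda>as :: 'a wgen list. 1 \<le> ncur as)"
    unfolding curv_ideal_def
  proof (rule complex_vector.span_minimal[OF _ subspace_word_span], clarify)
    fix x y :: "'a weil1" and h
    have "x * \<omega> h \<in> word_span (\<lambda>as. 1 \<le> ncur as)"
      by (rule word_span_mult[OF word_span_True cur_in_word_span]) simp
    then show "x * \<omega> h * y \<in> word_span (\<lambda>as. 1 \<le> ncur as)"
      by (rule word_span_mult[OF _ word_span_True]) simp
  qed
  show "word_span (\<lambda>as. 1 \<le> ncur as) \<subseteq> (curv_ideal :: 'a weil1 set)"
    unfolding word_span_def
  proof (rule complex_vector.span_minimal, clarify)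
    fix as :: "'a wgen list"
    assume "1 \<le> ncur as"
    then obtain us h vs where "as = us @ Cur h # vs" by (rule first_cur)
    then have "monomial as = monomial us * \<omega> h * monomial vs" by (simp add: mult.assoc)
    then show "monomial as \<in> curv_ideal"
      unfolding curv_ideal_def by (auto intro!: complex_vector.span_base simp del: gval.simps)
  qed (simp add: curv_ideal_def)
qed

text \<open>Cutting a word directly behind its first curvature letter leaves one curvature in the
  left factor and all the others in the right one. So the powers of I form the filtration by the
  number of curvature letters.\<close>

lemma curv_power_eq: "curv_power m = word_span (\<lambda>as. m \<le> ncur as)"
proof (induction m)
  case 0
  show ?case using word_span_True by auto
next
  case (Suc m)
  show ?case
  proof
    show "curv_power (Suc m) \<subseteq> word_span (\<lambda>as :: 'a wgen list. Suc m \<le> ncur as)"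
      unfolding curv_power.simps Suc curv_ideal_eq
      by (rule complex_vector.span_minimal[OF _ subspace_word_span]) (auto elim!: word_span_mult)
    show "word_span (\<lambda>as. Suc m \<le> ncur as) \<subseteq> (curv_power (Suc m) :: 'a weil1 set)"
      unfolding word_span_def
    proof (rule complex_vector.span_minimal, clarify)
      fix as :: "'a wgen list"
      assume as: "Suc m \<le> ncur as"
      then obtain us h vs where split: "as = us @ Cur h # vs" "ncur us = 0"
        using first_cur[of as] by auto
      have "monomial (us @ [Cur h]) \<in> curv_ideal" "monomial vs \<in> curv_power m"
        unfolding Suc curv_ideal_eq by (rule word_span_base, use as split in simp)+
      moreover have "monomial as = monomial (us @ [Cur h]) * monomial vs"
        by (simp add: split mult.assoc)
      ultimately show "monomial as \<in> curv_power (Suc m)"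
        unfolding curv_power.simps by (auto intro!: complex_vector.span_base)
    qed simp
  qed
qed

declare curv_power.simps [simp del]

lemma curv_power_Suc_subset_weil: "curv_power (Suc m) \<subseteq> weil"
  unfolding curv_power_eq weil_eq by (auto elim!: word_span_mono)

section \<open>Commutators\<close>

lemma vspan_weil1_alg: "vspan (weil1_alg \<Delta>) X = complex_vector.span X"
proof
  show "vspan (weil1_alg \<Delta>) X \<subseteq> complex_vector.span X"
    unfolding vspan_def weil1_alg_def
    by (rule hull_minimal) (auto intro: complex_vector.span_base complex_vector.span_add
      complex_vector.span_scale complex_vector.span_zero)
  show "complex_vector.span X \<subseteq> vspan (weil1_alg \<Delta>) X"
  proof (rule complex_vector.span_minimal)
    show "X \<subseteq> vspan (weil1_alg \<Delta>) X"
      unfolding vspan_def by (rule hull_subset)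
    show "complex_vector.subspace (vspan (weil1_alg \<Delta>) X)"
      unfolding vspan_def hull_def weil1_alg_def complex_vector.subspace_def by auto
  qed
qed

lemma gr_commutators_weil1_alg:
  "gr_commutators (weil1_alg \<Delta>) A B = complex_vector.span
    {x * y - ksign (j * k) *\<^sub>C (y * x) | x y j k. x \<in> A \<inter> weil_comp j \<and> y \<in> B \<inter> weil_comp k}"
  unfolding gr_commutators_def vspan_weil1_alg
  by (simp add: weil1_alg_def)

lemma gr_commutator_monomial:
  assumes "monomial us \<in> A" "monomial vs \<in> B"
  shows "monomial (us @ vs) - ksign (mdeg us * mdeg vs) *\<^sub>C monomial (vs @ us)
    \<in> gr_commutators (weil1_alg \<Delta>) A B"
  unfolding gr_commutators_weil1_alg
  using assms monomial_in_weil_comp[of us] monomial_in_weil_comp[of vs]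
  by (auto intro!: complex_vector.span_base)

text \<open>A rotation moving a connection letter past a word with a curvature letter \<open>\<omega>\<close> is a
  difference of two rotations moving blocks that contain \<open>\<omega>\<close>.\<close>

lemma cyc_t_minus_in_I_comm:
  assumes "z \<in> curv_power (Suc n)"
  shows "cyc_t z - z \<in> I_comm \<Delta> n"
proof -
  have sub: "complex_vector.subspace (I_comm \<Delta> n)"
    unfolding I_comm_def gr_commutators_weil1_alg by simp
  have "cyc_t (monomial as) - monomial as \<in> I_comm \<Delta> n" if as: "Suc n \<le> ncur as" for as :: "'a wgen list"
  proof (cases as)
    case Nil
    with that show ?thesis by simp
  next
    case (Cons a ws)
    have t: "cyc_t (monomial as) = ksign (gdeg a * mdeg ws) *\<^sub>C monomial (ws @ [a])"
      by (simp add: Cons cyc_t_Cons)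
    show ?thesis
    proof (cases a)
      case (Cur h)
      have "monomial ([a] @ ws) - ksign (mdeg [a] * mdeg ws) *\<^sub>C monomial (ws @ [a]) \<in> I_comm \<Delta> n"
        unfolding I_comm_def
        by (rule gr_commutator_monomial; unfold curv_ideal_eq curv_power_eq; rule word_span_base)
          (use as Cons Cur in auto)
      then have "- (monomial ([a] @ ws) - ksign (mdeg [a] * mdeg ws) *\<^sub>C monomial (ws @ [a])) \<in> I_comm \<Delta> n"
        by (rule complex_vector.subspace_neg[OF sub])
      then show ?thesis unfolding t by (simp add: Cons)
    next
      case (Con g)
      with as Cons obtain us h vs where ws: "ws = us @ Cur h # vs" "ncur us = 0"
        using first_cur[of ws] by auto
      \<comment> \<open>\<open>?u\<close> contains a curvature and \<open>vs\<close> at least n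
        further ones, so both cuts (a u, v) and (u, v a) are pairs from I and its n-th power. Their
        commutators share the word v a u, which drops out of the difference.\<close>
      let ?u = "us @ [Cur h]"
      have 1: "monomial ((a # ?u) @ vs) - ksign (mdeg (a # ?u) * mdeg vs) *\<^sub>C monomial (vs @ a # ?u) \<in>
        I_comm \<Delta> n"
        unfolding I_comm_def
        by (rule gr_commutator_monomial; unfold curv_ideal_eq curv_power_eq; rule word_span_base)
          (use as Cons Con ws in auto)
      have 2: "monomial (?u @ vs @ [a]) - ksign (mdeg ?u * mdeg (vs @ [a])) *\<^sub>C monomial ((vs @ [a]) @
        ?u) \<in> I_comm \<Delta> n"
        unfolding I_comm_def
        by (rule gr_commutator_monomial; unfold curv_ideal_eq curv_power_eq; rule word_span_base)
          (use as Cons Con ws in auto)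
      have "ksign (gdeg a * mdeg ws) * ksign (mdeg ?u * mdeg (vs @ [a])) = ksign (mdeg (a # ?u) * mdeg vs)"
        by (auto simp: ws ksign_def)
      then have "cyc_t (monomial as) - monomial as =
        ksign (gdeg a * mdeg ws) *\<^sub>C (monomial (?u @ vs @ [a]) - ksign (mdeg ?u * mdeg (vs @ [a])) *\<^sub>C
          monomial ((vs @ [a]) @ ?u))
        - (monomial ((a # ?u) @ vs) - ksign (mdeg (a # ?u) * mdeg vs) *\<^sub>C monomial (vs @ a # ?u))"
        unfolding t complex_vector.scale_right_diff_distrib scaleC_scaleC
        by (simp add: Cons ws mult.assoc)
      then show ?thesis
        using complex_vector.subspace_diff[OF sub complex_vector.subspace_scale[OF sub 2] 1] by simp
    qed
  qed
  then have "cyc_t z - z \<in> complex_vector.span (I_comm \<Delta> n)"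
    by (intro span_linear_image[OF clinear_minus[OF clinear_cyc_t clinear_ident]
          assms[unfolded curv_power_eq word_span_def]])
      (auto intro: complex_vector.span_base)
  then show ?thesis
    using sub complex_vector.span_eq_iff[of "I_comm \<Delta> n"] by blast
qed

text \<open>The trace property gives one inclusion. Conversely, N x = 0 forces x = (t - 1) Q x, and
  Q x stays in the same power because Q merely rotates words and so keeps the curvature
  count.\<close>

lemma I_comm_eq: "I_comm \<Delta> n = {x \<in> curv_power (Suc n). cyc_N x = 0}"
proof
  show "I_comm \<Delta> n \<subseteq> {x \<in> curv_power (Suc n). cyc_N x = 0}"
    unfolding I_comm_def gr_commutators_weil1_alg
  proof (rule complex_vector.span_minimal, clarify)
    fix x y :: "'a weil1" and j k
    assume x: "x \<in> curv_ideal" "x \<in> weil_comp j" and y: "y \<in> curv_power n" "y \<in> weil_comp k"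
    have "x * y \<in> curv_power (Suc n)" "y * x \<in> curv_power (Suc n)"
      using x(1) y(1) unfolding curv_ideal_eq curv_power_eq by (auto elim!: word_span_mult)
    then show "x * y - ksign (j * k) *\<^sub>C (y * x) \<in> curv_power (Suc n) \<and> cyc_N (x * y - ksign (j * k) *\<^sub>C
      (y * x)) = 0"
      using cyc_N_mult_commute[OF x(2) y(2)]
      by (simp add: curv_power_eq word_span_subspace clinear_simps[OF clinear_cyc_N])
  next
    show "complex_vector.subspace {x \<in> curv_power (Suc n). cyc_N x = 0}"
      unfolding curv_power_eq complex_vector.subspace_def
      by (auto simp: word_span_subspace clinear_simps[OF clinear_cyc_N])
  qed
  show "{x \<in> curv_power (Suc n). cyc_N x = 0} \<subseteq> I_comm \<Delta> n"
  proof clarify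
    fix x :: "'a weil1"
    assume x: "x \<in> curv_power (Suc n)" "cyc_N x = 0"
    then have "x \<in> weil" using curv_power_Suc_subset_weil[of n] by auto
    from cyc_decomposition[OF this] x(2) have "x = cyc_t (cyc_Q x) - cyc_Q x"
      by (simp add: cyc_N_cyc_P clinear_0[OF clinear_cyc_P])
    moreover have "cyc_Q x \<in> curv_power (Suc n)"
      using x(1) unfolding curv_power_eq by (rule word_span_cyc_ops) auto
    ultimately show "x \<in> I_comm \<Delta> n" using cyc_t_minus_in_I_comm by metis
  qed
qed

section \<open>Polynomials in \<open>t\<close>\<close>

lemma poly_eq_sum_single:
  "p = (\<Sum>k\<in>Poly_Mapping.keys p. Poly_Mapping.single k (Poly_Mapping.lookup p k))"
  by (rule poly_mapping_eqI)
    (simp add: lookup_sum lookup_single when_def sum.delta not_in_keys_iff_lookup_eq_zero)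

lemma clinear_single: "clinear (Poly_Mapping.single k)"
  by (rule clinearI)
    (auto intro!: poly_mapping_eqI simp: lookup_add lookup_single scaleC_poly_mapping.rep_eq when_def)

lemma clinear_lookup: "clinear (\<lambda>p. Poly_Mapping.lookup p k)"
  by (simp add: clinear_iff lookup_add scaleC_poly_mapping.rep_eq)

lemma poly_sum_superset:
  assumes "\<And>k. clinear (h k)" "finite A" "Poly_Mapping.keys p \<subseteq> A"
  shows "(\<Sum>k\<in>Poly_Mapping.keys p. h k (Poly_Mapping.lookup p k)) = (\<Sum>k\<in>A. h k (Poly_Mapping.lookup p k))"
  by (rule sum.mono_neutral_left)
    (use assms in \<open>auto simp: not_in_keys_iff_lookup_eq_zero clinear_0\<close>)

lemma clinear_poly_sum:
  fixes h :: "'k \<Rightarrow> 'a::complex_vector \<Rightarrow> 'b::complex_vector"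
  assumes "\<And>k. clinear (h k)"
  shows "clinear (\<lambda>p. \<Sum>k\<in>Poly_Mapping.keys p. h k (Poly_Mapping.lookup p k))"
proof (rule clinearI)
  fix p q :: "'k \<Rightarrow>\<^sub>0 'a"
  let ?A = "Poly_Mapping.keys p \<union> Poly_Mapping.keys q"
  have "Poly_Mapping.keys (p + q) \<subseteq> ?A" by (rule keys_add)
  then show "(\<Sum>k\<in>Poly_Mapping.keys (p + q). h k (Poly_Mapping.lookup (p + q) k)) =
    (\<Sum>k\<in>Poly_Mapping.keys p. h k (Poly_Mapping.lookup p k)) + (\<Sum>k\<in>Poly_Mapping.keys q. h k
      (Poly_Mapping.lookup q k))"
    by (subst (1 2 3) poly_sum_superset[where A = ?A, OF assms])
      (simp_all add: lookup_add clinear_add[OF assms] sum.distrib)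
next
  fix c and p :: "'k \<Rightarrow>\<^sub>0 'a"
  have "Poly_Mapping.keys (c *\<^sub>C p) \<subseteq> Poly_Mapping.keys p"
    by (auto simp: scaleC_poly_mapping.rep_eq in_keys_iff)
  then show "(\<Sum>k\<in>Poly_Mapping.keys (c *\<^sub>C p). h k (Poly_Mapping.lookup (c *\<^sub>C p) k)) =
    c *\<^sub>C (\<Sum>k\<in>Poly_Mapping.keys p. h k (Poly_Mapping.lookup p k))"
    by (subst (1 2) poly_sum_superset[where A = "Poly_Mapping.keys p", OF assms])
      (simp_all add: scaleC_poly_mapping.rep_eq clinear_scaleC[OF assms] complex_vector.scale_sum_right)
qed

lemma poly_sum_single:
  assumes "\<And>k. clinear (h k)"
  shows "(\<Sum>k\<in>Poly_Mapping.keys (Poly_Mapping.single i x). h k (Poly_Mapping.lookup (Poly_Mapping.single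
    i x) k)) = h i x"
  by (subst poly_sum_superset[where A = "{i}", OF assms]) (auto simp: lookup_single)

lemma poly_eqI:
  assumes "clinear f" "clinear g" "\<And>k x. f (Poly_Mapping.single k x) = g (Poly_Mapping.single k x)"
  shows "f p = g p"
  by (induction p rule: poly_mapping_add_induct)
    (simp_all add: clinear_simps[OF assms(1)] clinear_simps[OF assms(2)] assms(3))

lemma lookup_map_clinear:
  "clinear f \<Longrightarrow> Poly_Mapping.lookup (Poly_Mapping.map f p) k = f (Poly_Mapping.lookup p k)"
  by (simp add: Poly_Mapping.map.rep_eq when_def clinear_0)

lemma clinear_map: "clinear f \<Longrightarrow> clinear (Poly_Mapping.map f)"
  by (rule clinearI)
    (auto intro!: poly_mapping_eqI simp: lookup_map_clinear lookup_add clinear_simps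
      scaleC_poly_mapping.rep_eq)

lemma map_clinear_single: "clinear f \<Longrightarrow> Poly_Mapping.map f (Poly_Mapping.single k x) =
  Poly_Mapping.single k (f x)"
  by (rule poly_mapping_eqI) (simp add: lookup_map_clinear lookup_single when_def clinear_0)

type_synonym 'h weil_poly = "nat \<Rightarrow>\<^sub>0 'h weil1"

lemma scaleC_single: "c *\<^sub>C Poly_Mapping.single k x = Poly_Mapping.single k (c *\<^sub>C x)"
  by (simp add: clinear_scaleC[OF clinear_single])

lemma poly_scaleC_left [simp]: "(c *\<^sub>C p) * q = c *\<^sub>C (p * q)" for p q :: "'h::complex_vector weil_poly"
proof (induction p rule: poly_mapping_add_induct)
  case (single k x)
  show ?case
    by (induction q rule: poly_mapping_add_induct)
      (simp_all add: scaleC_single mult_single distrib_left scaleC_add_right)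
qed (simp_all add: distrib_right scaleC_add_right)

lemma poly_scaleC_right [simp]: "p * (c *\<^sub>C q) = c *\<^sub>C (p * q)" for p q :: "'h::complex_vector weil_poly"
proof (induction p rule: poly_mapping_add_induct)
  case (single k x)
  show ?case
    by (induction q rule: poly_mapping_add_induct)
      (simp_all add: scaleC_single mult_single distrib_left scaleC_add_right)
qed (simp_all add: distrib_right scaleC_add_right)

lemma clinear_poly_mult_left: "clinear f \<Longrightarrow> clinear (\<lambda>x. f x * q)" for q :: "'h::complex_vector weil_poly"
  by (simp add: clinear_iff distrib_right)

lemma clinear_poly_mult_right: "clinear f \<Longrightarrow> clinear (\<lambda>x. q * f x)" for q :: "'h::complex_vector weil_poly"
  by (simp add: clinear_iff distrib_left)

lemma poly_mult_eqI:
  fixes f g :: "'h::complex_vector weil_poly \<Rightarrow> 'h weil_poly \<Rightarrow> 'b::complex_vector"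
  assumes "bilin f" "bilin g"
    and "\<And>i x k y. f (Poly_Mapping.single i x) (Poly_Mapping.single k y) = g (Poly_Mapping.single i x)
      (Poly_Mapping.single k y)"
  shows "f p q = g p q"
  by (rule poly_eqI[OF bilin_left[OF assms(1)] bilin_left[OF assms(2)]],
      rule poly_eqI[OF bilin_right[OF assms(1)] bilin_right[OF assms(2)] assms(3)])

abbreviation poly_sign :: "'h::complex_vector weil_poly \<Rightarrow> 'h weil_poly"
  where "poly_sign \<equiv> Poly_Mapping.map weil_sign"

lemmas clinear_poly_sign = clinear_map[OF clinear_weil_sign]
lemmas poly_sign_single = map_clinear_single[OF clinear_weil_sign]

lemma poly_sign_mult: "poly_sign (p * q) = poly_sign p * poly_sign q"
  by (rule poly_mult_eqI[where f = "\<lambda>p q. poly_sign (p * q)" and g = "\<lambda>p q. poly_sign p * poly_sign q"])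
    (auto intro!: bilinI clinear_comp[OF clinear_poly_sign] clinear_poly_mult_left clinear_poly_mult_right
      clinear_ident clinear_poly_sign simp: poly_sign_single mult_single weil_sign_mult)

lemma poly_sign_one [simp]: "poly_sign 1 = 1"
  using poly_sign_single[of 0 1] by simp

lemma t_deriv_linear:
  "clinear (\<lambda>x. Poly_Mapping.single (k - 1) (of_nat k *\<^sub>C x))"
  by (rule clinear_comp[OF clinear_single clinear_scale[OF clinear_ident]])

lemma clinear_t_deriv: "clinear t_deriv"
  unfolding t_deriv_def[abs_def]
  by (rule clinear_poly_sum[where h = "\<lambda>k x. Poly_Mapping.single (k - 1) (of_nat k *\<^sub>C x)", OF
    t_deriv_linear])

lemma t_deriv_single: "t_deriv (Poly_Mapping.single k x) = Poly_Mapping.single (k - 1) (of_nat k *\<^sub>C x)"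
  unfolding t_deriv_def
  by (rule poly_sum_single[where h = "\<lambda>k x. Poly_Mapping.single (k - 1) (of_nat k *\<^sub>C x)", OF t_deriv_linear])

lemma scaleC_2: "2 *\<^sub>C x = x + x" for x :: "'a::complex_vector"
  using scaleC_add_left[of 1 1 x] by simp

lemma t_deriv_mult: "t_deriv (p * q) = t_deriv p * q + p * t_deriv q"
proof (rule poly_mult_eqI[where f = "\<lambda>p q. t_deriv (p * q)" and g = "\<lambda>p q. t_deriv p * q + p * t_deriv q"])
  show "bilin (\<lambda>p q. t_deriv (p * q))" "bilin (\<lambda>p q. t_deriv p * q + p * t_deriv q)"
    by (intro bilinI clinear_plus clinear_comp[OF clinear_t_deriv] clinear_poly_mult_left
      clinear_poly_mult_right
      clinear_ident clinear_t_deriv)+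
  show "t_deriv (Poly_Mapping.single i x * Poly_Mapping.single k y) =
      t_deriv (Poly_Mapping.single i x) * Poly_Mapping.single k y + Poly_Mapping.single i x * t_deriv
        (Poly_Mapping.single k y)" for i x k y
    by (cases i; cases k)
      (simp_all add: t_deriv_single mult_single scaleC_add_left scaleC_2 algebra_simps flip:
        clinear_add[OF clinear_single])
qed

lemma t_deriv_poly_sign: "t_deriv (poly_sign p) = poly_sign (t_deriv p)"
  by (rule poly_eqI[OF clinear_comp[OF clinear_t_deriv clinear_poly_sign] clinear_comp[OF
    clinear_poly_sign clinear_t_deriv]])
    (simp add: t_deriv_single poly_sign_single clinear_scaleC[OF clinear_weil_sign])

definition poly_span :: "('h::complex_vector wgen list \<Rightarrow> bool) \<Rightarrow> 'h weil_poly set"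
  where "poly_span R = {p. \<forall>k. Poly_Mapping.lookup p k \<in> word_span R}"

lemma poly_span_subspace:
  "0 \<in> poly_span R" "p \<in> poly_span R \<Longrightarrow> q \<in> poly_span R \<Longrightarrow> p + q \<in> poly_span R"
  "p \<in> poly_span R \<Longrightarrow> q \<in> poly_span R \<Longrightarrow> p - q \<in> poly_span R"
  "p \<in> poly_span R \<Longrightarrow> - p \<in> poly_span R"
  "p \<in> poly_span R \<Longrightarrow> c *\<^sub>C p \<in> poly_span R"
  by (simp_all add: poly_span_def lookup_add lookup_minus scaleC_poly_mapping.rep_eq word_span_subspace)

lemma poly_span_single: "x \<in> word_span R \<Longrightarrow> Poly_Mapping.single k x \<in> poly_span R"
  by (simp add: poly_span_def lookup_single when_def word_span_subspace)

lemma poly_span_eqI: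
  assumes "clinear f" "clinear g" "p \<in> poly_span R"
    and "\<And>k x. x \<in> word_span R \<Longrightarrow> f (Poly_Mapping.single k x) = g (Poly_Mapping.single k x)"
  shows "f p = g p"
proof -
  have "f p = (\<Sum>k\<in>Poly_Mapping.keys p. f (Poly_Mapping.single k (Poly_Mapping.lookup p k)))"
    by (subst (1) poly_eq_sum_single) (rule clinear_sum[OF assms(1)])
  also have "\<dots> = (\<Sum>k\<in>Poly_Mapping.keys p. g (Poly_Mapping.single k (Poly_Mapping.lookup p k)))"
    using assms(3,4) by (simp add: poly_span_def)
  also have "\<dots> = g p"
    by (subst (4) poly_eq_sum_single) (rule clinear_sum[OF assms(2), symmetric])
  finally show ?thesis .
qed

lemma poly_span_image:
  assumes "clinear f" "p \<in> poly_span R" "complex_vector.subspace U"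
    and "\<And>k x. x \<in> word_span R \<Longrightarrow> f (Poly_Mapping.single k x) \<in> U"
  shows "f p \<in> U"
proof -
  have "f p = (\<Sum>k\<in>Poly_Mapping.keys p. f (Poly_Mapping.single k (Poly_Mapping.lookup p k)))"
    by (subst (1) poly_eq_sum_single) (rule clinear_sum[OF assms(1)])
  also have "\<dots> \<in> U"
    using assms(2,4) by (intro complex_vector.subspace_sum[OF assms(3)]) (simp add: poly_span_def)
  finally show ?thesis .
qed

lemma subspace_poly_span: "complex_vector.subspace (poly_span R)"
  by (simp add: complex_vector.subspace_def poly_span_subspace)

lemma poly_span_mult:
  assumes "p \<in> poly_span R" "q \<in> poly_span S" "\<And>as bs. R as \<Longrightarrow> S bs \<Longrightarrow> U (as @ bs)"
  shows "p * q \<in> poly_span U"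
proof (rule poly_span_image[where f = "\<lambda>p. p * q", OF _ assms(1) subspace_poly_span])
  fix k x
  assume x: "x \<in> word_span R"
  show "Poly_Mapping.single k x * q \<in> poly_span U"
  proof (rule poly_span_image[where f = "\<lambda>q. Poly_Mapping.single k x * q", OF _ assms(2) subspace_poly_span])
    fix l y
    assume y: "y \<in> word_span S"
    show "Poly_Mapping.single k x * Poly_Mapping.single l y \<in> poly_span U"
      unfolding mult_single by (intro poly_span_single word_span_mult[OF x y]) (rule assms(3))
  qed (intro clinear_poly_mult_right clinear_ident)
qed (intro clinear_poly_mult_left clinear_ident)

lemma word_span_sign: "x \<in> word_span R \<Longrightarrow> weil_sign x \<in> word_span R"
  by (erule word_span_image[OF clinear_weil_sign])
    (simp add: weil_sign_monomial word_span_subspace(5) word_span_base)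

lemma poly_span_sign: "p \<in> poly_span R \<Longrightarrow> poly_sign p \<in> poly_span R"
  by (simp add: poly_span_def lookup_map_clinear[OF clinear_weil_sign] word_span_sign)

lemma poly_sign_poly_span:
  assumes "p \<in> poly_span R" "\<And>as. R as \<Longrightarrow> mdeg as = k"
  shows "poly_sign p = ksign k *\<^sub>C p"
proof (rule poly_span_eqI[OF clinear_poly_sign clinear_scale[OF clinear_ident] assms(1)])
  fix i x
  assume "x \<in> word_span R"
  then have "x \<in> weil_comp k"
    unfolding weil_comp_eq using assms(2) by (rule word_span_mono)
  then show "poly_sign (Poly_Mapping.single i x) = ksign k *\<^sub>C Poly_Mapping.single i x"
    by (simp add: poly_sign_single weil_sign_comp scaleC_single)
qed

lemma poly_span_mono: "p \<in> poly_span R \<Longrightarrow> (\<And>as. R as \<Longrightarrow> S as) \<Longrightarrow> p \<in> poly_span S"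
  unfolding poly_span_def using word_span_mono by blast

section \<open>Forms on the line\<close>

lemma forms_mult_Pair: "forms_mult (p, q) (p', q') = (p * p', p * q' + q * poly_sign p')"
  by (simp add: forms_mult_def)

lemma bilin_forms_mult: "bilin forms_mult"
proof (rule bilinI)
  show "clinear (\<lambda>a. forms_mult a b)" for b :: "'a weil_forms"
    by (cases b) (auto simp: clinear_iff forms_mult_Pair scaleC_prod_def split_paired_all distrib_right
      scaleC_add_right)
  show "clinear (forms_mult a)" for a :: "'a weil_forms"
    by (cases a) (auto simp: clinear_iff forms_mult_Pair scaleC_prod_def split_paired_all distrib_left
      scaleC_add_right
      clinear_simps[OF clinear_poly_sign])
qed

lemma forms_mult_assoc: "forms_mult (forms_mult a b) c = forms_mult a (forms_mult b c)"
  by (cases a; cases b; cases c) (simp add: forms_mult_Pair poly_sign_mult algebra_simps)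

lemma forms_mult_one [simp]: "forms_mult (1, 0) a = a"
  by (cases a) (simp add: forms_mult_Pair)

text \<open>The parity involution for the total degree; the extra minus sign in the second component
  is the degree of dt.\<close>

definition forms_sign :: "'h::complex_vector weil_forms \<Rightarrow> 'h weil_forms"
  where "forms_sign a = (poly_sign (fst a), - poly_sign (snd a))"

text \<open>With the Koszul sign expressed by a linear operator, the Leibniz rule holds for
  inhomogeneous x too, as is needed for coefficients of polynomials.\<close>

lemma derivation_weil_sign:
  assumes "graded_derivation D"
  shows "D (x * y) = D x * y + weil_sign x * D y"
proof (rule weil1_eqI[where f = "\<lambda>x. D (x * y)" and g = "\<lambda>x. D x * y + weil_sign x * D y"])
  show "clinear (\<lambda>x. D (x * y))" "clinear (\<lambda>x. D x * y + weil_sign x * D y)"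
    by (intro clinear_comp[OF derivation_clinear[OF assms]] clinear_plus clinear_mult_left clinear_ident
      clinear_weil_sign derivation_clinear[OF assms])+
qed (simp add: derivation_mult[OF assms monomial_in_weil_comp] weil_sign_monomial)

lemma clinear_con_t: "clinear con_t"
  unfolding con_t_def[abs_def]
  by (intro clinear_Pair clinear_zero clinear_comp[OF clinear_single clinear_con])

definition int01 :: "'h::complex_vector weil_poly \<Rightarrow> 'h weil1"
  where "int01 q = (\<Sum>k\<in>Poly_Mapping.keys q. (1 / of_nat (k + 1)) *\<^sub>C weil_sign (Poly_Mapping.lookup q k))"

lemma int01_linear: "clinear (\<lambda>x. (1 / of_nat (k + 1)) *\<^sub>C weil_sign x)"
  by (rule clinear_scale[OF clinear_weil_sign])

lemma clinear_int01: "clinear int01"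
  unfolding int01_def[abs_def]
  by (rule clinear_poly_sum[where h = "\<lambda>k x. (1 / of_nat (k + 1)) *\<^sub>C weil_sign x", OF int01_linear])

lemma int01_single: "int01 (Poly_Mapping.single k x) = (1 / of_nat (k + 1)) *\<^sub>C weil_sign x"
  unfolding int01_def
  by (rule poly_sum_single[where h = "\<lambda>k x. (1 / of_nat (k + 1)) *\<^sub>C weil_sign x", OF int01_linear])

lemma integrate_eq: "integrate a = int01 (snd a)"
  by (simp add: integrate_def int01_def)

definition eval_one :: "'h::complex_vector weil_poly \<Rightarrow> 'h weil1"
  where "eval_one p = (\<Sum>k\<in>Poly_Mapping.keys p. Poly_Mapping.lookup p k)"

lemma clinear_eval_one: "clinear eval_one"
  unfolding eval_one_def[abs_def]
  by (rule clinear_poly_sum[where h = "\<lambda>k x. x", OF clinear_ident])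

lemma eval_one_single [simp]: "eval_one (Poly_Mapping.single k x) = x"
  unfolding eval_one_def by (rule poly_sum_single[where h = "\<lambda>k x. x", OF clinear_ident])

lemma eval_one_mult: "eval_one (p * q) = eval_one p * eval_one q"
  by (rule poly_mult_eqI[where f = "\<lambda>p q. eval_one (p * q)" and g = "\<lambda>p q. eval_one p * eval_one q"])
    (auto intro!: bilinI clinear_comp[OF clinear_eval_one] clinear_poly_mult_left clinear_poly_mult_right
      clinear_mult_left clinear_mult_right clinear_ident clinear_eval_one simp: mult_single)

lemma lookup_zero_mult: "Poly_Mapping.lookup (p * q) 0 = Poly_Mapping.lookup p 0 * Poly_Mapping.lookup q 0"
  for p q :: "'h::complex_vector weil_poly"
  by (rule poly_mult_eqI[where f = "\<lambda>p q. Poly_Mapping.lookup (p * q) 0"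
        and g = "\<lambda>p q. Poly_Mapping.lookup p 0 * Poly_Mapping.lookup q 0"])
    (auto intro!: bilinI clinear_comp[OF clinear_lookup] clinear_poly_mult_left clinear_poly_mult_right
      clinear_mult_left clinear_mult_right clinear_ident clinear_lookup simp: mult_single lookup_single
        when_def)

text \<open>The fundamental theorem of calculus on powers of t. The sign for moving the differential
  past x and the sign built into the integration cancel.\<close>

lemma int01_t_deriv: "int01 (t_deriv (poly_sign p)) = eval_one p - Poly_Mapping.lookup p 0"
proof (rule poly_eqI[where f = "\<lambda>p. int01 (t_deriv (poly_sign p))" and g = "\<lambda>p. eval_one p -
  Poly_Mapping.lookup p 0"])
  show "int01 (t_deriv (poly_sign (Poly_Mapping.single k x))) =
      eval_one (Poly_Mapping.single k x) - Poly_Mapping.lookup (Poly_Mapping.single k x) 0" for k and x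
        :: "'a weil1"
  proof (cases k)
    case (Suc j)
    have "1 + of_nat j \<noteq> (0 :: complex)"
      by (metis of_nat_Suc of_nat_eq_0_iff nat.distinct(1))
    then show ?thesis
      by (simp add: Suc poly_sign_single t_deriv_single int01_single clinear_scaleC[OF
        clinear_weil_sign] lookup_single)
  qed (simp add: poly_sign_single t_deriv_single clinear_0[OF clinear_int01])
qed (intro clinear_minus clinear_comp[OF clinear_int01] clinear_comp[OF clinear_t_deriv] clinear_poly_sign
    clinear_eval_one clinear_lookup)+

context coalgebra
begin

abbreviation fd where "fd \<equiv> forms_diff \<Delta>"

lemma forms_diff_Pair: "fd (p, q) = (Poly_Mapping.map wd p, Poly_Mapping.map wd q + t_deriv (poly_sign p))"
  by (simp add: forms_diff_def)

lemmas clinear_map_wd = clinear_map[OF clinear_wd]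
lemmas map_wd_single = map_clinear_single[OF clinear_wd]

lemma clinear_fd: "clinear fd"
  by (auto simp: clinear_iff forms_diff_Pair scaleC_prod_def split_paired_all scaleC_add_right
      clinear_simps[OF clinear_poly_sign] clinear_simps[OF clinear_map_wd] clinear_simps[OF clinear_t_deriv])

lemma map_wd_mult: "Poly_Mapping.map wd (p * q) = Poly_Mapping.map wd p * q + poly_sign p *
  Poly_Mapping.map wd q"
  by (rule poly_mult_eqI[where f = "\<lambda>p q. Poly_Mapping.map wd (p * q)"
        and g = "\<lambda>p q. Poly_Mapping.map wd p * q + poly_sign p * Poly_Mapping.map wd q"])
    (auto intro!: bilinI clinear_plus clinear_comp[OF clinear_map_wd] clinear_poly_mult_left
      clinear_poly_mult_right
      clinear_ident clinear_poly_sign clinear_map_wd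
      simp: poly_sign_single map_wd_single mult_single derivation_weil_sign[OF weil_diff_spec(1)]
        clinear_add[OF clinear_single])

lemma wd_weil_sign: "wd (weil_sign x) = - weil_sign (wd x)"
  by (rule weil1_eqI[where f = "\<lambda>x. wd (weil_sign x)" and g = "\<lambda>x. - weil_sign (wd x)"])
    (auto intro!: clinear_neg clinear_comp[OF clinear_wd clinear_weil_sign] clinear_comp[OF
      clinear_weil_sign clinear_wd]
      simp: weil_sign_monomial weil_sign_comp[OF wd_weil_comp[OF monomial_in_weil_comp]]
        clinear_simps[OF clinear_wd] ksign_add)

lemma map_wd_poly_sign: "Poly_Mapping.map wd (poly_sign p) = - poly_sign (Poly_Mapping.map wd p)"
  by (rule poly_mapping_eqI)
    (simp add: lookup_map_clinear[OF clinear_wd] lookup_map_clinear[OF clinear_weil_sign] wd_weil_sign)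

lemma fd_mult: "fd (forms_mult a b) = forms_mult (fd a) b + forms_mult (forms_sign a) (fd b)"
  by (cases a; cases b)
    (simp add: forms_mult_Pair forms_diff_Pair forms_sign_def map_wd_mult map_wd_poly_sign t_deriv_mult
      poly_sign_mult
      clinear_simps[OF clinear_map_wd] clinear_simps[OF clinear_poly_sign] t_deriv_poly_sign algebra_simps)

subsection \<open>The characteristic map\<close>

definition cur_t :: "'h \<Rightarrow> 'h weil_forms"
  where "cur_t h = fd (con_t h) + sweedler \<Delta> (\<lambda>a b. forms_mult (con_t a) (con_t b)) h"

lemma bilin_forms_mult_comp: "clinear f \<Longrightarrow> clinear g \<Longrightarrow> bilin (\<lambda>a b. forms_mult (f a) (g b))"
  for f g :: "'h \<Rightarrow> 'h weil_forms"
  by (intro bilinI clinear_comp[OF bilin_left[OF bilin_forms_mult]] clinear_comp[OF bilin_right[OF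
    bilin_forms_mult]])

lemma clinear_cur_t: "clinear cur_t"
  unfolding cur_t_def[abs_def]
  by (intro clinear_plus clinear_comp[OF clinear_fd clinear_con_t] clinear_sweedler
    bilin_forms_mult_comp clinear_con_t)

text \<open>The differential of h t contributes t \<partial> h and the dt term, and the square of
  the connection contributes t^2. The function part is \<omega> h at t = 1 and zero at t = 0, which
  is what turns Stokes' theorem into a contraction.\<close>

lemma cur_t_eq:
  "cur_t h = (Poly_Mapping.single 1 (\<omega> h) - Poly_Mapping.single 1 (sweedler \<Delta> (\<lambda>a b. con a * con b) h)
     + Poly_Mapping.single 2 (sweedler \<Delta> (\<lambda>a b. con a * con b) h), - Poly_Mapping.single 0 (con h))"
proof -
  have "sweedler \<Delta> (\<lambda>a b. forms_mult (con_t a) (con_t b)) h =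
      sweedler \<Delta> (\<lambda>a b. (Poly_Mapping.single 2 (con a * con b), 0 :: 'h weil_poly)) h"
    by (simp add: con_t_def forms_mult_Pair mult_single numeral_2_eq_2 poly_sign_single del: gval.simps)
  also have "\<dots> = (Poly_Mapping.single 2 (sweedler \<Delta> (\<lambda>a b. con a * con b) h), 0)"
    using sweedler_apply[OF bilin_words(1) clinear_Pair[OF clinear_single[of 2] clinear_zero]] .
  finally show ?thesis
    using weil_sign_monomial[of "[Con h]"]
    by (simp add: cur_t_def con_t_def forms_diff_Pair map_wd_single poly_sign_single t_deriv_single
        clinear_0[OF clinear_map_wd] weil_diff_spec clinear_simps[OF clinear_single]
        clinear_uminus[OF clinear_t_deriv] del: gval.simps)
qed

definition gval_t :: "'h wgen \<Rightarrow> 'h weil_forms"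
  where "gval_t a = (case a of Con h \<Rightarrow> con_t h | Cur h \<Rightarrow> cur_t h)"

lemma char_map_aux:
  obtains \<Phi> where "clinear \<Phi>" "\<Phi> 1 = (1, 0)" "\<And>a x. \<Phi> (gval a * x) = forms_mult (gval_t a) (\<Phi> x)"
proof -
  have lin: "clinear (\<lambda>v. con_t (fst v) + cur_t (snd v))"
    by (intro clinear_plus clinear_comp[OF clinear_con_t clinear_fst] clinear_comp[OF clinear_cur_t
      clinear_snd])
  obtain G where G: "clinear G" "G 1 = (1, 0)"
    "\<And>v x. G (tgen v * x) = 0 + forms_mult (con_t (fst v) + cur_t (snd v)) (G x)"
    by (rule tensor_rec[where L="\<lambda>v x. 0" and R="\<lambda>v y. forms_mult (con_t (fst v) + cur_t (snd v)) y" and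
      e="(1, 0)",
      OF clinear_zero clinear_zero clinear_comp[OF bilin_left[OF bilin_forms_mult] lin] bilin_right[OF
        bilin_forms_mult]]) blast
  have "G (gval a * x) = forms_mult (gval_t a) (G x)" for a x
    by (cases a) (simp_all add: G(3) gval_t_def clinear_0[OF clinear_con_t] clinear_0[OF clinear_cur_t])
  with G(1,2) show ?thesis by (rule that)
qed

lemma sweedler_con_span:
  "sweedler \<Delta> (\<lambda>a b. con a * con b) h \<in> word_span (\<lambda>as. length as = 2 \<and> mdeg as = 2)"
proof (rule sweedler_word_span[OF bilin_words(1)])
  show "con a * con b \<in> word_span (\<lambda>as. length as = 2 \<and> mdeg as = 2)" for a b :: 'h
    using word_span_base[of "\<lambda>as. length as = 2 \<and> mdeg as = 2" "[Con a, Con b]"] by simp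
qed

text \<open>Compatibility with the differentials spreads from generators to products by the Leibniz
  rules. On a connection letter it is the definition of curvature; on a curvature letter it is the
  Bianchi identity, a consequence of d d = 0 and coassociativity.\<close>

lemma char_map_spec: "clinear (char_map \<Delta>) \<and> char_map \<Delta> 1 = (1, 0) \<and>
    (\<forall>x y. char_map \<Delta> (x * y) = forms_mult (char_map \<Delta> x) (char_map \<Delta> y)) \<and>
    (\<forall>x. char_map \<Delta> (wd x) = fd (char_map \<Delta> x)) \<and>
    (\<forall>h. char_map \<Delta> (con h) = con_t h) \<and>
    (\<forall>h. char_map \<Delta> (\<omega> h) = fd (con_t h) + sweedler \<Delta> (\<lambda>a b. forms_mult (con_t a) (con_t b)) h)"
  (is "?P (char_map \<Delta>)")
proof -
  obtain \<Phi> where \<Phi>: "clinear \<Phi>" "\<Phi> 1 = (1, 0)" and Cons: "\<And>a x. \<Phi> (gval a * x) = forms_mult (gval_t a) (\<Phi> x)"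
    by (rule char_map_aux) blast
  note lin = clinear_simps[OF \<Phi>(1)]
  have mult: "\<Phi> (x * y) = forms_mult (\<Phi> x) (\<Phi> y)" for x y
    by (rule weil1_eq_induct[where f = "\<lambda>x. \<Phi> (x * y)" and g = "\<lambda>x. forms_mult (\<Phi> x) (\<Phi> y)"])
      (auto intro!: clinear_comp[OF \<Phi>(1)] clinear_mult_left clinear_ident clinear_comp[OF bilin_left[OF
        bilin_forms_mult]] \<Phi>(1)
        simp: \<Phi>(2) Cons mult.assoc forms_mult_assoc)
  have gen: "\<Phi> (gval a) = gval_t a" for a
    using Cons[of a 1] by (cases "gval_t a") (simp add: \<Phi>(2) forms_mult_Pair)
  have con: "\<Phi> (con h) = con_t h" and cur: "\<Phi> (\<omega> h) = cur_t h" for h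
    using gen[of "Con h"] gen[of "Cur h"] by (simp_all add: gval_t_def)
  have sgn: "forms_sign (con_t h) = - con_t h" for h
    using weil_sign_monomial[of "[Con h]"]
    by (simp add: forms_sign_def con_t_def poly_sign_single clinear_0[OF clinear_poly_sign]
      clinear_simps[OF clinear_single])
  have sgn_cur: "forms_sign (cur_t h) = cur_t h" for h
  proof -
    have "sweedler \<Delta> (\<lambda>a b. con a * con b) h \<in> weil_comp 2"
      unfolding weil_comp_eq by (rule word_span_mono[OF sweedler_con_span]) simp
    from weil_sign_comp[OF this] weil_sign_monomial[of "[Con h]"] weil_sign_monomial[of "[Cur h]"] show
      ?thesis
      by (simp add: forms_sign_def cur_t_eq poly_sign_single clinear_simps[OF clinear_poly_sign]
        clinear_simps[OF clinear_single])
  qed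
  have sign: "forms_sign (gval_t a) = ksign (gdeg a) *\<^sub>C gval_t a" for a
    by (cases a) (simp_all add: gval_t_def sgn sgn_cur)
  have fdfd: "fd (fd (con_t h)) = 0" for h
    using weil_sign_monomial[of "[Con h]"] wd_weil_sign[of "con h"]
    by (simp add: con_t_def forms_diff_Pair map_wd_single poly_sign_single t_deriv_single
      clinear_simps[OF clinear_map_wd]
       clinear_simps[OF clinear_single] clinear_simps[OF clinear_wd] clinear_uminus[OF clinear_t_deriv]
         zero_prod_def)
  have sw: "\<Phi> (sweedler \<Delta> (\<lambda>a b. f a * g b) h) = sweedler \<Delta> (\<lambda>a b. forms_mult (\<Phi> (f a)) (\<Phi> (g b))) h"
    if "clinear f" "clinear g" for f g h
    using sweedler_apply[OF bilin_tensor_mult[OF that] \<Phi>(1)] by (simp add: mult)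
  have diff_gen: "\<Phi> (wd (gval a)) = fd (gval_t a)" for a
  proof (cases a)
    case (Con h)
    have "\<Phi> (wd (con h)) = fd (con_t h)"
      by (simp add: weil_diff_spec lin sw clinear_con con cur cur_t_def del: gval.simps)
    then show ?thesis by (simp add: Con gval_t_def)
  next
    case (Cur h)
    let ?S = "\<lambda>a. sweedler \<Delta> (\<lambda>c d. forms_mult (con_t c) (con_t d)) a"
    let ?d = "\<lambda>a. fd (con_t a)"
    note fd_lin = clinear_comp[OF clinear_fd clinear_con_t] and S_lin = clinear_sweedler[OF
      bilin_forms_mult_comp[OF clinear_con_t clinear_con_t]]
    note bl = bilin_forms_mult_comp[OF fd_lin clinear_con_t] bilin_forms_mult_comp[OF clinear_con_t fd_lin]
      bilin_forms_mult_comp[OF S_lin clinear_con_t] bilin_forms_mult_comp[OF clinear_con_t S_lin]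
      bilin_forms_mult_comp[OF clinear_con_t clinear_con_t]
    have "\<Phi> (wd (\<omega> h)) = sweedler \<Delta> (\<lambda>a b. forms_mult (cur_t a) (con_t b)) h - sweedler \<Delta> (\<lambda>a b.
      forms_mult (con_t a) (cur_t b)) h"
      by (simp add: weil_diff_spec lin sw clinear_con clinear_cur con cur del: gval.simps)
    also have "\<dots> = (sweedler \<Delta> (\<lambda>a b. forms_mult (?d a) (con_t b)) h + sweedler \<Delta> (\<lambda>a b. forms_mult (?S
      a) (con_t b)) h)
       - (sweedler \<Delta> (\<lambda>a b. forms_mult (con_t a) (?d b)) h + sweedler \<Delta> (\<lambda>a b. forms_mult (con_t a) (?S
         b)) h)"
      by (simp add: cur_t_def clinear_add[OF bilin_left[OF bilin_forms_mult]] clinear_add[OF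
        bilin_right[OF bilin_forms_mult]]
          sweedler_plus bl)
    \<comment> \<open>The terms cubic in the connection agree by coassociativity and will cancel,
      leaving those with one differential.\<close>
    also have "sweedler \<Delta> (\<lambda>a b. forms_mult (?S a) (con_t b)) h = sweedler \<Delta> (\<lambda>a b. forms_mult (con_t a)
      (?S b)) h"
    proof -
      have "sweedler \<Delta> (\<lambda>a b. sweedler \<Delta> (\<lambda>c d. forms_mult (forms_mult (con_t c) (con_t d)) (con_t b)) a) h =
        sweedler \<Delta> (\<lambda>a b. sweedler \<Delta> (\<lambda>c d. forms_mult (forms_mult (con_t a) (con_t c)) (con_t d)) b) h"
        by (rule sweedler_coassoc[where F = "\<lambda>a b c. forms_mult (forms_mult (con_t a) (con_t b)) (con_t c)"])
          (intro clinear_comp[OF bilin_left[OF bilin_forms_mult]] clinear_comp[OF bilin_right[OF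
            bilin_forms_mult]] clinear_con_t)+
      then show ?thesis
        using sweedler_apply[OF bl(5) bilin_left[OF bilin_forms_mult]] sweedler_apply[OF bl(5)
          bilin_right[OF bilin_forms_mult]]
        by (simp add: forms_mult_assoc)
    qed
    also have "(sweedler \<Delta> (\<lambda>a b. forms_mult (?d a) (con_t b)) h + sweedler \<Delta> (\<lambda>a b. forms_mult (con_t
      a) (?S b)) h)
       - (sweedler \<Delta> (\<lambda>a b. forms_mult (con_t a) (?d b)) h + sweedler \<Delta> (\<lambda>a b. forms_mult (con_t a) (?S
         b)) h) =
       sweedler \<Delta> (\<lambda>a b. forms_mult (?d a) (con_t b) - forms_mult (con_t a) (?d b)) h"
      by (simp add: sweedler_minus bl)
    \<comment> \<open>The connection form is odd, so the minus sign is that of the Leibniz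
      rule.\<close>
    also have "\<dots> = sweedler \<Delta> (\<lambda>a b. fd (forms_mult (con_t a) (con_t b))) h"
      by (simp add: fd_mult sgn clinear_uminus[OF bilin_left[OF bilin_forms_mult]])
    also have "\<dots> = fd (cur_t h)"
      by (simp add: cur_t_def clinear_add[OF clinear_fd] fdfd sweedler_apply[OF bl(5) clinear_fd])
    finally show ?thesis by (simp add: Cur gval_t_def)
  qed
  have fd_one: "fd (1, 0) = 0"
    using map_wd_single[of 0 1] t_deriv_single[of 0 "1 :: 'h weil1"]
    by (simp add: forms_diff_Pair clinear_0[OF clinear_map_wd] graded_derivation_one[OF
      weil_diff_spec(1)] zero_prod_def)
  have diff: "\<Phi> (wd x) = fd (\<Phi> x)" for x
  proof (rule weil1_eq_induct[where f = "\<lambda>x. \<Phi> (wd x)" and g = "\<lambda>x. fd (\<Phi> x)"])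
    show "\<Phi> (wd 1) = fd (\<Phi> 1)"
      by (simp add: graded_derivation_one[OF weil_diff_spec(1)] lin \<Phi>(2) fd_one)
    show "\<Phi> (wd (gval a * monomial as)) = fd (\<Phi> (gval a * monomial as))" if "\<Phi> (wd (monomial as)) = fd
      (\<Phi> (monomial as))" for a as
      by (simp add: derivation_gval[OF weil_diff_spec(1)] lin mult gen diff_gen that fd_mult sign
         clinear_scaleC[OF bilin_left[OF bilin_forms_mult]])
  qed (rule clinear_comp[OF \<Phi>(1) clinear_wd] clinear_comp[OF clinear_fd \<Phi>(1)])+
  have "?P \<Phi>"
    using \<Phi> mult diff con cur unfolding cur_t_def by blast
  moreover have "F = \<Phi>" if "?P F" for F
  proof
    have F: "F (gval a) = gval_t a" for a
      using that unfolding gval_t_def cur_t_def by (cases a) (auto simp del: gval.simps)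
    show "F x = \<Phi> x" for x
      by (rule weil1_eq_induct[where f = F and g = \<Phi>]) (use that \<Phi> F gen in \<open>auto simp: mult\<close>)
  qed
  ultimately show ?thesis
    unfolding char_map_def by (rule theI[where P = ?P])
qed

lemma clinear_char_map: "clinear (char_map \<Delta>)"
  and char_map_one: "char_map \<Delta> 1 = (1, 0)"
  and char_map_mult: "char_map \<Delta> (x * y) = forms_mult (char_map \<Delta> x) (char_map \<Delta> y)"
  and char_map_wd: "char_map \<Delta> (wd x) = fd (char_map \<Delta> x)"
  using char_map_spec by blast+

lemma char_map_gval: "char_map \<Delta> (gval a) = gval_t a"
  using char_map_spec unfolding gval_t_def cur_t_def by (cases a) (auto simp del: gval.simps)

section \<open>The contraction: homotopy formula, degrees, and compatibility with
  commutators\<close>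

lemma clinear_cs_contraction: "clinear (cs_contraction \<Delta>)"
  unfolding cs_contraction_def[abs_def] integrate_eq
  by (rule clinear_comp[OF clinear_int01 clinear_comp[OF clinear_snd clinear_char_map]])

text \<open>Function parts multiply without interference from the dt parts, and evaluation at an end
  point is multiplicative. So it suffices that every generator evaluates to itself at 1 and to 0 at
  0.\<close>

lemma char_map_eval:
  "eval_one (fst (char_map \<Delta> (monomial as))) = monomial as"
  "as \<noteq> [] \<Longrightarrow> Poly_Mapping.lookup (fst (char_map \<Delta> (monomial as))) 0 = 0"
proof -
  have fst_mult: "fst (forms_mult u v) = fst u * fst v" for u v :: "'h weil_forms"
    by (cases u; cases v) (simp add: forms_mult_Pair)
  have one: "eval_one (fst (gval_t a)) = gval a" and zero: "Poly_Mapping.lookup (fst (gval_t a)) 0 = 0" for a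
    by (cases a; simp add: gval_t_def con_t_def cur_t_eq clinear_simps[OF clinear_eval_one] lookup_add
      lookup_minus
        lookup_single del: gval.simps)+
  show "eval_one (fst (char_map \<Delta> (monomial as))) = monomial as"
    by (induction as) (simp_all add: char_map_one char_map_mult char_map_gval fst_mult eval_one_mult one
        eval_one_single[of 0 1, simplified])
  show "Poly_Mapping.lookup (fst (char_map \<Delta> (monomial as))) 0 = 0" if "as \<noteq> []"
    using that by (cases as) (simp_all add: char_map_mult char_map_gval fst_mult lookup_zero_mult zero)
qed

lemma int01_map_wd: "int01 (Poly_Mapping.map wd q) = - wd (int01 q)"
  by (rule poly_eqI[where f = "\<lambda>q. int01 (Poly_Mapping.map wd q)" and g = "\<lambda>q. - wd (int01 q)"])
    (auto intro!: clinear_neg clinear_comp[OF clinear_int01 clinear_map_wd] clinear_comp[OF clinear_wd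
      clinear_int01]
      simp: map_wd_single int01_single clinear_simps[OF clinear_wd] wd_weil_sign)

text \<open>Stokes' theorem on the interval, whose end points contribute the identity and \<open>0\<close>.\<close>

lemma cs_homotopy:
  assumes "x \<in> weil"
  shows "wd (cs_contraction \<Delta> x) + cs_contraction \<Delta> (wd x) = x"
proof -
  let ?p = "fst (char_map \<Delta> x)" and ?q = "snd (char_map \<Delta> x)"
  have "eval_one ?p = x"
    by (rule weil1_eqI[where f = "\<lambda>x. eval_one (fst (char_map \<Delta> x))" and g = "\<lambda>x. x"])
      (simp_all add: clinear_ident char_map_eval clinear_comp[OF clinear_eval_one clinear_comp[OF
        clinear_fst clinear_char_map]])
  moreover have "Poly_Mapping.lookup ?p 0 = 0"
    by (rule word_span_eq[where f = "\<lambda>x. Poly_Mapping.lookup (fst (char_map \<Delta> x)) 0" and g = "\<lambda>x. 0", OF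
      _ _ assms[unfolded weil_eq]])
      (simp_all add: clinear_zero char_map_eval clinear_comp[OF clinear_lookup clinear_comp[OF
        clinear_fst clinear_char_map]])
  moreover have "fd (char_map \<Delta> x) = fd (?p, ?q)" by simp
  ultimately show ?thesis
    by (simp only: cs_contraction_def integrate_eq char_map_wd forms_diff_Pair snd_conv clinear_add[OF
      clinear_int01]
        int01_map_wd int01_t_deriv) simp
qed

text \<open>The dt part lies one degree lower because dt carries that degree. The bound on the
  length keeps the contraction inside the algebra without unit. No curvature count appears: the term
  -h dt in the image of \<omega> h has lost its curvature.\<close>

lemma char_map_span:
  "fst (char_map \<Delta> (monomial as)) \<in> poly_span (\<lambda>bs. length as \<le> length bs \<and> mdeg bs = mdeg as) \<and>
   snd (char_map \<Delta> (monomial as)) \<in> poly_span (\<lambda>bs. length as \<le> length bs \<and> mdeg bs = mdeg as - 1)"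
proof (induction as)
  case Nil
  have "(Poly_Mapping.single 0 1 :: 'h weil_poly) \<in> poly_span (\<lambda>bs. mdeg bs = 0)"
    using one_in_weil_comp unfolding weil_comp_eq by (rule poly_span_single)
  then show ?case by (simp add: char_map_one poly_span_subspace)
next
  case (Cons a as)
  have word: "gval b \<in> word_span R" if "R [b]" for R and b :: "'h wgen"
    using word_span_base[of R "[b]"] that by simp
  have gen: "fst (gval_t a) \<in> poly_span (\<lambda>bs. 1 \<le> length bs \<and> mdeg bs = gdeg a)"
    "snd (gval_t a) \<in> poly_span (\<lambda>bs. 1 \<le> length bs \<and> mdeg bs = gdeg a - 1)"
    by (cases a; auto simp: gval_t_def con_t_def cur_t_eq simp del: gval.simps
        intro!: poly_span_subspace poly_span_single word word_span_mono[OF sweedler_con_span])+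
  obtain p q where pq: "char_map \<Delta> (monomial as) = (p, q)" by fastforce
  obtain p' q' where pq': "gval_t a = (p', q')" by fastforce
  show ?case
    using Cons gen
    by (auto simp: char_map_mult char_map_gval pq pq' forms_mult_Pair
        intro!: poly_span_subspace(2) poly_span_mult[of p'] poly_span_mult[of q'] poly_span_sign)
qed

lemma int01_word_span: "q \<in> poly_span R \<Longrightarrow> int01 q \<in> word_span R"
  by (erule poly_span_image[OF clinear_int01 _ subspace_word_span])
    (simp add: int01_single word_span_subspace(5) word_span_sign)

lemma cs_contraction_weil: "x \<in> weil \<Longrightarrow> cs_contraction \<Delta> x \<in> weil"
  unfolding weil_eq cs_contraction_def integrate_eq
  by (erule word_span_image[OF clinear_comp[OF clinear_int01 clinear_comp[OF clinear_snd clinear_char_map]]],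
      rule int01_word_span, rule poly_span_mono[OF char_map_span[THEN conjunct2]]) auto

lemma cs_contraction_weil_comp: "x \<in> weil_comp k \<Longrightarrow> cs_contraction \<Delta> x \<in> weil_comp (k - 1)"
  unfolding weil_comp_eq cs_contraction_def integrate_eq
  by (erule word_span_image[OF clinear_comp[OF clinear_int01 clinear_comp[OF clinear_snd clinear_char_map]]],
      rule int01_word_span, rule poly_span_mono[OF char_map_span[THEN conjunct2]]) auto

text \<open>The variable t is central and even, so on single powers the integral only contributes a
  factor symmetric in the two arguments, and the claim is the trace property of N.\<close>

lemma cyc_N_int01_commute:
  fixes p q :: "'h weil_poly"
  assumes p: "p \<in> poly_span (\<lambda>as. mdeg as = j)" and q: "q \<in> poly_span (\<lambda>as. mdeg as = k)"
  shows "cyc_N (int01 (p * q)) = ksign (j * k) *\<^sub>C cyc_N (int01 (q * p))"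
proof (rule poly_span_eqI[where f = "\<lambda>p. cyc_N (int01 (p * q))" and g = "\<lambda>p. ksign (j * k) *\<^sub>C cyc_N
  (int01 (q * p))", OF _ _ p])
  fix i and x :: "'h weil1"
  assume x: "x \<in> word_span (\<lambda>as. mdeg as = j)"
  show "cyc_N (int01 (Poly_Mapping.single i x * q)) = ksign (j * k) *\<^sub>C cyc_N (int01 (q *
    Poly_Mapping.single i x))"
  proof (rule poly_span_eqI[where f = "\<lambda>q. cyc_N (int01 (Poly_Mapping.single i x * q))"
        and g = "\<lambda>q. ksign (j * k) *\<^sub>C cyc_N (int01 (q * Poly_Mapping.single i x))", OF _ _ q])
    fix l and y :: "'h weil1"
    assume y: "y \<in> word_span (\<lambda>as. mdeg as = k)"
    have xy: "x \<in> weil_comp j" "y \<in> weil_comp k" using x y by (simp_all add: weil_comp_eq)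
    show "cyc_N (int01 (Poly_Mapping.single i x * Poly_Mapping.single l y)) =
        ksign (j * k) *\<^sub>C cyc_N (int01 (Poly_Mapping.single l y * Poly_Mapping.single i x))"
      by (simp add: mult_single int01_single clinear_scaleC[OF clinear_cyc_N] weil_sign_comp[OF
        weil_comp_mult[OF xy]]
          weil_sign_comp[OF weil_comp_mult[OF xy(2,1)]] cyc_N_mult_commute[OF xy] add.commute mult.commute)
  qed (intro clinear_scale clinear_comp[OF clinear_cyc_N] clinear_comp[OF clinear_int01]
    clinear_poly_mult_left
      clinear_poly_mult_right clinear_ident)+
qed (intro clinear_scale clinear_comp[OF clinear_cyc_N] clinear_comp[OF clinear_int01] clinear_poly_mult_left
    clinear_poly_mult_right clinear_ident)+

text \<open>The dt part of a product of forms has two summands. Swapping the factors exchanges them,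
  and the sign from moving dt past a function part makes the total sign the Koszul sign of the two
  words.\<close>

lemma cyc_N_cs_contraction_monomial:
  "cyc_N (cs_contraction \<Delta> (monomial as * monomial bs)) =
    ksign (mdeg as * mdeg bs) *\<^sub>C cyc_N (cs_contraction \<Delta> (monomial bs * monomial as))"
proof -
  let ?j = "mdeg as" and ?k = "mdeg bs"
  obtain p q where \<Phi>a: "char_map \<Delta> (monomial as) = (p, q)" by fastforce
  obtain p' q' where \<Phi>b: "char_map \<Delta> (monomial bs) = (p', q')" by fastforce
  have p: "p \<in> poly_span (\<lambda>cs. mdeg cs = ?j)" "q \<in> poly_span (\<lambda>cs. mdeg cs = ?j - 1)"
    using char_map_span[of as] \<Phi>a by (auto elim: poly_span_mono)
  have p': "p' \<in> poly_span (\<lambda>cs. mdeg cs = ?k)" "q' \<in> poly_span (\<lambda>cs. mdeg cs = ?k - 1)"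
    using char_map_span[of bs] \<Phi>b by (auto elim: poly_span_mono)
  have sgn: "ksign ?k * ksign ((?j - 1) * ?k) = ksign (?j * ?k)" "ksign (?j * ?k) * ksign ?j = ksign (?j
    * (?k - 1))"
    by (auto simp: ksign_def)
  note lin = clinear_simps[OF clinear_int01] clinear_simps[OF clinear_cyc_N]
  show ?thesis
    by (simp add: cs_contraction_def integrate_eq char_map_mult \<Phi>a \<Phi>b forms_mult_Pair lin
        poly_sign_poly_span[OF p(1)] poly_sign_poly_span[OF p'(1)] cyc_N_int01_commute[OF p(1) p'(2)]
        cyc_N_int01_commute[OF p(2) p'(1)] sgn scaleC_add_right)
qed

lemma cyc_N_cs_contraction_cyc_t: "cyc_N (cs_contraction \<Delta> (cyc_t x)) = cyc_N (cs_contraction \<Delta> x)"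
proof (rule weil1_eqI[where f = "\<lambda>x. cyc_N (cs_contraction \<Delta> (cyc_t x))" and g = "\<lambda>x. cyc_N
  (cs_contraction \<Delta> x)"])
  show "clinear (\<lambda>x. cyc_N (cs_contraction \<Delta> (cyc_t x)))" "clinear (\<lambda>x. cyc_N (cs_contraction \<Delta> x))"
    by (intro clinear_comp[OF clinear_cyc_N] clinear_comp[OF clinear_cs_contraction clinear_cyc_t]
      clinear_cs_contraction)+
  show "cyc_N (cs_contraction \<Delta> (cyc_t (monomial as))) = cyc_N (cs_contraction \<Delta> (monomial as))" for as
  proof (cases as)
    case Nil
    have "cs_contraction \<Delta> 1 = 0"
      by (simp add: cs_contraction_def integrate_eq char_map_one clinear_0[OF clinear_int01])
    then show ?thesis by (simp add: Nil clinear_0[OF clinear_cs_contraction])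
  next
    case (Cons a bs)
    show ?thesis
      using cyc_N_cs_contraction_monomial[of bs "[a]"]
      by (simp add: Cons cyc_t_Cons clinear_scaleC[OF clinear_cs_contraction] clinear_scaleC[OF
        clinear_cyc_N] mult.commute)
  qed
qed

lemma cyc_N_eq_0_imp:
  assumes "x \<in> weil" "cyc_N x = 0"
  shows "cyc_t (cyc_Q x) - cyc_Q x = x"
  using cyc_decomposition[OF assms(1)] by (simp add: assms(2) cyc_N_cyc_P clinear_0[OF clinear_cyc_P])

text \<open>The kernel of N on nonempty words is the image of t - 1, and N after the contraction
  kills that image.\<close>

lemma cyc_N_cs_contraction:
  assumes "x \<in> weil" "cyc_N x = 0"
  shows "cyc_N (cs_contraction \<Delta> x) = 0"
proof -
  have "cyc_N (cs_contraction \<Delta> (cyc_t (cyc_Q x) - cyc_Q x)) = 0"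
    by (simp add: clinear_diff[OF clinear_cs_contraction] clinear_diff[OF clinear_cyc_N]
      cyc_N_cs_contraction_cyc_t)
  then show ?thesis by (simp add: cyc_N_eq_0_imp[OF assms])
qed

text \<open>Isolates what is shared by the algebra, the positive powers of I and zero, so that I_n
  and W_n can be treated alike as quotients Y / Z. Stability under P and Q makes the exactness of
  the cyclic sequence pass to such quotients.\<close>

definition cyc_stable :: "'h weil1 set \<Rightarrow> bool"
  where "cyc_stable Y \<longleftrightarrow> complex_vector.subspace Y \<and> Y \<subseteq> weil \<and>
    (\<forall>x\<in>Y. wd x \<in> Y \<and> cyc_b \<Delta> x \<in> Y \<and> cyc_t x \<in> Y \<and> cyc_N x \<in> Y \<and> cyc_P x \<in> Y \<and> cyc_Q x \<in> Y)"

text \<open>\<partial> and b never shorten a word nor lower its number of curvatures, and the other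
  operators only rotate; hence the two closure conditions on \<open>R\<close>.\<close>

lemma cyc_stable_word_span:
  assumes "\<And>as. R as \<Longrightarrow> as \<noteq> []" "\<And>a as. R (a # as) \<Longrightarrow> R (as @ [a])"
    and "\<And>as bs. R as \<Longrightarrow> length as \<le> length bs \<Longrightarrow> ncur as \<le> ncur bs \<Longrightarrow> R bs"
  shows "cyc_stable (word_span R)"
  unfolding cyc_stable_def
proof (intro conjI ballI)
  fix x assume x: "x \<in> word_span R"
  show "wd x \<in> word_span R"
    by (rule word_span_image[OF clinear_wd x], rule word_span_mono[OF wd_word_span], elim conjE, erule
      (2) assms(3))
  show "cyc_b \<Delta> x \<in> word_span R"
    by (rule word_span_image[OF clinear_cyc_b x], rule word_span_mono[OF cyc_b_word_span], elim conjE,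
      erule (2) assms(3))
  show "cyc_t x \<in> word_span R" "cyc_N x \<in> word_span R" "cyc_P x \<in> word_span R" "cyc_Q x \<in> word_span R"
    using word_span_cyc_t[OF x] word_span_cyc_ops[OF x] assms(2) by simp_all
next
  show "word_span R \<subseteq> weil"
    unfolding weil_eq using assms(1) by (auto elim!: word_span_mono)
qed (rule subspace_word_span)

lemma cyc_stable_weil: "cyc_stable weil"
  unfolding weil_eq by (rule cyc_stable_word_span) auto

lemma cyc_stable_curv_power: "cyc_stable (curv_power (Suc n))"
  unfolding curv_power_eq by (rule cyc_stable_word_span) auto

lemma cyc_stable_zero: "cyc_stable {0}"
  unfolding cyc_stable_def
  by (simp add: clinear_0[OF clinear_wd] clinear_0[OF clinear_cyc_b] clinear_0[OF clinear_cyc_t]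
      clinear_0[OF clinear_cyc_N] clinear_0[OF clinear_cyc_P] clinear_0[OF clinear_cyc_Q] weil_eq
        word_span_subspace)

lemma weil_comp_cyc_ops:
  assumes "x \<in> weil_comp k"
  shows "cyc_t x \<in> weil_comp k" "cyc_N x \<in> weil_comp k" "cyc_P x \<in> weil_comp k" "cyc_Q x \<in> weil_comp k"
  using assms unfolding weil_comp_eq
  by (auto intro!: word_span_cyc_t word_span_cyc_ops)

lemma cyc_b_weil_comp: "x \<in> weil_comp k \<Longrightarrow> cyc_b \<Delta> x \<in> weil_comp (k + 1)"
  unfolding weil_comp_eq
  by (erule word_span_image[OF clinear_cyc_b], rule word_span_mono[OF cyc_b_word_span]) auto

subsection \<open>The \<open>S\<close>-operator\<close>

text \<open>By linearity, independence of S from all choices amounts to this: if u is a boundary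
  modulo commutators, then so is w. Write c = u - \<partial> a as (t - 1) e modulo Z; then
  \<partial> u is (t - 1) b e, so v - b e is fixed by t and hence of the form N f, whence b v = b N
  f = N \<partial> f, all modulo Z.\<close>

lemma S_relation_zero:
  assumes Y: "cyc_stable Y" and Z: "cyc_stable Z" and "Z \<subseteq> Y"
    and u: "u \<in> Y" "u \<in> weil_comp k" and v: "v \<in> Y" "v \<in> weil_comp (k + 1)" and w: "w \<in> Y"
    and uv: "wd u - (cyc_t v - v) \<in> Z" and vw: "cyc_b \<Delta> v - cyc_N w \<in> Z"
    and a: "a \<in> Y" "a \<in> weil_comp (k - 1)" and cN: "cyc_N (u - wd a) \<in> Z"
  shows "\<exists>f\<in>Y \<inter> weil_comp (k + 1). cyc_N (w - wd f) \<in> Z"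
proof -
  note sY = Y[unfolded cyc_stable_def, THEN conjunct1] and sZ = Z[unfolded cyc_stable_def, THEN conjunct1]
  note opsY = Y[unfolded cyc_stable_def, THEN conjunct2, THEN conjunct2, rule_format]
  note opsZ = Z[unfolded cyc_stable_def, THEN conjunct2, THEN conjunct2, rule_format]
  note subY = complex_vector.subspace_add[OF sY] complex_vector.subspace_diff[OF sY]
  note subZ = complex_vector.subspace_add[OF sZ] complex_vector.subspace_diff[OF sZ]
    complex_vector.subspace_neg[OF sZ]
  have weil: "x \<in> weil" if "x \<in> Y" for x using Y that unfolding cyc_stable_def by auto
  define c where "c = u - wd a"
  have cY: "c \<in> Y" unfolding c_def using u a opsY subY by blast
  have ck: "c \<in> weil_comp k" unfolding c_def using u wd_weil_comp[OF a(2)] by (simp add: weil_comp_subspace)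
  define e where "e = cyc_Q c"
  have e: "e \<in> Y" "e \<in> weil_comp k" unfolding e_def using cY ck opsY weil_comp_cyc_ops by auto
  have c_eq: "c = cyc_P (cyc_N c) + (cyc_t e - e)"
    using cyc_decomposition[OF weil[OF cY]] by (simp add: e_def cyc_N_cyc_P)
  have "wd u = wd c" by (simp add: c_def clinear_diff[OF clinear_wd])
  also have "\<dots> = wd (cyc_P (cyc_N c)) + (cyc_t (cyc_b \<Delta> e) - cyc_b \<Delta> e)"
    by (subst c_eq) (simp add: clinear_simps[OF clinear_wd] cyc_t_cyc_b)
  finally have du: "wd u = wd (cyc_P (cyc_N c)) + (cyc_t (cyc_b \<Delta> e) - cyc_b \<Delta> e)" .
  have PN: "wd (cyc_P (cyc_N c)) \<in> Z" using cN opsZ by (simp add: c_def)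
  define g where "g = v - cyc_b \<Delta> e"
  have gY: "g \<in> Y" and gk: "g \<in> weil_comp (k + 1)"
    unfolding g_def using v e opsY subY cyc_b_weil_comp[OF e(2)] by (auto simp: weil_comp_subspace)
  have "cyc_t g - g = wd (cyc_P (cyc_N c)) - (wd u - (cyc_t v - v))"
    unfolding du g_def by (simp add: clinear_simps[OF clinear_cyc_t])
  then have tg: "cyc_t g - g \<in> Z" using PN uv subZ by metis
  \<comment> \<open>Q commutes with t, so invariance of g modulo Z makes the second summand of the
    decomposition of g vanish modulo Z, leaving N P g.\<close>
  have "cyc_t (cyc_Q g) - cyc_Q g = cyc_Q (cyc_t g - g)"
    by (simp add: cyc_t_cyc_Q clinear_diff[OF clinear_cyc_Q])
  then have Qg: "cyc_t (cyc_Q g) - cyc_Q g \<in> Z" using tg opsZ by metis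
  define f where "f = cyc_P g"
  have f: "f \<in> Y" "f \<in> weil_comp (k + 1)" unfolding f_def using gY gk opsY weil_comp_cyc_ops by auto
  have gf: "g - cyc_N f \<in> Z"
    using cyc_decomposition[OF weil[OF gY]] Qg unfolding f_def by (metis add_diff_cancel_left')
  have "cyc_b \<Delta> v = cyc_b \<Delta> (g - cyc_N f) + cyc_N (wd f)"
    by (simp add: g_def clinear_simps[OF clinear_cyc_b] cyc_b_cyc_b cyc_b_cyc_N)
  then have "cyc_N (w - wd f) = cyc_b \<Delta> (g - cyc_N f) - (cyc_b \<Delta> v - cyc_N w)"
    by (simp add: clinear_diff[OF clinear_cyc_N])
  also have "\<dots> \<in> Z" using gf vw opsZ subZ by blast
  finally show ?thesis using f by blast
qed

end

section \<open>Quotients of subspaces\<close>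

lemma subspace_clinear_image:
  assumes f: "clinear f" and S: "complex_vector.subspace S"
  shows "complex_vector.subspace (f ` S)"
proof (rule complex_vector.subspaceI)
  have "f 0 \<in> f ` S" using complex_vector.subspace_0[OF S] by (rule imageI)
  then show "0 \<in> f ` S" by (simp add: clinear_0[OF f])
next
  fix x y assume "x \<in> f ` S" "y \<in> f ` S"
  then obtain a b where "a \<in> S" "b \<in> S" "x = f a" "y = f b" by blast
  then have "x + y = f (a + b)" "a + b \<in> S"
    by (simp_all add: clinear_add[OF f] complex_vector.subspace_add[OF S])
  then show "x + y \<in> f ` S" by blast
next
  fix c x assume "x \<in> f ` S"
  then obtain a where "a \<in> S" "x = f a" by blast
  then have "c *\<^sub>C x = f (c *\<^sub>C a)" "c *\<^sub>C a \<in> S"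
    by (simp_all add: clinear_scaleC[OF f] complex_vector.subspace_scale[OF S])
  then show "c *\<^sub>C x \<in> f ` S" by blast
qed

text \<open>Quotients, also iterated ones, are handled through representatives: every space below is
  presented as \<open>Y / Z\<close> for subspaces \<open>Z \<subseteq> Y\<close> of the Weil algebra.\<close>

locale presentation =
  fixes Y Z :: "'v::complex_vector set" and M :: "('a, 'm) cspace_scheme" and \<pi> :: "'v \<Rightarrow> 'a"
  assumes subspace_Y: "complex_vector.subspace Y" and subspace_Z: "complex_vector.subspace Z"
    and Z_subset: "Z \<subseteq> Y"
    and carrier: "vcarrier M = \<pi> ` Y" and zero: "vzero M = \<pi> 0"
    and add: "x \<in> Y \<Longrightarrow> y \<in> Y \<Longrightarrow> vadd M (\<pi> x) (\<pi> y) = \<pi> (x + y)"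
    and scale: "x \<in> Y \<Longrightarrow> vscale M c (\<pi> x) = \<pi> (c *\<^sub>C x)"
    and eq_iff: "x \<in> Y \<Longrightarrow> y \<in> Y \<Longrightarrow> \<pi> x = \<pi> y \<longleftrightarrow> x - y \<in> Z"
begin

lemmas Y_closed = complex_vector.subspace_add[OF subspace_Y] complex_vector.subspace_diff[OF subspace_Y]
  complex_vector.subspace_scale[OF subspace_Y] complex_vector.subspace_0[OF subspace_Y]

lemma coset_image: "U \<subseteq> Y \<Longrightarrow> x \<in> Y \<Longrightarrow> coset M (\<pi> ` U) (\<pi> x) = (\<lambda>u. \<pi> (x + u)) ` U"
  unfolding coset_def image_image by (rule image_cong) (auto intro: add)

context
  fixes U
  assumes U: "complex_vector.subspace U" "Z \<subseteq> U" "U \<subseteq> Y"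
begin

lemmas U_closed = complex_vector.subspace_add[OF U(1)] complex_vector.subspace_diff[OF U(1)]
  complex_vector.subspace_0[OF U(1)] complex_vector.subspace_scale[OF U(1)]

lemma coset_eq_iff:
  assumes "x \<in> Y" "y \<in> Y"
  shows "coset M (\<pi> ` U) (\<pi> x) = coset M (\<pi> ` U) (\<pi> y) \<longleftrightarrow> x - y \<in> U"
proof
  assume "coset M (\<pi> ` U) (\<pi> x) = coset M (\<pi> ` U) (\<pi> y)"
  moreover have "\<pi> (x + 0) \<in> (\<lambda>u. \<pi> (x + u)) ` U"
    using U_closed(3) by (rule imageI)
  ultimately have "\<pi> (x + 0) \<in> (\<lambda>u. \<pi> (y + u)) ` U"
    using assms U(3) by (simp add: coset_image)
  then obtain u where u: "u \<in> U" "\<pi> x = \<pi> (y + u)" by auto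
  then have "x - (y + u) \<in> Z" using eq_iff[of x "y + u"] assms U(3) Y_closed(1) by auto
  then have "x - (y + u) + u \<in> U" using u(1) U(2) U_closed(1) by blast
  then show "x - y \<in> U" by simp
next
  have sub: "coset M (\<pi> ` U) (\<pi> x) \<subseteq> coset M (\<pi> ` U) (\<pi> y)" if h: "x - y \<in> U" "x \<in> Y" "y \<in> Y" for x y
  proof
    fix z assume "z \<in> coset M (\<pi> ` U) (\<pi> x)"
    then obtain u where u: "u \<in> U" "z = \<pi> (x + u)" using h(2) U(3) by (auto simp: coset_image)
    have "(\<lambda>u. \<pi> (y + u)) (x - y + u) \<in> (\<lambda>u. \<pi> (y + u)) ` U"
      using U_closed(1)[OF h(1) u(1)] by (rule imageI)
    then show "z \<in> coset M (\<pi> ` U) (\<pi> y)"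
      using h U(3) by (simp add: coset_image u(2))
  qed
  assume xy: "x - y \<in> U"
  then have "y - x \<in> U" using complex_vector.subspace_neg[OF U(1) xy] by simp
  then show "coset M (\<pi> ` U) (\<pi> x) = coset M (\<pi> ` U) (\<pi> y)"
    using sub[OF xy] sub[of y x] assms by blast
qed

text \<open>The union defining \<open>quot_op1\<close> runs over cosets that all coincide, because
  \<open>g\<close> preserves \<open>U\<close>, and there is at least one of them.\<close>

lemma quot_op1_coset:
  assumes x: "x \<in> Y" and f: "\<And>x. x \<in> Y \<Longrightarrow> f (\<pi> x) = \<pi> (g x)" and gY: "\<And>x. x \<in> Y \<Longrightarrow> g x \<in> Y"
    and g: "clinear g" "\<And>u. u \<in> U \<Longrightarrow> g u \<in> U"
  shows "quot_op1 M (\<pi> ` U) f (coset M (\<pi> ` U) (\<pi> x)) = coset M (\<pi> ` U) (\<pi> (g x))"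
proof -
  have "coset M (\<pi> ` U) (f z) = coset M (\<pi> ` U) (\<pi> (g x))" if "z \<in> coset M (\<pi> ` U) (\<pi> x)" for z
  proof -
    from that obtain u where u: "u \<in> U" "z = \<pi> (x + u)" using x by (auto simp: coset_image U)
    then have "x + u \<in> Y" using x U(3) Y_closed(1) by blast
    then have "coset M (\<pi> ` U) (\<pi> (g (x + u))) = coset M (\<pi> ` U) (\<pi> (g x))"
      using coset_eq_iff[of "g (x + u)" "g x"] gY[OF \<open>x + u \<in> Y\<close>] gY[OF x] g(2)[OF u(1)]
      by (simp add: clinear_add[OF g(1)])
    then show ?thesis using u f \<open>x + u \<in> Y\<close> by simp
  qed
  moreover have "coset M (\<pi> ` U) (\<pi> x) \<noteq> {}" using U_closed(3) x by (auto simp: coset_image U)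
  ultimately show ?thesis unfolding quot_op1_def by (simp add: SUP_eq_const)
qed

lemma quot_op2_coset:
  assumes x: "x \<in> Y" and y: "y \<in> Y" and f: "\<And>x y. x \<in> Y \<Longrightarrow> y \<in> Y \<Longrightarrow> f (\<pi> x) (\<pi> y) = \<pi> (g x y)"
    and gY: "\<And>x y. x \<in> Y \<Longrightarrow> y \<in> Y \<Longrightarrow> g x y \<in> Y"
    and g: "\<And>u u'. u \<in> U \<Longrightarrow> u' \<in> U \<Longrightarrow> g (x + u) (y + u') - g x y \<in> U"
  shows "quot_op2 M (\<pi> ` U) f (coset M (\<pi> ` U) (\<pi> x)) (coset M (\<pi> ` U) (\<pi> y)) = coset M (\<pi> ` U) (\<pi> (g x y))"
proof -
  have "coset M (\<pi> ` U) (f z z') = coset M (\<pi> ` U) (\<pi> (g x y))"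
    if "z \<in> coset M (\<pi> ` U) (\<pi> x)" "z' \<in> coset M (\<pi> ` U) (\<pi> y)" for z z'
  proof -
    from that obtain u u' where u: "u \<in> U" "z = \<pi> (x + u)" "u' \<in> U" "z' = \<pi> (y + u')"
      using x y by (auto simp: coset_image U)
    then have "x + u \<in> Y" "y + u' \<in> Y" using x y U(3) Y_closed(1) by blast+
    then show ?thesis
      using u f gY x y g by (simp add: coset_eq_iff)
  qed
  moreover have "coset M (\<pi> ` U) (\<pi> x) \<noteq> {}" if "x \<in> Y" for x using U_closed(3) that by (auto simp:
    coset_image U)
  ultimately show ?thesis unfolding quot_op2_def using x y by (simp add: SUP_eq_const)
qed

text \<open>The third isomorphism theorem on representatives: dividing Y / Z by U / Z gives Y / U.
  Every further quotient is thus again presented over the same Y.\<close>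

lemma quot_presentation: "presentation Y U (quot_space M (\<pi> ` U)) (\<lambda>x. coset M (\<pi> ` U) (\<pi> x))"
proof
  show "vzero (quot_space M (\<pi> ` U)) = coset M (\<pi> ` U) (\<pi> 0)"
    by (simp add: quot_space_def coset_image U Y_closed)
  show "vadd (quot_space M (\<pi> ` U)) (coset M (\<pi> ` U) (\<pi> x)) (coset M (\<pi> ` U) (\<pi> y)) = coset M (\<pi> ` U) (\<pi>
    (x + y))"
    if "x \<in> Y" "y \<in> Y" for x y
    unfolding quot_space_def cspace.simps
    by (rule quot_op2_coset[where f = "vadd M" and g = "(+)", OF that add]) (auto simp: Y_closed
      U_closed algebra_simps)
  show "vscale (quot_space M (\<pi> ` U)) c (coset M (\<pi> ` U) (\<pi> x)) = coset M (\<pi> ` U) (\<pi> (c *\<^sub>C x))" if "x \<in>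
    Y" for c x
    unfolding quot_space_def cspace.simps
    by (rule quot_op1_coset[where f = "vscale M c" and g = "\<lambda>x. c *\<^sub>C x", OF that scale]) (auto simp:
      Y_closed U_closed clinear_scale clinear_ident)
qed (use subspace_Y U coset_eq_iff carrier in \<open>auto simp: quot_space_def image_image\<close>)

lemma induced_coset:
  assumes "x \<in> Y" "\<And>u. u \<in> U \<Longrightarrow> g (\<pi> (x + u)) = g (\<pi> x)"
  shows "induced g (coset M (\<pi> ` U) (\<pi> x)) = g (\<pi> x)"
proof -
  have "g ` coset M (\<pi> ` U) (\<pi> x) = {g (\<pi> x)}"
    using assms(2) U_closed(3) by (auto simp: coset_image U(3) assms(1) image_image)
  then show ?thesis by (simp add: induced_def)
qed

end

end

section \<open>Isomorphisms, complexes and cohomology through representatives\<close>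

lemma linear_iso_presentation:
  assumes "presentation Y Z V \<pi>" "presentation Y' Z' W \<pi>'" and K: "clinear K"
    and KY: "\<And>x. x \<in> Y \<Longrightarrow> K x \<in> Y'" and KZ: "\<And>x. x \<in> Y \<Longrightarrow> K x \<in> Z' \<longleftrightarrow> x \<in> Z"
    and surj: "\<And>y. y \<in> Y' \<Longrightarrow> \<exists>x\<in>Y. y - K x \<in> Z'"
    and f: "\<And>x. x \<in> Y \<Longrightarrow> f (\<pi> x) = \<pi>' (K x)"
  shows "linear_iso V W f"
proof -
  interpret V: presentation Y Z V \<pi> by fact
  interpret W: presentation Y' Z' W \<pi>' by fact
  have "linear_map V W f"
    unfolding linear_map_def V.carrier W.carrier
    by (auto simp: f KY V.add V.scale V.Y_closed W.add W.scale clinear_add[OF K] clinear_scaleC[OF K])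
  moreover have "inj_on f (vcarrier V)"
    by (auto simp: inj_on_def V.carrier f KY W.eq_iff V.eq_iff V.Y_closed KZ simp flip: clinear_diff[OF K])
  moreover have "vcarrier W \<subseteq> f ` vcarrier V"
  proof
    fix \<eta> assume "\<eta> \<in> vcarrier W"
    then obtain y where y: "\<eta> = \<pi>' y" "y \<in> Y'" by (auto simp: W.carrier)
    then obtain x where x: "x \<in> Y" "y - K x \<in> Z'" using surj by blast
    then have "\<eta> = f (\<pi> x)" using y W.eq_iff KY by (simp add: f)
    then show "\<eta> \<in> f ` vcarrier V" using x by (auto simp: V.carrier)
  qed
  ultimately show ?thesis
    unfolding linear_iso_def bij_betw_def linear_map_def by blast
qed

text \<open>Grading and differential live on the representatives, so all complexes of the theorem
  share \<open>weil_comp\<close> and \<open>wd\<close> and differ only in \<open>Y\<close>,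
  \<open>Z\<close> and the projection.\<close>

locale complex_presentation = presentation Y Z M \<pi>
  for Y Z :: "'v::complex_vector set" and M :: "('a, 'm) cochain_scheme" and \<pi> :: "'v \<Rightarrow> 'a" +
  fixes E :: "int \<Rightarrow> 'v set" and D :: "'v \<Rightarrow> 'v"
  assumes linear_D: "clinear D" and subspace_E: "complex_vector.subspace (E k)"
    and D_E: "x \<in> E k \<Longrightarrow> D x \<in> E (k + 1)" and D_D: "D (D x) = 0"
    and D_Y: "x \<in> Y \<Longrightarrow> D x \<in> Y" and D_Z: "x \<in> Z \<Longrightarrow> D x \<in> Z"
    and comp: "vcomp M k = \<pi> ` (Y \<inter> E k)" and diff: "x \<in> Y \<Longrightarrow> vdiff M (\<pi> x) = \<pi> (D x)"
begin

lemma quot_complex: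
  assumes U: "complex_vector.subspace U" "Z \<subseteq> U" "U \<subseteq> Y" and DU: "\<And>u. u \<in> U \<Longrightarrow> D u \<in> U"
  shows "complex_presentation Y U (quot_cochain M (\<pi> ` U)) (\<lambda>x. coset M (\<pi> ` U) (\<pi> x)) E D"
proof -
  interpret Q: presentation Y U "quot_space M (\<pi> ` U)" "\<lambda>x. coset M (\<pi> ` U) (\<pi> x)"
    by (rule quot_presentation[OF U])
  show ?thesis
  proof (intro complex_presentation.intro presentation.intro complex_presentation_axioms.intro)
    show "vdiff (quot_cochain M (\<pi> ` U)) (coset M (\<pi> ` U) (\<pi> x)) = coset M (\<pi> ` U) (\<pi> (D x))" if "x \<in> Y" for x
      using quot_op1_coset[OF U that, of "vdiff M" D] diff D_Y linear_D DU
      by (simp add: quot_cochain_def cspace.extend_def cochain.fields_def)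
    show "complex_vector.subspace Y" "complex_vector.subspace U" "clinear D" "complex_vector.subspace (E
      k)" for k
      by (fact subspace_Y U(1) linear_D subspace_E)+
  qed (use U(3) Q.carrier Q.zero Q.add Q.scale Q.eq_iff D_E D_D D_Y DU comp in
      \<open>auto simp: quot_cochain_def cspace.extend_def cochain.fields_def image_image\<close>)
qed

definition cyc :: "int \<Rightarrow> 'v set"
  where "cyc k = {x \<in> Y \<inter> E k. D x \<in> Z}"

text \<open>Representatives of coboundaries. Homogeneity of x is demanded explicitly, since an
  element of \<open>Z\<close> by which x differs from \<open>D y\<close> may have components in
  several degrees.\<close>

definition bnd :: "int \<Rightarrow> 'v set"
  where "bnd k = {x \<in> Y \<inter> E k. \<exists>y\<in>Y \<inter> E (k - 1). x - D y \<in> Z}"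

lemma cocycles_eq: "cocycles M k = \<pi> ` cyc k"
proof -
  have "vdiff M (\<pi> x) = vzero M \<longleftrightarrow> D x \<in> Z" if "x \<in> Y" for x
    using that eq_iff[of "D x" 0] by (simp add: diff zero D_Y Y_closed)
  then show ?thesis by (auto simp: cocycles_def comp cyc_def)
qed

lemma coboundaries_eq: "coboundaries M k = \<pi> ` bnd k"
proof
  show "coboundaries M k \<subseteq> \<pi> ` bnd k"
  proof
    fix X assume "X \<in> coboundaries M k"
    then obtain y where y: "y \<in> Y" "y \<in> E (k - 1)" "X = \<pi> (D y)"
      by (auto simp: coboundaries_def comp diff)
    have "D y \<in> bnd k"
      using y D_Y D_E[OF y(2)] complex_vector.subspace_0[OF subspace_Z] by (auto simp: bnd_def intro!:
        bexI[of _ y])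
    then show "X \<in> \<pi> ` bnd k" using y by blast
  qed
  show "\<pi> ` bnd k \<subseteq> coboundaries M k"
  proof clarify
    fix x assume "x \<in> bnd k"
    then obtain y where "x \<in> Y" "y \<in> Y" "y \<in> E (k - 1)" "x - D y \<in> Z" by (auto simp: bnd_def)
    then have "\<pi> x = vdiff M (\<pi> y)" using eq_iff D_Y by (simp add: diff)
    then show "\<pi> x \<in> coboundaries M k"
      using \<open>y \<in> Y\<close> \<open>y \<in> E (k - 1)\<close> by (auto simp: coboundaries_def comp)
  qed
qed

lemma subspace_cyc: "complex_vector.subspace (cyc k)"
  using subspace_Y subspace_E[of k] subspace_Z
  by (auto simp: complex_vector.subspace_def cyc_def clinear_simps[OF linear_D])

lemma subspace_bnd: "complex_vector.subspace (bnd k)"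
proof -
  have D: "complex_vector.subspace (D ` (Y \<inter> E (k - 1)))"
    by (intro subspace_clinear_image linear_D complex_vector.subspace_inter subspace_Y subspace_E)
  have "bnd k = (Y \<inter> E k) \<inter> {y + z | y z. y \<in> D ` (Y \<inter> E (k - 1)) \<and> z \<in> Z}"
  proof (intro equalityI subsetI)
    fix x assume "x \<in> bnd k"
    then obtain y where y: "x \<in> Y \<inter> E k" "y \<in> Y \<inter> E (k - 1)" "x - D y \<in> Z" by (auto simp: bnd_def)
    moreover have "x = D y + (x - D y)" by simp
    ultimately show "x \<in> (Y \<inter> E k) \<inter> {y + z | y z. y \<in> D ` (Y \<inter> E (k - 1)) \<and> z \<in> Z}" by blast
  next
    fix x assume "x \<in> (Y \<inter> E k) \<inter> {y + z | y z. y \<in> D ` (Y \<inter> E (k - 1)) \<and> z \<in> Z}"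
    then obtain y z where "x \<in> Y \<inter> E k" "y \<in> Y \<inter> E (k - 1)" "z \<in> Z" "x = D y + z" by blast
    then show "x \<in> bnd k" unfolding bnd_def by (auto intro!: bexI[of _ y])
  qed
  then show ?thesis
    using complex_vector.subspace_inter[OF complex_vector.subspace_inter[OF subspace_Y subspace_E[of k]]
        complex_vector.subspace_sums[OF D subspace_Z]] by simp
qed

lemma bnd_subset_cyc: "bnd k \<subseteq> cyc k"
proof
  fix x assume "x \<in> bnd k"
  then obtain y where y: "x \<in> Y" "x \<in> E k" "x - D y \<in> Z" by (auto simp: bnd_def)
  then have "D (x - D y) \<in> Z" using D_Z by blast
  then show "x \<in> cyc k" using y by (simp add: cyc_def clinear_diff[OF linear_D] D_D)
qed

text \<open>\<open>Z\<close> need not lie in one degree, so the kernel of the projection on cocycles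
  is \<open>cyc k \<inter> Z\<close>. It consists of coboundary representatives, with primitive
  0.\<close>

lemma cohomology_presentation:
  "presentation (cyc k) (bnd k) (cohomology M k) (\<lambda>x. cohom_class M k (\<pi> x))"
proof -
  let ?M = "M\<lparr>vcarrier := cocycles M k\<rparr>"
  have sub: "cyc k \<subseteq> Y" by (auto simp: cyc_def)
  interpret C: presentation "cyc k" "cyc k \<inter> Z" ?M \<pi>
  proof
    show "\<pi> x = \<pi> y \<longleftrightarrow> x - y \<in> cyc k \<inter> Z" if "x \<in> cyc k" "y \<in> cyc k" for x y
      using that sub eq_iff[of x y] complex_vector.subspace_diff[OF subspace_cyc that] by blast
  qed (auto simp: cocycles_eq zero add scale subsetD[OF sub] subspace_cyc subspace_Z
    complex_vector.subspace_inter)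
  have "cyc k \<inter> Z \<subseteq> bnd k"
    using Y_closed(4) complex_vector.subspace_0[OF subspace_E]
    by (auto simp: bnd_def cyc_def clinear_0[OF linear_D] intro!: bexI[of _ 0])
  from C.quot_presentation[OF subspace_bnd this bnd_subset_cyc]
  show ?thesis
    unfolding cohomology_def cohom_class_def coboundaries_eq by (simp add: coset_def)
qed


end

text \<open>The product and the cyclic operators of W_n sit in additional record fields, on which a
  presentation does not depend.\<close>

lemma complex_presentation_extend:
  "complex_presentation Y Z M \<pi> E D \<Longrightarrow> complex_presentation Y Z (cochain.extend M m) \<pi> E D"
  unfolding complex_presentation_def presentation_def complex_presentation_axioms_def
  by (simp add: cochain.extend_def)

lemma (in complex_presentation) induced_cohom_class:
  assumes "x \<in> Y" "\<And>u. u \<in> bnd k \<Longrightarrow> g (\<pi> (x + u)) = g (\<pi> x)"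
  shows "induced g (cohom_class M k (\<pi> x)) = g (\<pi> x)"
proof -
  have "bnd k \<subseteq> Y" by (auto simp: bnd_def)
  then have "g ` cohom_class M k (\<pi> x) = {g (\<pi> x)}"
    using assms complex_vector.subspace_0[OF subspace_bnd[of k]]
    by (auto simp: cohom_class_def coboundaries_eq coset_image image_image)
  then show ?thesis by (simp add: induced_def)
qed

lemma vspan_zero: "vzero M \<in> vspan M X"
  and vspan_add: "x \<in> vspan M X \<Longrightarrow> y \<in> vspan M X \<Longrightarrow> vadd M x y \<in> vspan M X"
  and vspan_scale: "x \<in> vspan M X \<Longrightarrow> vscale M c x \<in> vspan M X"
  and vspan_base: "x \<in> X \<Longrightarrow> x \<in> vspan M X"
  by (auto simp: vspan_def hull_def)


section \<open>The S-operator on a presented quotient\<close>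

context coalgebra
begin

lemma cyc_stable_subspace: "cyc_stable Y \<Longrightarrow> complex_vector.subspace Y"
  and cyc_stable_subset: "cyc_stable Y \<Longrightarrow> x \<in> Y \<Longrightarrow> x \<in> weil"
  and cyc_stable_ops: "cyc_stable Y \<Longrightarrow> x \<in> Y \<Longrightarrow> wd x \<in> Y" "cyc_stable Y \<Longrightarrow> x \<in> Y \<Longrightarrow> cyc_b \<Delta> x \<in> Y"
    "cyc_stable Y \<Longrightarrow> x \<in> Y \<Longrightarrow> cyc_t x \<in> Y" "cyc_stable Y \<Longrightarrow> x \<in> Y \<Longrightarrow> cyc_N x \<in> Y"
    "cyc_stable Y \<Longrightarrow> x \<in> Y \<Longrightarrow> cyc_P x \<in> Y" "cyc_stable Y \<Longrightarrow> x \<in> Y \<Longrightarrow> cyc_Q x \<in> Y"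
  unfolding cyc_stable_def by auto

text \<open>\<open>C\<close> stands for the commutators of Y / Z, pulled back to Y. It is a
  subcomplex because N \<partial> = b N and b preserves Z.\<close>

lemma cyc_stable_kernel:
  assumes Y: "cyc_stable Y" and Z: "cyc_stable Z" and "Z \<subseteq> Y"
  defines "C \<equiv> {x \<in> Y. cyc_N x \<in> Z}"
  shows "complex_vector.subspace C" "Z \<subseteq> C" "C \<subseteq> Y" "x \<in> C \<Longrightarrow> wd x \<in> C"
proof -
  show "complex_vector.subspace C"
    using cyc_stable_subspace[OF Y] cyc_stable_subspace[OF Z]
    by (auto simp: C_def complex_vector.subspace_def clinear_simps[OF clinear_cyc_N])
  show "x \<in> C \<Longrightarrow> wd x \<in> C"
    using cyc_stable_ops(1)[OF Y] cyc_stable_ops(2)[OF Z] by (simp add: C_def flip: cyc_b_cyc_N)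
qed (use assms(3) cyc_stable_ops(4)[OF Z] in \<open>auto simp: C_def\<close>)

text \<open>Any admissible triple computes S. The triple itself is the witness for existence; for
  uniqueness, the difference of two triples satisfies the same linear relations, so
  \<open>S_relation_zero\<close> applies.\<close>

lemma S_op_class:
  fixes M :: "('a, 'm) cyclic_algebra_scheme"
  assumes pres: "complex_presentation Y Z M \<pi> weil_comp wd"
    and Y: "cyc_stable Y" and Z: "cyc_stable Z"
    and op_t: "\<And>x. x \<in> Y \<Longrightarrow> op_t M (\<pi> x) = \<pi> (cyc_t x)"
    and op_b: "\<And>x. x \<in> Y \<Longrightarrow> op_b M (\<pi> x) = \<pi> (cyc_b \<Delta> x)"
    and op_N: "\<And>x. x \<in> Y \<Longrightarrow> op_N M (\<pi> x) = \<pi> (cyc_N x)"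
    and C: "C = {x \<in> Y. cyc_N x \<in> Z}"
    and u: "u \<in> Y" "u \<in> weil_comp k" and v: "v \<in> Y" "v \<in> weil_comp (k + 1)"
    and w: "w \<in> Y" "w \<in> weil_comp (k + 2)"
    and uv: "wd u - (cyc_t v - v) \<in> Z" and vw: "cyc_b \<Delta> v - cyc_N w \<in> Z"
  shows "S_op M (\<pi> ` C) k (cohom_class (quot_cochain M (\<pi> ` C)) k (coset M (\<pi> ` C) (\<pi> u))) =
    cohom_class (quot_cochain M (\<pi> ` C)) (k + 2) (coset M (\<pi> ` C) (\<pi> w))"
proof -
  interpret P: complex_presentation Y Z M \<pi> weil_comp wd by fact
  note ker = cyc_stable_kernel[OF Y Z P.Z_subset, folded C]
  interpret Q: complex_presentation Y C "quot_cochain M (\<pi> ` C)" "\<lambda>x. coset M (\<pi> ` C) (\<pi> x)" weil_comp wd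
    by (rule P.quot_complex[OF ker])
  interpret H: presentation "Q.cyc j" "Q.bnd j" "cohomology (quot_cochain M (\<pi> ` C)) j"
      "\<lambda>x. cohom_class (quot_cochain M (\<pi> ` C)) j (coset M (\<pi> ` C) (\<pi> x))" for j
    by (rule Q.cohomology_presentation)
  note sZ = cyc_stable_subspace[OF Z]
  have memC: "x \<in> C \<longleftrightarrow> x \<in> Y \<and> cyc_N x \<in> Z" for x by (simp add: C)
  have rel1: "vdiff M (\<pi> u) = vadd M (op_t M (\<pi> v)) (vscale M (- 1) (\<pi> v)) \<longleftrightarrow> wd u - (cyc_t v - v) \<in> Z"
    if "u \<in> Y" "v \<in> Y" for u v
    using that cyc_stable_ops(1,3)[OF Y] P.Y_closed P.scale[of v "-1"] P.add[of "cyc_t v" "- v"]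
      complex_vector.subspace_neg[OF P.subspace_Y that(2)]
    by (simp add: P.diff op_t P.eq_iff)
  have rel2: "op_b M (\<pi> v) = op_N M (\<pi> w) \<longleftrightarrow> cyc_b \<Delta> v - cyc_N w \<in> Z" if "v \<in> Y" "w \<in> Y" for v w
    using that cyc_stable_ops(2,4)[OF Y] by (simp add: op_b op_N P.eq_iff)
  \<comment> \<open>Solvability of the first relation already makes u a cocycle, as N kills the
    image of t - 1.\<close>
  have ucyc: "u \<in> Q.cyc k" if "u \<in> Y" "u \<in> weil_comp k" "v \<in> Y" "wd u - (cyc_t v - v) \<in> Z" for u v
  proof -
    have "cyc_N (wd u) = cyc_N (wd u - (cyc_t v - v))"
      by (simp add: clinear_simps[OF clinear_cyc_N])
    then show ?thesis
      using that cyc_stable_ops(1)[OF Y] cyc_stable_ops(4)[OF Z that(4)] by (simp add: Q.cyc_def memC)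
  qed
  \<comment> \<open>Likewise w is a cocycle: N \<partial> w = b N w, which agrees with b b v = 0
    modulo Z.\<close>
  have wcyc: "w \<in> Q.cyc (k + 2)" if "w \<in> Y" "w \<in> weil_comp (k + 2)" "v \<in> Y" "cyc_b \<Delta> v - cyc_N w \<in> Z" for v w
  proof -
    have "cyc_N (wd w) = cyc_b \<Delta> (- (cyc_b \<Delta> v - cyc_N w))"
      by (simp add: clinear_simps[OF clinear_cyc_b] cyc_b_cyc_b cyc_b_cyc_N)
    also have "\<dots> \<in> Z" using that(4) complex_vector.subspace_neg[OF sZ] cyc_stable_ops(2)[OF Z] by blast
    finally show ?thesis
      using that cyc_stable_ops(1)[OF Y] by (simp add: Q.cyc_def memC)
  qed
  let ?cls = "\<lambda>j X. cohom_class (quot_cochain M (\<pi> ` C)) j (coset M (\<pi> ` C) X)"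
  show ?thesis
    unfolding S_op_def
  proof (rule the_equality)
    show "\<exists>u'\<in>vcomp M k. \<exists>v\<in>vcomp M (k + 1). \<exists>w'\<in>vcomp M (k + 2).
       ?cls k (\<pi> u) = ?cls k u' \<and>
       vdiff M u' = vadd M (op_t M v) (vscale M (- 1) v) \<and> op_b M v = op_N M w' \<and>
       ?cls (k + 2) (\<pi> w) = ?cls (k + 2) w'"
      unfolding P.comp
      by (intro bexI[of _ "\<pi> u"] bexI[of _ "\<pi> v"] bexI[of _ "\<pi> w"])
        (use u v w uv vw rel1 rel2 in auto)
  next
    fix \<eta>
    assume "\<exists>u'\<in>vcomp M k. \<exists>v\<in>vcomp M (k + 1). \<exists>w'\<in>vcomp M (k + 2).
       ?cls k (\<pi> u) = ?cls k u' \<and>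
       vdiff M u' = vadd M (op_t M v) (vscale M (- 1) v) \<and> op_b M v = op_N M w' \<and>
       \<eta> = ?cls (k + 2) w'"
    then obtain u' v' w' where u': "u' \<in> Y" "u' \<in> weil_comp k" and v': "v' \<in> Y" "v' \<in> weil_comp (k + 1)"
      and w': "w' \<in> Y" "w' \<in> weil_comp (k + 2)"
      and eq: "?cls k (\<pi> u) = ?cls k (\<pi> u')"
      and rels: "vdiff M (\<pi> u') = vadd M (op_t M (\<pi> v')) (vscale M (- 1) (\<pi> v'))" "op_b M (\<pi> v') = op_N
        M (\<pi> w')"
      and \<eta>: "\<eta> = ?cls (k + 2) (\<pi> w')"
      unfolding P.comp by blast
    have uv': "wd u' - (cyc_t v' - v') \<in> Z" using rels(1) rel1 u' v' by blast
    have vw': "cyc_b \<Delta> v' - cyc_N w' \<in> Z" using rels(2) rel2 v' w' by blast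
    have "u - u' \<in> Q.bnd k" using eq H.eq_iff ucyc[OF u v(1) uv] ucyc[OF u' v'(1) uv'] by blast
    then obtain a where a: "a \<in> Y" "a \<in> weil_comp (k - 1)" and c: "cyc_N (u - u' - wd a) \<in> Z"
      by (auto simp: Q.bnd_def memC)
    have 1: "wd (u - u') - (cyc_t (v - v') - (v - v')) \<in> Z"
      using complex_vector.subspace_diff[OF sZ uv uv']
      by (simp add: clinear_diff[OF clinear_wd] clinear_diff[OF clinear_cyc_t] algebra_simps)
    have 2: "cyc_b \<Delta> (v - v') - cyc_N (w - w') \<in> Z"
      using complex_vector.subspace_diff[OF sZ vw vw']
      by (simp add: clinear_diff[OF clinear_cyc_b] clinear_diff[OF clinear_cyc_N] algebra_simps)
    obtain f where f: "f \<in> Y" "f \<in> weil_comp (k + 1)" "cyc_N (w - w' - wd f) \<in> Z"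
      using S_relation_zero[OF Y Z P.Z_subset _ _ _ _ _ 1 2 a c] u u' v v' w w'
      by (auto simp: P.Y_closed weil_comp_subspace)
    have "f \<in> weil_comp (1 + k)" using f(2) by (simp add: add.commute)
    then have "w - w' \<in> Q.bnd (k + 2)"
      using f w w' cyc_stable_ops(1)[OF Y f(1)]
      by (auto simp: Q.bnd_def memC P.Y_closed weil_comp_subspace intro!: bexI[of _ f])
    then show "\<eta> = ?cls (k + 2) (\<pi> w)"
      using H.eq_iff[OF wcyc[OF w v(1) vw] wcyc[OF w' v'(1) vw']] unfolding \<eta> by simp
  qed
qed

section \<open>The complexes of the theorem\<close>

lemma subspace_weil_comp: "complex_vector.subspace (weil_comp k)"
  unfolding weil_comp_eq by (rule subspace_word_span)

lemma sub_algebra_presentation: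
  assumes "cyc_stable Y"
  shows "complex_presentation Y {0} (sub_algebra (weil1_alg \<Delta>) Y) (\<lambda>x. x) weil_comp wd"
  by (intro complex_presentation.intro presentation.intro complex_presentation_axioms.intro)
    (auto simp: sub_algebra_def weil1_alg_def cyc_stable_subspace[OF assms] clinear_wd clinear_0[OF
      clinear_wd]
      subspace_weil_comp wd_weil_comp cyc_stable_ops[OF assms] complex_vector.subspace_0[OF
        cyc_stable_subspace[OF assms]])

lemma I_alg_presentation:
  "complex_presentation (curv_power (Suc n)) {0} (I_alg \<Delta> n) (\<lambda>x. x) weil_comp wd"
  unfolding I_alg_def Suc_eq_plus1[symmetric] by (rule sub_algebra_presentation[OF cyc_stable_curv_power])

lemma weil_alg_presentation: "complex_presentation weil {0} (weil_alg \<Delta>) (\<lambda>x. x) weil_comp wd"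
  unfolding weil_alg_def by (rule sub_algebra_presentation[OF cyc_stable_weil])

lemma curv_power_quot:
  "complex_vector.subspace (curv_power (Suc n) :: 'h weil1 set)" "{0} \<subseteq> (curv_power (Suc n) :: 'h weil1 set)"
  "(curv_power (Suc n) :: 'h weil1 set) \<subseteq> weil"
  "x \<in> curv_power (Suc n) \<Longrightarrow> wd x \<in> curv_power (Suc n)"
  using cyc_stable_curv_power[of n, THEN cyc_stable_subspace] cyc_stable_subset[OF
    cyc_stable_curv_power[of n]]
    cyc_stable_ops(1)[OF cyc_stable_curv_power[of n]] complex_vector.subspace_0[of "curv_power (Suc n)
      :: 'h weil1 set"]
  by auto

definition W_pi :: "nat \<Rightarrow> 'h weil1 \<Rightarrow> 'h weil1 set"
  where "W_pi n = coset (weil_alg \<Delta>) (curv_power (Suc n))"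

lemma W_alg_presentation:
  "complex_presentation weil (curv_power (Suc n)) (W_alg \<Delta> n) (W_pi n) weil_comp wd"
proof -
  interpret complex_presentation weil "{0}" "weil_alg \<Delta>" "\<lambda>x. x" weil_comp wd
    by (rule weil_alg_presentation)
  show ?thesis
    using quot_complex[OF curv_power_quot(1,2,3)[of n]] curv_power_quot(4)[of _ n]
    unfolding W_alg_def quot_algebra_def image_ident W_pi_def Suc_eq_plus1[symmetric]
    by (intro complex_presentation_extend) blast
qed

lemma W_alg_ops:
  assumes "x \<in> weil"
  shows "op_t (W_alg \<Delta> n) (W_pi n x) = W_pi n (cyc_t x)"
    and "op_b (W_alg \<Delta> n) (W_pi n x) = W_pi n (cyc_b \<Delta> x)"
    and "op_N (W_alg \<Delta> n) (W_pi n x) = W_pi n (cyc_N x)"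
proof -
  interpret complex_presentation weil "{0}" "weil_alg \<Delta>" "\<lambda>x. x" weil_comp wd
    by (rule weil_alg_presentation)
  have ops: "op_t (weil_alg \<Delta>) = cyc_t" "op_b (weil_alg \<Delta>) = cyc_b \<Delta>" "op_N (weil_alg \<Delta>) = cyc_N"
    by (simp_all add: weil_alg_def sub_algebra_def weil1_alg_def)
  note q = quot_op1_coset[OF curv_power_quot(1,2,3)[of n] assms, unfolded image_ident, folded W_pi_def]
  show "op_t (W_alg \<Delta> n) (W_pi n x) = W_pi n (cyc_t x)"
    using q[of cyc_t cyc_t] cyc_stable_ops(3)[OF cyc_stable_weil] cyc_stable_ops(3)[OF
      cyc_stable_curv_power[of n]] clinear_cyc_t
    by (simp add: W_alg_def quot_algebra_def cochain.extend_def cyclic_algebra.fields_def ops)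
  show "op_b (W_alg \<Delta> n) (W_pi n x) = W_pi n (cyc_b \<Delta> x)"
    using q[of "cyc_b \<Delta>" "cyc_b \<Delta>"] cyc_stable_ops(2)[OF cyc_stable_weil] cyc_stable_ops(2)[OF
      cyc_stable_curv_power[of n]] clinear_cyc_b
    by (simp add: W_alg_def quot_algebra_def cochain.extend_def cyclic_algebra.fields_def ops)
  show "op_N (W_alg \<Delta> n) (W_pi n x) = W_pi n (cyc_N x)"
    using q[of cyc_N cyc_N] cyc_stable_ops(4)[OF cyc_stable_weil] cyc_stable_ops(4)[OF
      cyc_stable_curv_power[of n]] clinear_cyc_N
    by (simp add: W_alg_def quot_algebra_def cochain.extend_def cyclic_algebra.fields_def ops)
qed

lemma weil_mult: "x \<in> weil \<Longrightarrow> y \<in> weil \<Longrightarrow> x * y \<in> weil"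
  unfolding weil_eq by (erule word_span_mult) auto

lemma W_alg_mult:
  assumes "x \<in> weil" "y \<in> weil"
  shows "vmult (W_alg \<Delta> n) (W_pi n x) (W_pi n y) = W_pi n (x * y)"
proof -
  interpret complex_presentation weil "{0}" "weil_alg \<Delta>" "\<lambda>x. x" weil_comp wd
    by (rule weil_alg_presentation)
  have ideal: "u * z \<in> curv_power (Suc n)" "z * u \<in> curv_power (Suc n)" if "u \<in> curv_power (Suc n)" for
    u z :: "'h weil1"
    using that unfolding curv_power_eq
    by (auto elim!: word_span_mult[OF _ word_span_True] word_span_mult[OF word_span_True])
  have "(x + u) * (y + u') - x * y \<in> curv_power (Suc n)" if "u \<in> curv_power (Suc n)" "u' \<in> curv_power
    (Suc n)" for u u'
  proof -
    have "(x + u) * (y + u') - x * y = u * (y + u') + x * u'" by (simp add: algebra_simps)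
    then show ?thesis
      using ideal(1)[OF that(1)] ideal(2)[OF that(2)] complex_vector.subspace_add[OF
        curv_power_quot(1)[of n]] by metis
  qed
  then have "quot_op2 (weil_alg \<Delta>) (curv_power (Suc n)) (*) (W_pi n x) (W_pi n y) = W_pi n (x * y)"
    using quot_op2_coset[OF curv_power_quot(1,2,3)[of n] assms, unfolded image_ident, folded W_pi_def,
      where f = "(*)" and g = "(*)"] weil_mult by blast
  then show ?thesis
    by (simp add: W_alg_def quot_algebra_def cochain.extend_def cyclic_algebra.fields_def
        weil_alg_def sub_algebra_def weil1_alg_def)
qed

text \<open>The commutators of W_n pulled back to W, as \<open>W_comm_eq\<close> shows. The form by
  N makes membership a linear condition that can be tested directly.\<close>

definition W_ker :: "nat \<Rightarrow> 'h weil1 set"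
  where "W_ker n = {x \<in> weil. cyc_N x \<in> curv_power (Suc n)}"

lemmas W_ker_props = cyc_stable_kernel[OF cyc_stable_weil cyc_stable_curv_power curv_power_quot(3),
  folded W_ker_def]

text \<open>N kills commutators even before the ideal is divided out. Conversely x differs from (t -
  1) Q x by P N x, which lies in the ideal, and on a word (t - 1) is minus the commutator of its
  first generator with the rest.\<close>

lemma W_comm_eq: "W_comm \<Delta> n = W_pi n ` W_ker n"
proof -
  interpret complex_presentation weil "curv_power (Suc n)" "W_alg \<Delta> n" "W_pi n" weil_comp wd
    by (rule W_alg_presentation)
  let ?G = "{vadd (W_alg \<Delta> n) (vmult (W_alg \<Delta> n) x y) (vscale (W_alg \<Delta> n) (- ksign (j * k)) (vmult
    (W_alg \<Delta> n) y x)) | x y j k.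
      x \<in> vcarrier (W_alg \<Delta> n) \<inter> vcomp (W_alg \<Delta> n) j \<and> y \<in> vcarrier (W_alg \<Delta> n) \<inter> vcomp (W_alg \<Delta> n) k}"
  let ?V = "vspan (W_alg \<Delta> n) ?G"
  have gen: "vadd (W_alg \<Delta> n) (vmult (W_alg \<Delta> n) (W_pi n x) (W_pi n y)) (vscale (W_alg \<Delta> n) (- c) (vmult
    (W_alg \<Delta> n) (W_pi n y) (W_pi n x)))
      = W_pi n (x * y - c *\<^sub>C (y * x))" if "x \<in> weil" "y \<in> weil" for x y c
    unfolding W_alg_mult[OF that] W_alg_mult[OF that(2,1)] scale[OF weil_mult[OF that(2,1)]]
      add[OF weil_mult[OF that] Y_closed(3)[OF weil_mult[OF that(2,1)]]]
    by simp
  have "?V \<subseteq> W_pi n ` W_ker n"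
    unfolding vspan_def
  proof (rule hull_minimal)
    show "?G \<subseteq> W_pi n ` W_ker n"
    proof clarify
      fix X Y' j k
      assume "X \<in> vcomp (W_alg \<Delta> n) j" "Y' \<in> vcomp (W_alg \<Delta> n) k"
      then obtain x y where x: "x \<in> weil" "x \<in> weil_comp j" "X = W_pi n x" and y: "y \<in> weil" "y \<in>
        weil_comp k" "Y' = W_pi n y"
        unfolding comp by blast
      have "cyc_N (x * y - ksign (j * k) *\<^sub>C (y * x)) = 0"
        using cyc_N_mult_commute[OF x(2) y(2)] by (simp add: clinear_simps[OF clinear_cyc_N])
      moreover have "x * y - ksign (j * k) *\<^sub>C (y * x) \<in> weil"
        by (intro Y_closed weil_mult x(1) y(1))
      ultimately have "x * y - ksign (j * k) *\<^sub>C (y * x) \<in> W_ker n"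
        unfolding W_ker_def using curv_power_quot(2)[of n] by simp
      then show "vadd (W_alg \<Delta> n) (vmult (W_alg \<Delta> n) X Y') (vscale (W_alg \<Delta> n) (- ksign (j * k)) (vmult
        (W_alg \<Delta> n) Y' X))
        \<in> W_pi n ` W_ker n"
        unfolding x(3) y(3) gen[OF x(1) y(1)] by blast
    qed
    have "W_ker n \<subseteq> weil" by (auto simp: W_ker_def)
    then show "vzero (W_alg \<Delta> n) \<in> W_pi n ` W_ker n \<and>
      (\<forall>x\<in>W_pi n ` W_ker n. \<forall>y\<in>W_pi n ` W_ker n. vadd (W_alg \<Delta> n) x y \<in> W_pi n ` W_ker n) \<and>
      (\<forall>c. \<forall>x\<in>W_pi n ` W_ker n. vscale (W_alg \<Delta> n) c x \<in> W_pi n ` W_ker n)"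
      using complex_vector.subspace_0[OF W_ker_props(1)[of n]] complex_vector.subspace_add[OF
        W_ker_props(1)[of n]]
        complex_vector.subspace_scale[OF W_ker_props(1)[of n]]
      by (auto simp: zero add scale subset_iff)
  qed
  moreover have "W_pi n ` W_ker n \<subseteq> ?V"
  proof clarify
    fix x assume "x \<in> W_ker n"
    then have x: "x \<in> weil" "cyc_N x \<in> curv_power (Suc n)" by (auto simp: W_ker_def)
    let ?S = "{z \<in> weil. W_pi n (cyc_t z - z) \<in> ?V}"
    have t: "cyc_t z - z \<in> weil" if "z \<in> weil" for z :: "'h weil1"
      by (intro Y_closed(2) cyc_stable_ops(3)[OF cyc_stable_weil] that)
    have "complex_vector.span {monomial as | as. as \<noteq> []} \<subseteq> ?S"
    proof (rule complex_vector.span_minimal)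
      show "{monomial as | as. as \<noteq> []} \<subseteq> ?S"
      proof clarify
        fix as :: "'h wgen list" assume "as \<noteq> []"
        then obtain a bs where as: "as = a # bs" by (cases as) auto
        have m: "monomial cs \<in> weil" if "cs \<noteq> []" for cs :: "'h wgen list"
          unfolding weil_eq using that by (rule word_span_base)
        have "W_pi n (cyc_t (monomial as) - monomial as) \<in> ?V"
        proof (cases "bs = []")
          \<comment> \<open>The rest of a word with one letter is the unit, which does not belong to
            W_n; here t fixes the word, so there is nothing to write as a commutator.\<close>
          case True
          then have "cyc_t (monomial as) - monomial as = 0"
            using cyc_t_Cons[of a "[]"] by (simp add: as)
          then show ?thesis
            using vspan_zero[of "W_alg \<Delta> n" ?G] unfolding zero by simp
        next
          case False
          have ab: "gval a \<in> weil" "monomial bs \<in> weil" using m[of "[a]"] m[OF False] by simp_all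
          let ?x = "W_pi n (gval a)" and ?y = "W_pi n (monomial bs)"
            and ?g = "gval a * monomial bs - ksign (gdeg a * mdeg bs) *\<^sub>C (monomial bs * gval a)"
          have "?x \<in> vcarrier (W_alg \<Delta> n) \<inter> vcomp (W_alg \<Delta> n) (gdeg a)"
            unfolding carrier comp using ab gval_in_weil_comp[of a] by auto
          moreover have "?y \<in> vcarrier (W_alg \<Delta> n) \<inter> vcomp (W_alg \<Delta> n) (mdeg bs)"
            unfolding carrier comp using ab monomial_in_weil_comp[of bs] by auto
          ultimately have "W_pi n ?g \<in> ?G"
            unfolding gen[OF ab, symmetric]
            by (intro CollectI exI[of _ ?x] exI[of _ ?y] exI[of _ "gdeg a"] exI[of _ "mdeg bs"] conjI refl)
          then have V: "vscale (W_alg \<Delta> n) (- 1) (W_pi n ?g) \<in> ?V"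
            by (intro vspan_scale vspan_base)
          have g: "?g \<in> weil" by (intro Y_closed weil_mult ab)
          have "- 1 *\<^sub>C ?g = cyc_t (monomial as) - monomial as"
            by (simp add: as cyc_t_Cons)
          then show ?thesis using V unfolding scale[OF g] by (simp only:)
        qed
        then show "monomial as \<in> weil \<and> W_pi n (cyc_t (monomial as) - monomial as) \<in> ?V"
          using m[OF \<open>as \<noteq> []\<close>] by blast
      qed
      show "complex_vector.subspace ?S"
      proof (rule complex_vector.subspaceI)
        show "0 \<in> ?S"
          using vspan_zero[of "W_alg \<Delta> n"] by (simp add: Y_closed clinear_0[OF clinear_cyc_t] zero)
      next
        fix y z assume yz: "y \<in> ?S" "z \<in> ?S"
        then have w: "y \<in> weil" "z \<in> weil" by blast+
        have "vadd (W_alg \<Delta> n) (W_pi n (cyc_t y - y)) (W_pi n (cyc_t z - z)) \<in> ?V"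
          using yz by (intro vspan_add) blast+
        moreover have "(cyc_t y - y) + (cyc_t z - z) = cyc_t (y + z) - (y + z)"
          by (simp add: clinear_add[OF clinear_cyc_t])
        ultimately have "W_pi n (cyc_t (y + z) - (y + z)) \<in> ?V"
          unfolding add[OF t[OF w(1)] t[OF w(2)]] by (simp only:)
        then show "y + z \<in> ?S" using Y_closed(1)[OF w] by blast
      next
        fix c z assume z: "z \<in> ?S"
        then have w: "z \<in> weil" by blast
        have "vscale (W_alg \<Delta> n) c (W_pi n (cyc_t z - z)) \<in> ?V"
          using z by (intro vspan_scale) blast
        moreover have "c *\<^sub>C (cyc_t z - z) = cyc_t (c *\<^sub>C z) - c *\<^sub>C z"
          by (simp add: clinear_scaleC[OF clinear_cyc_t] complex_vector.scale_right_diff_distrib)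
        ultimately have "W_pi n (cyc_t (c *\<^sub>C z) - c *\<^sub>C z) \<in> ?V"
          unfolding scale[OF t[OF w]] by (simp only:)
        then show "c *\<^sub>C z \<in> ?S" using Y_closed(3)[OF w] by blast
      qed
    qed
    then have "weil \<subseteq> ?S" by (simp only: weil_def[symmetric])
    moreover have q: "cyc_Q x \<in> weil" using x(1) by (rule cyc_stable_ops(6)[OF cyc_stable_weil])
    ultimately have "W_pi n (cyc_t (cyc_Q x) - cyc_Q x) \<in> ?V" by blast
    moreover have "W_pi n x = W_pi n (cyc_t (cyc_Q x) - cyc_Q x)"
    proof -
      have "x - (cyc_t (cyc_Q x) - cyc_Q x) = cyc_P (cyc_N x)"
        using cyc_decomposition[OF x(1)] by (simp add: cyc_N_cyc_P algebra_simps)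
      then show ?thesis
        using eq_iff[OF x(1) t[OF q]] cyc_stable_ops(5)[OF cyc_stable_curv_power x(2)] by simp
    qed
    ultimately show "W_pi n x \<in> ?V" by simp
  qed
  ultimately show ?thesis
    unfolding W_comm_def gr_commutators_def by (rule subset_antisym)
qed

lemma I_comm_props: "complex_vector.subspace (I_comm \<Delta> n)" "{0} \<subseteq> I_comm \<Delta> n" "I_comm \<Delta> n \<subseteq> curv_power
  (Suc n)"
  "x \<in> I_comm \<Delta> n \<Longrightarrow> wd x \<in> I_comm \<Delta> n"
  using cyc_stable_kernel[OF cyc_stable_curv_power[of n] cyc_stable_zero curv_power_quot(2)] by
    (simp_all add: I_comm_eq)

lemma I_nat_presentation:
  "complex_presentation (curv_power (Suc n)) (I_comm \<Delta> n) (I_nat \<Delta> n) (I_proj \<Delta> n) weil_comp wd"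
proof -
  interpret complex_presentation "curv_power (Suc n)" "{0}" "I_alg \<Delta> n" "\<lambda>x. x" weil_comp wd
    by (rule I_alg_presentation)
  show ?thesis
    using quot_complex[OF I_comm_props(1,2,3)[of n]] I_comm_props(4)[of _ n]
    unfolding I_nat_def I_proj_def[abs_def] image_ident by blast
qed

lemma W_nat_presentation:
  "complex_presentation weil (W_ker n) (W_nat \<Delta> n) (W_proj \<Delta> n) weil_comp wd"
proof -
  interpret complex_presentation weil "curv_power (Suc n)" "W_alg \<Delta> n" "W_pi n" weil_comp wd
    by (rule W_alg_presentation)
  show ?thesis
    using quot_complex[OF W_ker_props(1,2,3)[of n]] W_ker_props(4)[of _ n]
    unfolding W_nat_def W_proj_def[abs_def] W_comm_eq Suc_eq_plus1[symmetric] W_pi_def[symmetric] by blast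
qed

section \<open>The Chern-Simons map on complexes and on cohomology\<close>

context
  fixes n :: nat
begin

interpretation I: complex_presentation "curv_power (Suc n)" "I_comm \<Delta> n" "I_nat \<Delta> n" "I_proj \<Delta> n" weil_comp wd
  by (rule I_nat_presentation)

interpretation W: complex_presentation weil "W_ker n" "W_nat \<Delta> n" "W_proj \<Delta> n" weil_comp wd
  by (rule W_nat_presentation)

interpretation HI: presentation "I.cyc k" "I.bnd k" "cohomology (I_nat \<Delta> n) k"
    "\<lambda>x. cohom_class (I_nat \<Delta> n) k (I_proj \<Delta> n x)" for k
  by (rule I.cohomology_presentation)

interpretation HW: presentation "W.cyc k" "W.bnd k" "cohomology (W_nat \<Delta> n) k"
    "\<lambda>x. cohom_class (W_nat \<Delta> n) k (W_proj \<Delta> n x)" for k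
  by (rule W.cohomology_presentation)

abbreviation K where "K \<equiv> cs_contraction \<Delta>"

lemma I_weil: "x \<in> curv_power (Suc n) \<Longrightarrow> x \<in> weil" for x :: "'h weil1"
  using curv_power_quot(3) by blast

lemma W_ker_iff: "x \<in> W_ker n \<longleftrightarrow> x \<in> weil \<and> cyc_N x \<in> curv_power (Suc n)"
  by (simp add: W_ker_def)

lemma I_comm_iff: "x \<in> I_comm \<Delta> n \<longleftrightarrow> x \<in> curv_power (Suc n) \<and> cyc_N x = 0"
  by (simp add: I_comm_eq)

lemma W_kerI: "x \<in> weil \<Longrightarrow> cyc_N x = 0 \<Longrightarrow> x \<in> W_ker n"
  using curv_power_quot(2)[of n] by (simp add: W_ker_iff)

lemma I_ops: "x \<in> curv_power (Suc n) \<Longrightarrow> cyc_N x \<in> curv_power (Suc n)"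
  "x \<in> curv_power (Suc n) \<Longrightarrow> cyc_P x \<in> curv_power (Suc n)"
  "x \<in> curv_power (Suc n) \<Longrightarrow> cyc_Q x \<in> curv_power (Suc n)"
  "x \<in> curv_power (Suc n) \<Longrightarrow> cyc_b \<Delta> x \<in> curv_power (Suc n)"
  "x \<in> curv_power (Suc n) \<Longrightarrow> cyc_t x \<in> curv_power (Suc n)" for x :: "'h weil1"
  by (erule cyc_stable_ops[OF cyc_stable_curv_power])+

lemma I_subset_W_ker: "x \<in> curv_power (Suc n) \<Longrightarrow> x \<in> W_ker n"
  using I_weil I_ops(1) by (simp add: W_ker_iff)

lemma cs_I_comm: "c \<in> I_comm \<Delta> n \<Longrightarrow> K c \<in> W_ker n"
  using I_weil by (intro W_kerI cs_contraction_weil cyc_N_cs_contraction) (auto simp: I_comm_iff)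

lemma cs_wd: "x \<in> weil \<Longrightarrow> wd (K x) = x - K (wd x)"
  using cs_homotopy[of x] by (metis add_diff_cancel_right')

lemma CS_proj: "x \<in> curv_power (Suc n) \<Longrightarrow> CS \<Delta> n (I_proj \<Delta> n x) = W_proj \<Delta> n (K x)"
proof -
  assume x: "x \<in> curv_power (Suc n)"
  interpret A: complex_presentation "curv_power (Suc n)" "{0}" "I_alg \<Delta> n" "\<lambda>x. x" weil_comp wd
    by (rule I_alg_presentation)
  have "W_proj \<Delta> n (K (x + u)) = W_proj \<Delta> n (K x)" if "u \<in> I_comm \<Delta> n" for u
  proof -
    have "x + u \<in> curv_power (Suc n)" using x that I.Z_subset I.Y_closed(1) by blast
    then have "K (x + u) \<in> weil" "K x \<in> weil" using x I_weil cs_contraction_weil by blast+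
    then show ?thesis
      using cs_I_comm[OF that] by (simp add: W.eq_iff clinear_add[OF clinear_cs_contraction])
  qed
  then show ?thesis
    unfolding CS_def I_proj_def
    by (rule A.induced_coset[where g = "\<lambda>x. W_proj \<Delta> n (K x)", OF I_comm_props(1,2,3) x, unfolded
      image_ident])
qed

text \<open>The homotopy formula says that K \<partial> x and -\<partial> K x differ by x, and x
  lies in the ideal that is divided out in the target. The minus sign is the one in the shifted
  differential.\<close>

lemma CS_cochain_map: "cochain_map (I_nat \<Delta> n) (shift (W_nat \<Delta> n)) (CS \<Delta> n)"
proof -
  have Kweil: "K x \<in> weil" if "x \<in> curv_power (Suc n)" for x
    using that I_weil cs_contraction_weil by blast
  have sh: "vcarrier (shift (W_nat \<Delta> n)) = vcarrier (W_nat \<Delta> n)" "vadd (shift (W_nat \<Delta> n)) = vadd (W_nat \<Delta> n)"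
    "vscale (shift (W_nat \<Delta> n)) = vscale (W_nat \<Delta> n)" "vcomp (shift (W_nat \<Delta> n)) k = vcomp (W_nat \<Delta> n)
      (k - 1)"
    "vdiff (shift (W_nat \<Delta> n)) X = vscale (W_nat \<Delta> n) (- 1) (vdiff (W_nat \<Delta> n) X)" for k X
    by (simp_all add: shift_def)
  have "linear_map (I_nat \<Delta> n) (shift (W_nat \<Delta> n)) (CS \<Delta> n)"
    unfolding linear_map_def sh I.carrier W.carrier
    using Kweil I.Y_closed
    by (auto simp: CS_proj I.add I.scale W.add W.scale clinear_simps[OF clinear_cs_contraction]
        simp del: add_uminus_conv_diff)
  moreover have "CS \<Delta> n ` vcomp (I_nat \<Delta> n) k \<subseteq> vcomp (shift (W_nat \<Delta> n)) k" for k
    unfolding sh I.comp W.comp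
    using Kweil cs_contraction_weil_comp CS_proj by (fastforce)
  moreover have "CS \<Delta> n (vdiff (I_nat \<Delta> n) X) = vdiff (shift (W_nat \<Delta> n)) (CS \<Delta> n X)" if "X \<in> vcarrier
    (I_nat \<Delta> n)" for X
  proof -
    from that obtain x where x: "x \<in> curv_power (Suc n)" "X = I_proj \<Delta> n x" unfolding I.carrier by blast
    have "CS \<Delta> n (vdiff (I_nat \<Delta> n) X) = W_proj \<Delta> n (K (wd x))"
      unfolding x(2) I.diff[OF x(1)] by (rule CS_proj[OF I.D_Y[OF x(1)]])
    also have "\<dots> = W_proj \<Delta> n (- 1 *\<^sub>C wd (K x))"
    proof -
      have "K (wd x) - - 1 *\<^sub>C wd (K x) = x" using cs_wd[OF I_weil[OF x(1)]] by simp
      then show ?thesis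
        using W.eq_iff[OF Kweil[OF I.D_Y[OF x(1)]] W.Y_closed(3)[OF W.D_Y[OF Kweil[OF x(1)]]], of "-1"]
          I_subset_W_ker[OF x(1)]
        by simp
    qed
    also have "\<dots> = vdiff (shift (W_nat \<Delta> n)) (CS \<Delta> n X)"
      unfolding sh x(2) CS_proj[OF x(1)] W.diff[OF Kweil[OF x(1)]] by (rule W.scale[OF W.D_Y[OF Kweil[OF
        x(1)]], symmetric])
    finally show ?thesis .
  qed
  ultimately show ?thesis unfolding cochain_map_def by blast
qed

lemma cs_cyc:
  assumes "x \<in> I.cyc k"
  shows "K x \<in> W.cyc (k - 1)"
proof -
  have x: "x \<in> curv_power (Suc n)" "x \<in> weil_comp k" "wd x \<in> I_comm \<Delta> n" using assms by (auto simp: I.cyc_def)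
  have "wd (K x) \<in> W_ker n"
    unfolding cs_wd[OF I_weil[OF x(1)]]
    by (rule complex_vector.subspace_diff[OF W.subspace_Z I_subset_W_ker[OF x(1)] cs_I_comm[OF x(3)]])
  then show ?thesis
    using cs_contraction_weil[OF I_weil[OF x(1)]] cs_contraction_weil_comp[OF x(2)] by (simp add: W.cyc_def)
qed

text \<open>If u equals \<partial> y up to commutators, then K u equals y - \<partial> K y up to
  commutators, and y vanishes in W_n. So -K y is the primitive.\<close>

lemma cs_bnd:
  assumes "u \<in> I.bnd k"
  shows "K u \<in> W.bnd (k - 1)"
proof -
  obtain y where u: "u \<in> curv_power (Suc n)" "u \<in> weil_comp k" and y: "y \<in> curv_power (Suc n)" "y \<in>
    weil_comp (k - 1)"
    and c: "u - wd y \<in> I_comm \<Delta> n" using assms by (auto simp: I.bnd_def)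
  have "K u - wd (- K y) = K (u - wd y) + y"
    using cs_wd[OF I_weil[OF y(1)]]
    by (simp add: clinear_simps[OF clinear_wd] clinear_simps[OF clinear_cs_contraction])
  also have "\<dots> \<in> W_ker n"
    by (rule complex_vector.subspace_add[OF W.subspace_Z cs_I_comm[OF c] I_subset_W_ker[OF y(1)]])
  finally have "K u - wd (- K y) \<in> W_ker n" .
  moreover have "- K y \<in> weil \<inter> weil_comp (k - 1 - 1)"
    using cs_contraction_weil[OF I_weil[OF y(1)]] cs_contraction_weil_comp[OF y(2)]
    by (simp add: complex_vector.subspace_neg[OF W.subspace_Y] weil_comp_subspace)
  ultimately show ?thesis
    using cs_contraction_weil[OF I_weil[OF u(1)]] cs_contraction_weil_comp[OF u(2)] by (auto simp: W.bnd_def)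
qed

text \<open>Injectivity on cohomology. If z = K x - \<partial> y vanishes in the quotient, it splits
  as i + (t - 1) q with i in the ideal. Comparing \<partial> z = x - K \<partial> x with the
  boundary of this splitting gives x - \<partial> i = (t - 1) b q + K \<partial> x, and N kills both
  terms, so i is a primitive of x.\<close>

lemma cs_bnd_iff:
  assumes "x \<in> I.cyc k"
  shows "K x \<in> W.bnd (k - 1) \<longleftrightarrow> x \<in> I.bnd k"
proof
  assume "K x \<in> W.bnd (k - 1)"
  then obtain y where y: "y \<in> weil" "y \<in> weil_comp (k - 1 - 1)" and z: "K x - wd y \<in> W_ker n"
    by (auto simp: W.bnd_def)
  have x: "x \<in> curv_power (Suc n)" "x \<in> weil_comp k" "wd x \<in> I_comm \<Delta> n" using assms by (auto simp: I.cyc_def)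
  define z where "z = K x - wd y"
  define q where "q = cyc_Q z"
  define i where "i = cyc_P (cyc_N z)"
  have "z \<in> weil_comp (k - 1)"
    unfolding z_def using cs_contraction_weil_comp[OF x(2)] wd_weil_comp[OF y(2)] by (simp add:
      weil_comp_subspace)
  from weil_comp_cyc_ops(3)[OF weil_comp_cyc_ops(2)[OF this]]
  have i: "i \<in> curv_power (Suc n)" "i \<in> weil_comp (k - 1)"
    using z I_ops(2) by (auto simp: i_def z_def W_ker_iff)
  have z_eq: "z = i + (cyc_t q - q)"
    using cyc_decomposition[of z] z by (simp add: W_ker_iff z_def i_def q_def cyc_N_cyc_P)
  have "x = wd z + K (wd x)"
    using cs_wd[OF I_weil[OF x(1)]] by (simp add: z_def clinear_diff[OF clinear_wd])
  also have "\<dots> = wd i + (cyc_t (cyc_b \<Delta> q) - cyc_b \<Delta> q) + K (wd x)"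
    by (simp add: z_eq clinear_simps[OF clinear_wd] cyc_t_cyc_b)
  finally have "x - wd i = (cyc_t (cyc_b \<Delta> q) - cyc_b \<Delta> q) + K (wd x)" by (simp add: algebra_simps)
  then have "cyc_N (x - wd i) = 0"
    using x(3) cyc_N_cs_contraction[of "wd x"] I_weil
    by (simp add: clinear_simps[OF clinear_cyc_N] I_comm_iff)
  moreover have "x - wd i \<in> curv_power (Suc n)"
    using x(1) I.D_Y[OF i(1)] by (rule I.Y_closed(2))
  ultimately show "x \<in> I.bnd k"
    using x i unfolding I.bnd_def I_comm_iff by blast
next
  assume "x \<in> I.bnd k"
  then show "K x \<in> W.bnd (k - 1)" by (rule cs_bnd)
qed

text \<open>The preimage of y is its value under the connecting homomorphism: the part x in the
  ideal of \<partial> y = x + (t - 1) q. Applying the homotopy formula to y shows that y - K x is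
  \<partial> K y plus the contraction of a commutator.\<close>

lemma cs_surj:
  assumes "y \<in> W.cyc (k - 1)"
  shows "\<exists>x\<in>I.cyc k. y - K x \<in> W.bnd (k - 1)"
proof -
  have y: "y \<in> weil" "y \<in> weil_comp (k - 1)" "wd y \<in> weil" "cyc_N (wd y) \<in> curv_power (Suc n)"
    using assms by (auto simp: W.cyc_def W_ker_iff)
  define q where "q = cyc_Q (wd y)"
  define x where "x = cyc_P (cyc_N (wd y))"
  have q: "q \<in> weil" unfolding q_def using y(3) cyc_stable_ops(6)[OF cyc_stable_weil] by blast
  have tq: "cyc_t q - q \<in> weil" using q cyc_stable_ops(3)[OF cyc_stable_weil] W.Y_closed(2) by blast
  have dy: "wd y = x + (cyc_t q - q)"
    using cyc_decomposition[OF y(3)] by (simp add: q_def x_def cyc_N_cyc_P)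
  have "wd y \<in> weil_comp k" using wd_weil_comp[OF y(2)] by simp
  from weil_comp_cyc_ops(3)[OF weil_comp_cyc_ops(2)[OF this]]
  have x: "x \<in> curv_power (Suc n)" "x \<in> weil_comp k"
    using y(4) I_ops(2) by (auto simp: x_def)
  have "x = wd y - (cyc_t q - q)" using dy by simp
  then have "wd x = - (cyc_t (cyc_b \<Delta> q) - cyc_b \<Delta> q)" by (simp add: clinear_simps[OF clinear_wd] cyc_t_cyc_b)
  then have "cyc_N (wd x) = 0" by (simp add: clinear_simps[OF clinear_cyc_N])
  then have xc: "x \<in> I.cyc k" using x I.D_Y[OF x(1)] by (simp add: I.cyc_def I_comm_iff)
  have "y - K x = wd (K y) + K (cyc_t q - q)"
    using cs_wd[OF y(1)] arg_cong[OF dy, of K] by (simp add: clinear_simps[OF clinear_cs_contraction])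
  then have "y - K x - wd (K y) = K (cyc_t q - q)" by simp
  also have "\<dots> \<in> W_ker n"
    by (intro W_kerI cs_contraction_weil cyc_N_cs_contraction tq) (simp_all add: clinear_simps[OF
      clinear_cyc_N])
  finally have "y - K x \<in> W.bnd (k - 1)"
    using y cs_contraction_weil[OF y(1)] cs_contraction_weil_comp[OF y(2)]
      cs_contraction_weil[OF I_weil[OF x(1)]] cs_contraction_weil_comp[OF x(2)]
    by (auto simp: W.bnd_def W.Y_closed weil_comp_subspace)
  then show ?thesis using xc by blast
qed

lemma CS_cohom_class:
  assumes "x \<in> I.cyc k"
  shows "CS_cohom \<Delta> n k (cohom_class (I_nat \<Delta> n) k (I_proj \<Delta> n x)) = cohom_class (W_nat \<Delta> n) (k - 1)
    (W_proj \<Delta> n (K x))"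
proof -
  have x: "x \<in> curv_power (Suc n)" using assms by (auto simp: I.cyc_def)
  have "cohom_class (W_nat \<Delta> n) (k - 1) (CS \<Delta> n (I_proj \<Delta> n (x + u))) = cohom_class (W_nat \<Delta> n) (k - 1)
    (CS \<Delta> n (I_proj \<Delta> n x))"
    if "u \<in> I.bnd k" for u
  proof -
    have xu: "x + u \<in> I.cyc k"
      using assms that I.bnd_subset_cyc complex_vector.subspace_add[OF I.subspace_cyc] by blast
    then have "x + u \<in> curv_power (Suc n)" by (auto simp: I.cyc_def)
    then show ?thesis
      using HW.eq_iff[OF cs_cyc[OF xu] cs_cyc[OF assms]] cs_bnd[OF that]
      by (simp add: CS_proj[OF x] CS_proj clinear_add[OF clinear_cs_contraction])
  qed
  then show ?thesis
    unfolding CS_cohom_def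
    using I.induced_cohom_class[OF x, of k "\<lambda>X. cohom_class (W_nat \<Delta> n) (k - 1) (CS \<Delta> n X)"] CS_proj[OF
      x] by simp
qed

lemma CS_cohom_iso:
  "linear_iso (cohomology (I_nat \<Delta> n) k) (cohomology (W_nat \<Delta> n) (k - 1)) (CS_cohom \<Delta> n k)"
  by (rule linear_iso_presentation[OF I.cohomology_presentation W.cohomology_presentation
    clinear_cs_contraction
      cs_cyc cs_bnd_iff cs_surj CS_cohom_class])

text \<open>Data \<open>(K x, v, w)\<close> defining \<open>S\<close> on \<open>W\<^sub>n\<close> are lifted to \<open>W\<close>; the defects of their relations
  lie in \<open>I\<^sub>n\<close> and form the data \<open>(x, Q \<partial>x, m)\<close> defining \<open>S\<close> there, as for any connecting homomorphism.\<close>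

lemma CS_cohom_S:
  assumes "x \<in> I.cyc k"
  shows "CS_cohom \<Delta> n (k + 2) (S_I \<Delta> n k (cohom_class (I_nat \<Delta> n) k (I_proj \<Delta> n x))) =
    S_W \<Delta> n (k - 1) (cohom_class (W_nat \<Delta> n) (k - 1) (W_proj \<Delta> n (K x)))"
proof -
  have x: "x \<in> curv_power (Suc n)" "x \<in> weil_comp k" and dx: "wd x \<in> curv_power (Suc n)" "cyc_N (wd x) = 0"
    using assms by (auto simp: I.cyc_def I_comm_iff)
  have dxk: "wd x \<in> weil_comp (k + 1)" by (rule wd_weil_comp[OF x(2)])
  \<comment> \<open>Solves (t - 1) v = -K \<partial> x exactly; by the homotopy formula this is
    \<partial> K x up to x, that is, modulo the ideal.\<close>
  define v where "v = - cyc_Q (K (wd x))"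
  \<comment> \<open>Division of b v by N: by the decomposition, the remainder is (t - 1) Q b
    v.\<close>
  define w where "w = cyc_P (cyc_b \<Delta> v)"
  \<comment> \<open>The part of \<partial> w in the ideal, hence the value of the connecting
    homomorphism at the class of w.\<close>
  define m where "m = cyc_P (cyc_N (wd w))"
  define q where "q = cyc_Q (wd w)"
  have Kdx: "K (wd x) \<in> weil" "K (wd x) \<in> weil_comp k" "cyc_N (K (wd x)) = 0"
    using cs_contraction_weil[OF I_weil[OF dx(1)]] cs_contraction_weil_comp[OF dxk]
      cyc_N_cs_contraction[OF I_weil[OF dx(1)] dx(2)]
    by simp_all
  have v: "v \<in> weil" "v \<in> weil_comp k"
    using cyc_stable_ops(6)[OF cyc_stable_weil Kdx(1)] weil_comp_cyc_ops(4)[OF Kdx(2)]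
    by (simp_all add: v_def complex_vector.subspace_neg[OF W.subspace_Y] weil_comp_subspace)
  have tv: "cyc_t v - v = - K (wd x)"
    using cyc_N_eq_0_imp[OF Kdx(1,3)] by (simp add: v_def clinear_simps[OF clinear_cyc_t] algebra_simps)
  have bv: "cyc_b \<Delta> v \<in> weil" "cyc_b \<Delta> v \<in> weil_comp (k + 1)"
    using cyc_stable_ops(2)[OF cyc_stable_weil v(1)] cyc_b_weil_comp[OF v(2)] .
  have w: "w \<in> weil" "w \<in> weil_comp (k + 1)"
    unfolding w_def using cyc_stable_ops(5)[OF cyc_stable_weil bv(1)] weil_comp_cyc_ops(3)[OF bv(2)] .
  \<comment> \<open>\<partial> K \<partial> x = \<partial> x by the homotopy formula, because
    \<partial> squares to zero.\<close>
  have "cyc_t (cyc_b \<Delta> v) - cyc_b \<Delta> v = wd (cyc_t v - v)" by (simp add: cyc_t_cyc_b clinear_diff[OF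
    clinear_wd])
  also have "\<dots> = - wd x"
    unfolding tv using cs_wd[OF I_weil[OF dx(1)]] by (simp add: clinear_simps[OF clinear_wd]
      clinear_0[OF clinear_cs_contraction])
  finally have tbv: "cyc_t (cyc_b \<Delta> v) - cyc_b \<Delta> v = - wd x" .
  have "cyc_t (cyc_Q (cyc_b \<Delta> v)) - cyc_Q (cyc_b \<Delta> v) = - cyc_Q (wd x)"
    using arg_cong[OF tbv, of cyc_Q] by (simp add: cyc_t_cyc_Q clinear_simps[OF clinear_cyc_Q])
  moreover have "cyc_b \<Delta> v = cyc_N w + (cyc_t (cyc_Q (cyc_b \<Delta> v)) - cyc_Q (cyc_b \<Delta> v))"
    unfolding w_def by (rule cyc_decomposition[OF bv(1)])
  \<comment> \<open>The remainder is exactly -Q \<partial> x. It lies in the ideal, so the second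
    relation holds in W_n, and Q \<partial> x is the middle term of the data for I_n.\<close>
  ultimately have bvw: "cyc_b \<Delta> v - cyc_N w = - cyc_Q (wd x)"
    by (metis add_diff_cancel_left')
  have Ndw: "cyc_N (wd w) = cyc_b \<Delta> (cyc_Q (wd x))"
  proof -
    have "cyc_N (wd w) = cyc_b \<Delta> (- (cyc_b \<Delta> v - cyc_N w))"
      by (simp add: clinear_simps[OF clinear_cyc_b] cyc_b_cyc_b cyc_b_cyc_N)
    then show ?thesis unfolding bvw by simp
  qed
  have Qdx: "cyc_Q (wd x) \<in> curv_power (Suc n)" "cyc_Q (wd x) \<in> weil_comp (k + 1)"
    using I_ops(3)[OF dx(1)] weil_comp_cyc_ops(4)[OF dxk] .
  have dw: "wd w \<in> weil" "wd w \<in> weil_comp (k + 2)"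
    using cyc_stable_ops(1)[OF cyc_stable_weil w(1)] wd_weil_comp[OF w(2)] by (simp_all add: add.assoc)
  have m: "m \<in> curv_power (Suc n)" "m \<in> weil_comp (k + 2)"
    unfolding m_def using I_ops(2)[OF I_ops(4)[OF Qdx(1)]] weil_comp_cyc_ops(3)[OF
      weil_comp_cyc_ops(2)[OF dw(2)]]
    by (simp_all add: Ndw)
  have q: "q \<in> weil" unfolding q_def using cyc_stable_ops(6)[OF cyc_stable_weil dw(1)] .
  have tq: "cyc_t q - q \<in> weil" using cyc_stable_ops(3)[OF cyc_stable_weil q] q by (rule W.Y_closed(2))
  have dw_eq: "wd w = m + (cyc_t q - q)"
    using cyc_decomposition[OF dw(1)] by (simp add: m_def q_def cyc_N_cyc_P)
  have Nm: "cyc_N m = cyc_N (wd w)" by (simp add: dw_eq clinear_simps[OF clinear_cyc_N])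
  have S_I: "S_I \<Delta> n k (cohom_class (I_nat \<Delta> n) k (I_proj \<Delta> n x)) = cohom_class (I_nat \<Delta> n) (k + 2)
    (I_proj \<Delta> n m)"
  proof -
    have ops: "op_t (I_alg \<Delta> n) = cyc_t" "op_b (I_alg \<Delta> n) = cyc_b \<Delta>" "op_N (I_alg \<Delta> n) = cyc_N"
      by (simp_all add: I_alg_def sub_algebra_def weil1_alg_def)
    have 1: "wd x - (cyc_t (cyc_Q (wd x)) - cyc_Q (wd x)) \<in> {0}"
      using cyc_N_eq_0_imp[OF I_weil[OF dx(1)] dx(2)] by simp
    have 2: "cyc_b \<Delta> (cyc_Q (wd x)) - cyc_N m \<in> {0}" by (simp add: Nm Ndw)
    have C: "I_comm \<Delta> n = {x \<in> curv_power (Suc n). cyc_N x \<in> {0}}" by (simp add: I_comm_eq)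
    show ?thesis
      unfolding S_I_def I_nat_def I_proj_def
      by (rule S_op_class[OF I_alg_presentation cyc_stable_curv_power cyc_stable_zero _ _ _ C x Qdx m 1
        2, unfolded image_ident])
        (simp_all add: ops)
  qed
  have S_W: "S_W \<Delta> n (k - 1) (cohom_class (W_nat \<Delta> n) (k - 1) (W_proj \<Delta> n (K x))) =
      cohom_class (W_nat \<Delta> n) (k - 1 + 2) (W_proj \<Delta> n w)"
  proof -
    have u: "K x \<in> weil" "K x \<in> weil_comp (k - 1)"
      using cs_contraction_weil[OF I_weil[OF x(1)]] cs_contraction_weil_comp[OF x(2)] .
    have v': "v \<in> weil_comp (k - 1 + 1)" and w': "w \<in> weil_comp (k - 1 + 2)" using v w by (simp_all add:
      add.commute)
    have 1: "wd (K x) - (cyc_t v - v) \<in> curv_power (Suc n)"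
      unfolding tv using cs_wd[OF I_weil[OF x(1)]] x(1) by simp
    have 2: "cyc_b \<Delta> v - cyc_N w \<in> curv_power (Suc n)"
      unfolding bvw by (rule complex_vector.subspace_neg[OF I.subspace_Y Qdx(1)])
    show ?thesis
      unfolding S_W_def W_nat_def W_proj_def W_comm_eq Suc_eq_plus1[symmetric] W_pi_def[symmetric]
      by (rule S_op_class[OF W_alg_presentation cyc_stable_weil cyc_stable_curv_power W_alg_ops
        W_ker_def u v(1) v' w(1) w' 1 2])
  qed
  have "cyc_N (wd m) = 0"
  proof -
    have "m = wd w - (cyc_t q - q)" using dw_eq by simp
    then have "wd m = - (cyc_t (cyc_b \<Delta> q) - cyc_b \<Delta> q)" by (simp add: clinear_simps[OF clinear_wd]
      cyc_t_cyc_b)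
    then show ?thesis by (simp add: clinear_simps[OF clinear_cyc_N])
  qed
  then have mc: "m \<in> I.cyc (k + 2)" using m I.D_Y[OF m(1)] by (simp add: I.cyc_def I_comm_iff)
  \<comment> \<open>The homotopy formula at w, with \<partial> w split into m and a commutator;
    hence K m and w are cohomologous in the quotient of W_n.\<close>
  have "w - K m = wd (K w) + K (cyc_t q - q)"
    using cs_wd[OF w(1)] arg_cong[OF dw_eq, of K] by (simp add: clinear_simps[OF clinear_cs_contraction])
  then have "K m - w - wd (- K w) = - K (cyc_t q - q)"
    by (simp add: clinear_simps[OF clinear_wd] algebra_simps)
  also have "\<dots> \<in> W_ker n"
    by (intro complex_vector.subspace_neg[OF W.subspace_Z] W_kerI cs_contraction_weil cyc_N_cs_contraction tq)
      (simp_all add: clinear_simps[OF clinear_cyc_N])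
  finally have diff: "K m - w - wd (- K w) \<in> W_ker n" .
  have Km: "K m \<in> W.cyc (k + 1)" using cs_cyc[OF mc] by (simp add: add.commute)
  have Kw: "- K w \<in> weil \<inter> weil_comp k"
    using cs_contraction_weil[OF w(1)] cs_contraction_weil_comp[OF w(2)]
    by (simp add: complex_vector.subspace_neg[OF W.subspace_Y] weil_comp_subspace)
  have bnd: "K m - w \<in> W.bnd (k + 1)"
    using diff Kw Km w by (auto simp: W.bnd_def W.cyc_def W.Y_closed weil_comp_subspace)
  then have "K m - (K m - w) \<in> W.cyc (k + 1)"
    using W.bnd_subset_cyc complex_vector.subspace_diff[OF W.subspace_cyc Km] by blast
  then have wc: "w \<in> W.cyc (k + 1)" by simp
  have "cohom_class (W_nat \<Delta> n) (k + 1) (W_proj \<Delta> n (K m)) = cohom_class (W_nat \<Delta> n) (k + 1) (W_proj \<Delta> n w)"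
    using HW.eq_iff[OF Km wc] bnd by blast
  moreover have idx: "k + 2 - 1 = k + 1" "k - 1 + 2 = k + 1" by simp_all
  ultimately show ?thesis
    unfolding S_I S_W CS_cohom_class[OF mc] idx by (simp only:)
qed

text \<open>\<open>CS\<close> and \<open>CS_cohom\<close> arise from \<open>induced\<close>, which
  extracts the element of a singleton image. The clauses on representatives certify that these
  values are the intended ones and not an unspecified default.\<close>

theorem chern_simons_isomorphism:
  "(\<forall>x\<in>vcarrier (I_alg \<Delta> n).
      K x \<in> weil \<and> CS \<Delta> n (I_proj \<Delta> n x) = W_proj \<Delta> n (K x)) \<and>
    cochain_map (I_nat \<Delta> n) (shift (W_nat \<Delta> n)) (CS \<Delta> n) \<and>
    (\<forall>k. (\<forall>X\<in>cocycles (I_nat \<Delta> n) k.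
            CS_cohom \<Delta> n k (cohom_class (I_nat \<Delta> n) k X) = cohom_class (W_nat \<Delta> n) (k - 1) (CS \<Delta> n X)) \<and>
         linear_iso (cohomology (I_nat \<Delta> n) k) (cohomology (W_nat \<Delta> n) (k - 1)) (CS_cohom \<Delta> n k) \<and>
         (\<forall>\<xi>\<in>vcarrier (cohomology (I_nat \<Delta> n) k).
            CS_cohom \<Delta> n (k + 2) (S_I \<Delta> n k \<xi>) = S_W \<Delta> n (k - 1) (CS_cohom \<Delta> n k \<xi>)))"
proof (intro conjI allI ballI)
  fix x assume "x \<in> vcarrier (I_alg \<Delta> n)"
  then have x: "x \<in> curv_power (Suc n)" by (simp add: I_alg_def sub_algebra_def)
  show "K x \<in> weil" by (rule cs_contraction_weil[OF I_weil[OF x]])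
  show "CS \<Delta> n (I_proj \<Delta> n x) = W_proj \<Delta> n (K x)" by (rule CS_proj[OF x])
next
  fix k X assume "X \<in> cocycles (I_nat \<Delta> n) k"
  then obtain x where x: "X = I_proj \<Delta> n x" "x \<in> I.cyc k" unfolding I.cocycles_eq by blast
  then have "x \<in> curv_power (Suc n)" by (auto simp: I.cyc_def)
  then show "CS_cohom \<Delta> n k (cohom_class (I_nat \<Delta> n) k X) = cohom_class (W_nat \<Delta> n) (k - 1) (CS \<Delta> n X)"
    unfolding x(1) by (simp only: CS_cohom_class[OF x(2)] CS_proj)
next
  fix k \<xi> assume "\<xi> \<in> vcarrier (cohomology (I_nat \<Delta> n) k)"
  then obtain x where x: "\<xi> = cohom_class (I_nat \<Delta> n) k (I_proj \<Delta> n x)" "x \<in> I.cyc k" unfolding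
    HI.carrier by blast
  show "CS_cohom \<Delta> n (k + 2) (S_I \<Delta> n k \<xi>) = S_W \<Delta> n (k - 1) (CS_cohom \<Delta> n k \<xi>)"
    unfolding x(1) CS_cohom_class[OF x(2)] by (rule CS_cohom_S[OF x(2)])
qed (rule CS_cochain_map CS_cohom_iso)+

end

end

theorem theorem6p7:
  fixes \<Delta> :: "'h::complex_vector \<Rightarrow> 'h tensor_algebra" and \<epsilon> :: "'h \<Rightarrow> complex" and n :: nat
  assumes "coalgebra \<Delta> \<epsilon>"
  shows "(\<forall>x\<in>vcarrier (I_alg \<Delta> n).
            cs_contraction \<Delta> x \<in> weil \<and>
            CS \<Delta> n (I_proj \<Delta> n x) = W_proj \<Delta> n (cs_contraction \<Delta> x)) \<and>
    cochain_map (I_nat \<Delta> n) (shift (W_nat \<Delta> n)) (CS \<Delta> n) \<and>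
    (\<forall>k. (\<forall>X\<in>cocycles (I_nat \<Delta> n) k.
            CS_cohom \<Delta> n k (cohom_class (I_nat \<Delta> n) k X)
              = cohom_class (W_nat \<Delta> n) (k - 1) (CS \<Delta> n X)) \<and>
         linear_iso (cohomology (I_nat \<Delta> n) k) (cohomology (W_nat \<Delta> n) (k - 1)) (CS_cohom \<Delta> n k) \<and>
         (\<forall>\<xi>\<in>vcarrier (cohomology (I_nat \<Delta> n) k).
            CS_cohom \<Delta> n (k + 2) (S_I \<Delta> n k \<xi>) = S_W \<Delta> n (k - 1) (CS_cohom \<Delta> n k \<xi>)))"
  by (rule coalgebra.chern_simons_isomorphism[OF assms])

end
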